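(* Let $n\ge1$, let $0\le\alpha_1\le\cdots\le\alpha_n<1$ be real numbers, let $\gamma=-\sum_{i=1}^n\alpha_i$, and let $\mathcal H=\mathcal H(\alpha_i;\emptyset)=\mathcal D_{\mathbb G_{m,t}}/\big(\prod_{i=1}^n(t\partial_t-\alpha_i)-t\big)$. For $k=1,\dots,n$ set $\rho(k)=-n\alpha_k+k$. Then the jumping numbers of the irregular Hodge filtration of $\mathcal H$ are, up to an overall real shift, the numbers $\rho(k)$, and the irregular Hodge numbers are the multiplicities of those jumping numbers, i.e. the nonzero values of $|\rho^{-1}(x)|$ for $x\in\mathbb R$. Moreover, for $r=0,\dots,n-1$ and $\alpha\in\mathbb R$ put $\nu_\alpha(r)=\lceil-\alpha+r-\gamma-n\alpha_{r+1}\rceil$ and let $\bar Q_r$ be the class in $\mathcal H$ of $(-n)^r\prod_{i=1}^r(t\partial_t-\alpha_i)$. Then the irregular Hodge filtration $F^{\mathrm{irr}}_\bullet\mathcal H$ is given, for $\alpha\in\mathbb R$ and $j\in\mathbb Z$, by $$F^{\mathrm{irr}}_{\alpha+j}\mathcal H=\bigoplus_{0\le k\le n-1,\ j\ge\nu_\alpha(k)}\mathcal O_{\mathbb G_{m,t}}\,\bar Q_k .$$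
   Context: $\mathbb G_{m,t}=\operatorname{Spec}\mathbb C[t^{\pm1}]$. For a smooth variety $X$, $\mathcal R^{\mathrm{int}}_{\mathbb A^1_z\times X}$ is the subalgebra of $\mathcal D_{\mathbb A^1_z\times X}$ generated over $\mathcal O$ by $z^2\partial_z$ and $z\partial_{x_i}$ ($x_i$ local coordinates of $X$); without $z^2\partial_z$ one gets $\mathcal R_{\mathbb A^1_z\times X}$. The module $\mathcal H$ underlies an irregular mixed Hodge module in the sense of Sabbah, given by the $\mathcal R^{\mathrm{int}}$-module $$\widehat{\mathcal H}=\mathcal R^{\mathrm{int}}_{\mathbb A^1_z\times\mathbb G_{m,t}}/\Big(z^2\partial_z+ntz\partial_t+\gamma z,\ \prod_{i=1}^nz(t\partial_t-\alpha_i)-t\Big),$$ with $\widehat{\mathcal H}/(z-1)\widehat{\mathcal H}=\mathcal H$. Its irregular Hodge filtration is defined as follows. Let $\mathcal X=\mathbb A^1_z\times\mathbb G_{m,t}$, ${}^\theta\mathcal X=\mathcal X\times\mathbb G_{m,\theta}$, $\tau=1/\theta$, ${}^\tau\mathcal X=\mathcal X\times\mathbb A^1_\tau$, ${}^\tau\mathcal X_0=\{\tau=0\}$. Let $\mu:{}^\theta\mathcal X\to\mathcal X$, $(z,t,\theta)\mapsto(z\theta,t)$. The rescaled module ${}^\theta\widehat{\mathcal H}=\mu^*\widehat{\mathcal H}$ has the $\mathcal R^{\mathrm{int}}_{{}^\theta\mathcal X}$-action given by the chain rule; regarded as a module over $\mathcal R^{\mathrm{int}}_{{}^\tau\mathcal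 X}( *{}^\tau\mathcal X_0)$ it is denoted ${}^\tau\widehat{\mathcal H}$. It has a canonical increasing $V$-filtration ${}^\tau V_\alpha{}^\tau\widehat{\mathcal H}$ ($\alpha\in\mathbb R$) along $\tau=0$: the steps are coherent over $\mathcal O_{{}^\tau\mathcal X}\langle z\partial_t,z\tau\partial_\tau\rangle$, $\tau\,{}^\tau V_\alpha={}^\tau V_{\alpha-1}$, the graded pieces are strict (no $z$-torsion, i.e. no $\mathbb C[z]$-torsion), and $z\tau\partial_\tau+\alpha z$ is nilpotent on $\operatorname{Gr}^{{}^\tau V}_\alpha$. Restricting to $\tau=z$ one has a canonical identification of ${}^\theta\widehat{\mathcal H}|_{\tau=z}$ with $\mathcal H[z,z^{-1}]$, and ${}^\tau V_\alpha/(\tau-z){}^\tau V_\alpha$ is a $z$-graded submodule; the irregular Hodge filtration is defined by $${}^\tau V_\alpha/(\tau-z){}^\tau V_\alpha=\bigoplus_{p\in\mathbb Z}F^{\mathrm{irr}}_{\alpha+p}\mathcal H\cdot z^p .$$ A jumping number of $F^{\mathrm{irr}}_\bullet$ is $x\in\mathbb R$ with $\operatorname{gr}^{F^{\mathrm{irr}}}_x\mathcal H=F^{\mathrm{irr}}_x/F^{\mathrm{irr}}_{<x}\ne0$, and its multiplicity (irregular Hodge number) is the rank of this graded piece over $\mathcal O_{\mathbb G_{m,t}}$. *)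

theory Defs
  imports
    Complex_Main
    "HOL-Algebra.Algebra"
    "HOL-Library.Poly_Mapping"
    "HOL-Library.Product_Plus"
    "HOL-Library.Extended_Nat"
begin

text \<open>
  All varieties involved are affine, so sheaves are replaced by their modules of global sections.
  Coordinate rings are monoid algebras: a monomial is identified with its exponent tuple,
  with \<open>nat\<close> for polynomial and \<open>int\<close> for invertible variables.
\<close>

type_synonym O_t = "int \<Rightarrow>\<^sub>0 complex"
type_synonym O_zt = "(nat \<times> int) \<Rightarrow>\<^sub>0 complex"
type_synonym O_zt\<theta> = "(nat \<times> int \<times> int) \<Rightarrow>\<^sub>0 complex"

abbreviation cst :: "complex \<Rightarrow> ('k::comm_monoid_add \<Rightarrow>\<^sub>0 complex)"
  where "cst c \<equiv> Poly_Mapping.single 0 c"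

abbreviation mon :: "'k \<Rightarrow> ('k \<Rightarrow>\<^sub>0 complex)"
  where "mon k \<equiv> Poly_Mapping.single k 1"

definition monomial_deriv :: "('k \<Rightarrow> int) \<Rightarrow> ('k \<Rightarrow> 'k) \<Rightarrow> ('k \<Rightarrow>\<^sub>0 complex) \<Rightarrow> ('k \<Rightarrow>\<^sub>0 complex)"
  where "monomial_deriv e s f =
    (\<Sum>k\<in>Poly_Mapping.keys f. Poly_Mapping.single (s k) (of_int (e k) * Poly_Mapping.lookup f k))"

text \<open>In \<open>d_z\<close> the truncated subtraction is harmless: for exponent 0 the coefficient vanishes.\<close>

definition d_t :: "O_t \<Rightarrow> O_t"
  where "d_t = monomial_deriv (\<lambda>b. b) (\<lambda>b. b - 1)"

definition d_z :: "O_zt \<Rightarrow> O_zt"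
  where "d_z = monomial_deriv (\<lambda>(a, b). int a) (\<lambda>(a, b). (a - 1, b))"

definition d_t' :: "O_zt \<Rightarrow> O_zt"
  where "d_t' = monomial_deriv (\<lambda>(a, b). b) (\<lambda>(a, b). (a, b - 1))"

definition d_t'' :: "O_zt\<theta> \<Rightarrow> O_zt\<theta>"
  where "d_t'' = monomial_deriv (\<lambda>(a, b, d). b) (\<lambda>(a, b, d). (a, b - 1, d))"

definition d_\<theta> :: "O_zt\<theta> \<Rightarrow> O_zt\<theta>"
  where "d_\<theta> = monomial_deriv (\<lambda>(a, b, d). d) (\<lambda>(a, b, d). (a, b, d - 1))"


section \<open>Rings of differential operators and modules over them\<close>

definition End_C :: "(('k::comm_monoid_add \<Rightarrow>\<^sub>0 complex) \<Rightarrow> ('k \<Rightarrow>\<^sub>0 complex)) ring"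
  where "End_C = \<lparr>
    carrier = {T. (\<forall>f g. T (f + g) = T f + T g) \<and> (\<forall>c f. T (cst c * f) = cst c * T f)},
    monoid.mult = (\<circ>), one = id, ring.zero = (\<lambda>_. 0), add = (\<lambda>S T f. S f + T f)\<rparr>"

text \<open>Differential operators act faithfully on functions (characteristic 0); the algebra generated
  over the functions by a set of operators is taken inside the linear endomorphisms.\<close>

definition diff_ops :: "(('k::comm_monoid_add \<Rightarrow>\<^sub>0 complex) \<Rightarrow> ('k \<Rightarrow>\<^sub>0 complex)) set
    \<Rightarrow> (('k \<Rightarrow>\<^sub>0 complex) \<Rightarrow> ('k \<Rightarrow>\<^sub>0 complex)) ring"
  where "diff_ops G = End_C\<lparr>carrier := generate_ring End_C (range (*) \<union> G)\<rparr>"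

text \<open>Left modules are records of type \<open>module\<close>, whose fields \<open>mult\<close> and \<open>one\<close> are irrelevant;
  the scalars may be noncommutative, and the locale of the same name is not used.\<close>

definition left_ideal :: "('r, 'm) ring_scheme \<Rightarrow> 'r set \<Rightarrow> 'r set"
  where "left_ideal R S =
    generate (add_monoid R) {r \<otimes>\<^bsub>R\<^esub> s | r s. r \<in> carrier R \<and> s \<in> S}"

definition regular_module :: "'r ring \<Rightarrow> ('r, 'r) module"
  where "regular_module R = \<lparr>carrier = carrier R, monoid.mult = undefined, one = undefined,
    ring.zero = \<zero>\<^bsub>R\<^esub>, add = (\<oplus>\<^bsub>R\<^esub>), smult = (\<otimes>\<^bsub>R\<^esub>)\<rparr>"

definition induced_op :: "('s, 'a) module \<Rightarrow> 'a set \<Rightarrow> ('a \<Rightarrow> 'a) \<Rightarrow> 'a set \<Rightarrow> 'a set"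
  where "induced_op M N T C = (\<Union>x\<in>C. N +>\<^bsub>M\<^esub> T x)"

definition quot_module :: "('s, 'a) module \<Rightarrow> 'a set \<Rightarrow> ('s, 'a set) module"
  where "quot_module M N = \<lparr>carrier = a_rcosets\<^bsub>M\<^esub> N, monoid.mult = undefined, one = undefined,
    ring.zero = N, add = (<+>\<^bsub>M\<^esub>), smult = (\<lambda>r. induced_op M N (smult M r))\<rparr>"

definition restrict_scalars :: "('r \<Rightarrow> 's) \<Rightarrow> ('s, 'a) module \<Rightarrow> ('r, 'a) module"
  where "restrict_scalars \<phi> M = \<lparr>carrier = carrier M, monoid.mult = undefined, one = undefined,
    ring.zero = \<zero>\<^bsub>M\<^esub>, add = (\<oplus>\<^bsub>M\<^esub>), smult = (\<lambda>r. smult M (\<phi> r))\<rparr>"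

text \<open>The tensor product \<open>B \<otimes>\<^sub>A M\<close> along \<open>\<phi> : A \<rightarrow> B\<close>: the free abelian group on \<open>B \<times> M\<close>,
  with \<open>B\<close> acting on the first factor, modulo the usual relations.\<close>

definition tensor_free :: "('a, 'm) module \<Rightarrow> ('b::comm_ring_1, ('b \<times> 'm) \<Rightarrow>\<^sub>0 int) module"
  where "tensor_free M = \<lparr>carrier = {x. Poly_Mapping.keys x \<subseteq> UNIV \<times> carrier M},
    monoid.mult = undefined, one = undefined, ring.zero = 0, add = (+),
    smult = (\<lambda>b. frag_extend (\<lambda>(f, m). frag_of (b * f, m)))\<rparr>"

definition tensor_rel ::
    "('a \<Rightarrow> 'b) \<Rightarrow> ('a, 'm) module \<Rightarrow> (('b::comm_ring_1 \<times> 'm) \<Rightarrow>\<^sub>0 int) set"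
  where "tensor_rel \<phi> M = generate (add_monoid (tensor_free M :: ('b, ('b \<times> 'm) \<Rightarrow>\<^sub>0 int) module))
    ({frag_of (f + g, m) - frag_of (f, m) - frag_of (g, m) | f g m. m \<in> carrier M}
     \<union> {frag_of (f, m \<oplus>\<^bsub>M\<^esub> m') - frag_of (f, m) - frag_of (f, m') | f m m'.
          m \<in> carrier M \<and> m' \<in> carrier M}
     \<union> {frag_of (f * \<phi> a, m) - frag_of (f, a \<odot>\<^bsub>M\<^esub> m) | f a m. m \<in> carrier M})"

definition tensor ::
    "('a \<Rightarrow> 'b) \<Rightarrow> ('a, 'm) module \<Rightarrow> ('b::comm_ring_1, (('b \<times> 'm) \<Rightarrow>\<^sub>0 int) set) module"
  where "tensor \<phi> M = quot_module (tensor_free M) (tensor_rel \<phi> M)"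

text \<open>Rank of a module over a domain: the maximal number of linearly independent elements.\<close>

definition lin_indep :: "('a::comm_ring_1, 'm) module \<Rightarrow> 'm set \<Rightarrow> bool"
  where "lin_indep M S \<longleftrightarrow>
    (\<forall>c. (\<Oplus>\<^bsub>M\<^esub>s\<in>S. c s \<odot>\<^bsub>M\<^esub> s) = \<zero>\<^bsub>M\<^esub> \<longrightarrow> (\<forall>s\<in>S. c s = 0))"

definition rank :: "('a::comm_ring_1, 'm) module \<Rightarrow> enat"
  where "rank M = (SUP S\<in>{S. finite S \<and> S \<subseteq> carrier M \<and> lin_indep M S}. enat (card S))"

definition is_internal_direct_sum ::
    "('s, 'm) module \<Rightarrow> 'i set \<Rightarrow> ('i \<Rightarrow> 'm set) \<Rightarrow> 'm set \<Rightarrow> bool"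
  where "is_internal_direct_sum M I N S \<longleftrightarrow>
    S = {\<Oplus>\<^bsub>M\<^esub>i\<in>I. x i | x. x \<in> (\<Pi> i\<in>I. N i)} \<and>
    (\<forall>x\<in>(\<Pi> i\<in>I. N i). (\<Oplus>\<^bsub>M\<^esub>i\<in>I. x i) = \<zero>\<^bsub>M\<^esub> \<longrightarrow> (\<forall>i\<in>I. x i = \<zero>\<^bsub>M\<^esub>))"


section \<open>The hypergeometric modules\<close>

text \<open>The composite of the operators \<open>L 1, \<dots>, L r\<close> (which commute in all uses below).\<close>

definition op_prod :: "(nat \<Rightarrow> 'a \<Rightarrow> 'a) \<Rightarrow> nat \<Rightarrow> 'a \<Rightarrow> 'a"
  where "op_prod L r = foldr (\<circ>) (map L [1..<Suc r]) id"

definition gam :: "nat \<Rightarrow> (nat \<Rightarrow> real) \<Rightarrow> real"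
  where "gam n a = - (\<Sum>i=1..n. a i)"

definition D_Gm :: "(O_t \<Rightarrow> O_t) ring"
  where "D_Gm = diff_ops {d_t}"

definition tdt_shift :: "real \<Rightarrow> O_t \<Rightarrow> O_t"
  where "tdt_shift c f = mon 1 * d_t f - cst (of_real c) * f"

definition hyp_op :: "nat \<Rightarrow> (nat \<Rightarrow> real) \<Rightarrow> O_t \<Rightarrow> O_t"
  where "hyp_op n a f = op_prod (\<lambda>i. tdt_shift (a i)) n f - mon 1 * f"

definition hyp_ideal :: "nat \<Rightarrow> (nat \<Rightarrow> real) \<Rightarrow> (O_t \<Rightarrow> O_t) set"
  where "hyp_ideal n a = left_ideal D_Gm {hyp_op n a}"

definition hypH :: "nat \<Rightarrow> (nat \<Rightarrow> real) \<Rightarrow> (O_t \<Rightarrow> O_t, (O_t \<Rightarrow> O_t) set) module"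
  where "hypH n a = quot_module (regular_module D_Gm) (hyp_ideal n a)"

definition hypH_class :: "nat \<Rightarrow> (nat \<Rightarrow> real) \<Rightarrow> (O_t \<Rightarrow> O_t) \<Rightarrow> (O_t \<Rightarrow> O_t) set"
  where "hypH_class n a P = hyp_ideal n a +>\<^bsub>D_Gm\<^esub> P"

definition hypH_O :: "nat \<Rightarrow> (nat \<Rightarrow> real) \<Rightarrow> (O_t, (O_t \<Rightarrow> O_t) set) module"
  where "hypH_O n a = restrict_scalars (*) (hypH n a)"

definition z2dz :: "O_zt \<Rightarrow> O_zt"
  where "z2dz f = mon (2, 0) * d_z f"

definition zdt :: "O_zt \<Rightarrow> O_zt"
  where "zdt f = mon (1, 0) * d_t' f"

definition R_int :: "(O_zt \<Rightarrow> O_zt) ring"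
  where "R_int = diff_ops {z2dz, zdt}"

definition ztdt_shift :: "real \<Rightarrow> O_zt \<Rightarrow> O_zt"
  where "ztdt_shift c f = mon (1, 0) * (mon (0, 1) * d_t' f - cst (of_real c) * f)"

definition hyp_rel_z :: "nat \<Rightarrow> (nat \<Rightarrow> real) \<Rightarrow> O_zt \<Rightarrow> O_zt"
  where "hyp_rel_z n a f =
    z2dz f + of_nat n * mon (0, 1) * zdt f + cst (of_real (gam n a)) * mon (1, 0) * f"

definition hyp_rel_t :: "nat \<Rightarrow> (nat \<Rightarrow> real) \<Rightarrow> O_zt \<Rightarrow> O_zt"
  where "hyp_rel_t n a f = op_prod (\<lambda>i. ztdt_shift (a i)) n f - mon (0, 1) * f"

definition Hhat_ideal :: "nat \<Rightarrow> (nat \<Rightarrow> real) \<Rightarrow> (O_zt \<Rightarrow> O_zt) set"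
  where "Hhat_ideal n a = left_ideal R_int {hyp_rel_z n a, hyp_rel_t n a}"

definition Hhat :: "nat \<Rightarrow> (nat \<Rightarrow> real) \<Rightarrow> (O_zt \<Rightarrow> O_zt, (O_zt \<Rightarrow> O_zt) set) module"
  where "Hhat n a = quot_module (regular_module R_int) (Hhat_ideal n a)"

definition Hhat_O :: "nat \<Rightarrow> (nat \<Rightarrow> real) \<Rightarrow> (O_zt, (O_zt \<Rightarrow> O_zt) set) module"
  where "Hhat_O n a = restrict_scalars (*) (Hhat n a)"

text \<open>The projection onto \<open>Hhat/(z-1)Hhat = hypH\<close>: the map sending the class of 1 to the class
  of 1 and inducing an isomorphism of D-modules, where \<open>\<partial>\<^sub>t\<close> acts on \<open>Hhat/(z-1)Hhat\<close> as \<open>z\<partial>\<^sub>t\<close>.\<close>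

definition ev_z1 :: "O_zt \<Rightarrow> O_t"
  where "ev_z1 f = (\<Sum>(a, b)\<in>Poly_Mapping.keys f.
    Poly_Mapping.single b (Poly_Mapping.lookup f (a, b)))"

definition is_specialization ::
    "nat \<Rightarrow> (nat \<Rightarrow> real) \<Rightarrow> ((O_zt \<Rightarrow> O_zt) set \<Rightarrow> (O_t \<Rightarrow> O_t) set) \<Rightarrow> bool"
  where "is_specialization n a \<sigma> \<longleftrightarrow>
    \<sigma> \<in> carrier (Hhat n a) \<rightarrow>\<^sub>E carrier (hypH n a) \<and>
    \<sigma> (Hhat_ideal n a +>\<^bsub>R_int\<^esub> id) = hypH_class n a id \<and>
    (\<forall>m\<in>carrier (Hhat n a). \<forall>m'\<in>carrier (Hhat n a).
       \<sigma> (m \<oplus>\<^bsub>Hhat n a\<^esub> m') = \<sigma> m \<oplus>\<^bsub>hypH n a\<^esub> \<sigma> m') \<and>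
    (\<forall>f. \<forall>m\<in>carrier (Hhat n a). \<sigma> (f \<odot>\<^bsub>Hhat_O n a\<^esub> m) = ev_z1 f \<odot>\<^bsub>hypH_O n a\<^esub> \<sigma> m) \<and>
    (\<forall>m\<in>carrier (Hhat n a). \<sigma> (zdt \<odot>\<^bsub>Hhat n a\<^esub> m) = d_t \<odot>\<^bsub>hypH n a\<^esub> \<sigma> m) \<and>
    \<sigma> ` carrier (Hhat n a) = carrier (hypH n a) \<and>
    {m\<in>carrier (Hhat n a). \<sigma> m = \<zero>\<^bsub>hypH n a\<^esub>}
      = smult (Hhat_O n a) (mon (1, 0) - 1) ` carrier (Hhat n a)"

definition specialization ::
    "nat \<Rightarrow> (nat \<Rightarrow> real) \<Rightarrow> (O_zt \<Rightarrow> O_zt) set \<Rightarrow> (O_t \<Rightarrow> O_t) set"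
  where "specialization n a = (THE \<sigma>. is_specialization n a \<sigma>)"


section \<open>The rescaled module\<close>

type_synonym presc = "(O_zt\<theta> \<times> (O_zt \<Rightarrow> O_zt) set) \<Rightarrow>\<^sub>0 int"

text \<open>Pullback of functions along \<open>\<mu>(z, t, \<theta>) = (z\<theta>, t)\<close>.\<close>

definition mu_pull :: "O_zt \<Rightarrow> O_zt\<theta>"
  where "mu_pull f = (\<Sum>(a, b)\<in>Poly_Mapping.keys f.
    Poly_Mapping.single (a, b, int a) (Poly_Mapping.lookup f (a, b)))"

definition rescaled :: "nat \<Rightarrow> (nat \<Rightarrow> real) \<Rightarrow> (O_zt\<theta>, presc set) module"
  where "rescaled n a = tensor mu_pull (Hhat_O n a)"

text \<open>The operator on the pullback determined by \<open>f \<otimes> m \<mapsto> d f \<otimes> m + f g \<otimes> P m\<close>.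
  With \<open>w = z\<theta>\<close> the chain rule reads \<open>z\<partial>\<^sub>t(1 \<otimes> m) = \<theta>\<^sup>-\<^sup>1 \<otimes> (w\<partial>\<^sub>t)m\<close> and
  \<open>z\<partial>\<^sub>\<theta>(1 \<otimes> m) = z\<^sup>2 \<otimes> \<partial>\<^sub>w m = \<theta>\<^sup>-\<^sup>2 \<otimes> (w\<^sup>2\<partial>\<^sub>w)m\<close>. The remaining generator \<open>z\<^sup>2\<partial>\<^sub>z\<close> plays no role in
  the V-filtration.\<close>

definition chain_rule_op :: "nat \<Rightarrow> (nat \<Rightarrow> real) \<Rightarrow> (O_zt\<theta> \<Rightarrow> O_zt\<theta>) \<Rightarrow> O_zt\<theta>
    \<Rightarrow> (O_zt \<Rightarrow> O_zt) \<Rightarrow> presc set \<Rightarrow> presc set"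
  where "chain_rule_op n a d g P =
    induced_op (tensor_free (Hhat_O n a)) (tensor_rel mu_pull (Hhat_O n a))
      (frag_extend (\<lambda>(f, m). frag_of (d f, m) + frag_of (f * g, P \<odot>\<^bsub>Hhat n a\<^esub> m)))"

definition resc_zdt :: "nat \<Rightarrow> (nat \<Rightarrow> real) \<Rightarrow> presc set \<Rightarrow> presc set"
  where "resc_zdt n a = chain_rule_op n a (\<lambda>f. mon (1, 0, 0) * d_t'' f) (mon (0, 0, -1)) zdt"

definition resc_zd\<theta> :: "nat \<Rightarrow> (nat \<Rightarrow> real) \<Rightarrow> presc set \<Rightarrow> presc set"
  where "resc_zd\<theta> n a = chain_rule_op n a (\<lambda>f. mon (1, 0, 0) * d_\<theta> f) (mon (0, 0, -2)) z2dz"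

text \<open>Since \<open>\<tau> = 1/\<theta>\<close>, one has \<open>\<tau>\<partial>\<^sub>\<tau> = -\<theta>\<partial>\<^sub>\<theta>\<close>.\<close>

definition resc_z\<tau>d\<tau> :: "nat \<Rightarrow> (nat \<Rightarrow> real) \<Rightarrow> presc set \<Rightarrow> presc set"
  where "resc_z\<tau>d\<tau> n a x = (- mon (0, 0, 1)) \<odot>\<^bsub>rescaled n a\<^esub> resc_zd\<theta> n a x"

abbreviation tau :: O_zt\<theta>
  where "tau \<equiv> mon (0, 0, -1)"


section \<open>The V-filtration along \<open>\<tau> = 0\<close>\<close>

definition O_zt\<tau> :: "O_zt\<theta> set"
  where "O_zt\<tau> = {f. \<forall>(a, b, d)\<in>Poly_Mapping.keys f. d \<le> 0}"

definition C_z :: "O_zt\<theta> set"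
  where "C_z = {f. \<forall>(a, b, d)\<in>Poly_Mapping.keys f. b = 0 \<and> d = 0}"

definition V0_submodule :: "nat \<Rightarrow> (nat \<Rightarrow> real) \<Rightarrow> presc set set \<Rightarrow> bool"
  where "V0_submodule n a S \<longleftrightarrow>
    S \<subseteq> carrier (rescaled n a) \<and> \<zero>\<^bsub>rescaled n a\<^esub> \<in> S \<and>
    (\<forall>x\<in>S. \<forall>y\<in>S. x \<oplus>\<^bsub>rescaled n a\<^esub> y \<in> S) \<and>
    (\<forall>f\<in>O_zt\<tau>. \<forall>x\<in>S. f \<odot>\<^bsub>rescaled n a\<^esub> x \<in> S) \<and>
    (\<forall>x\<in>S. resc_zdt n a x \<in> S) \<and> (\<forall>x\<in>S. resc_z\<tau>d\<tau> n a x \<in> S)"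

definition below :: "(real \<Rightarrow> 'a set) \<Rightarrow> real \<Rightarrow> 'a set"
  where "below F x = (\<Union>y\<in>{..<x}. F y)"

text \<open>Coherence over the Noetherian ring \<open>\<O>\<langle>z\<partial>\<^sub>t, z\<tau>\<partial>\<^sub>\<tau>\<rangle>\<close> is finite generation. As usual, a
  V-filtration is exhaustive and is indexed by \<open>A + \<int>\<close> for a finite set \<open>A\<close> of real numbers.\<close>

definition is_V_filtration :: "nat \<Rightarrow> (nat \<Rightarrow> real) \<Rightarrow> (real \<Rightarrow> presc set set) \<Rightarrow> bool"
  where "is_V_filtration n a V \<longleftrightarrow>
    (\<forall>\<alpha>. V0_submodule n a (V \<alpha>)) \<and>
    (\<forall>\<alpha>. \<exists>S. finite S \<and> S \<subseteq> carrier (rescaled n a) \<and> V \<alpha> = V0_submodule n a hull S) \<and>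
    (\<forall>\<alpha> \<beta>. \<alpha> \<le> \<beta> \<longrightarrow> V \<alpha> \<subseteq> V \<beta>) \<and>
    (\<Union>\<alpha>. V \<alpha>) = carrier (rescaled n a) \<and>
    (\<exists>A. finite A \<and> (\<forall>\<alpha> \<beta>. \<alpha> \<le> \<beta> \<and> (\<forall>c\<in>A. \<forall>k::int. c + of_int k \<notin> {\<alpha><..\<beta>}) \<longrightarrow> V \<alpha> = V \<beta>)) \<and>
    (\<forall>\<alpha>. smult (rescaled n a) tau ` V \<alpha> = V (\<alpha> - 1)) \<and>
    (\<forall>\<alpha>. \<forall>p\<in>C_z. \<forall>x\<in>V \<alpha>.
       p \<noteq> 0 \<and> p \<odot>\<^bsub>rescaled n a\<^esub> x \<in> below V \<alpha> \<longrightarrow> x \<in> below V \<alpha>) \<and>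
    (\<forall>\<alpha>. \<exists>N. \<forall>x\<in>V \<alpha>.
       ((\<lambda>y. resc_z\<tau>d\<tau> n a y
              \<oplus>\<^bsub>rescaled n a\<^esub> (cst (of_real \<alpha>) * mon (1, 0, 0)) \<odot>\<^bsub>rescaled n a\<^esub> y) ^^ N) x
         \<in> below V \<alpha>)"

definition V_filtration :: "nat \<Rightarrow> (nat \<Rightarrow> real) \<Rightarrow> real \<Rightarrow> presc set set"
  where "V_filtration n a = (THE V. is_V_filtration n a V)"


section \<open>The irregular Hodge filtration\<close>

text \<open>\<open>f(z, t, 1/z)\<close>, as a Laurent polynomial in \<open>z\<close> with coefficients in \<open>O_t\<close>.\<close>

definition ev_\<tau>z :: "O_zt\<theta> \<Rightarrow> int \<Rightarrow>\<^sub>0 O_t"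
  where "ev_\<tau>z f = (\<Sum>(a, b, d)\<in>Poly_Mapping.keys f.
    Poly_Mapping.single (int a - d) (Poly_Mapping.single b (Poly_Mapping.lookup f (a, b, d))))"

text \<open>Elements of \<open>hypH[z, 1/z]\<close> are represented as functions from exponents of \<open>z\<close> to \<open>hypH\<close>
  with finite support. Composing \<open>\<mu>\<close> with the inclusion of \<open>\<tau> = z\<close> gives the constant map to
  \<open>z = 1\<close>, so restriction to \<open>\<tau> = z\<close> is \<open>f \<otimes> m \<mapsto> f(z, t, 1/z) \<cdot> (m mod (z-1))\<close>. The union of a set
  of cosets is its set of representatives, so \<open>restrict_\<tau>z n a ` \<Union>S\<close> is the image of a
  set \<open>S\<close> of elements of the rescaled module.\<close>

definition restrict_\<tau>z :: "nat \<Rightarrow> (nat \<Rightarrow> real) \<Rightarrow> presc \<Rightarrow> int \<Rightarrow> (O_t \<Rightarrow> O_t) set"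
  where "restrict_\<tau>z n a x p = (\<Oplus>\<^bsub>hypH_O n a\<^esub>k\<in>Poly_Mapping.keys x.
    (of_int (Poly_Mapping.lookup x k) * Poly_Mapping.lookup (ev_\<tau>z (fst k)) p)
      \<odot>\<^bsub>hypH_O n a\<^esub> specialization n a (snd k))"

text \<open>The condition \<open>V\<^sub>\<alpha>/(\<tau>-z)V\<^sub>\<alpha> = \<Oplus>\<^sub>p F\<^sub>\<alpha>\<^sub>+\<^sub>p z\<^sup>p\<close>: restriction to \<open>\<tau> = z\<close> has kernel
  \<open>(\<tau>-z)V\<^sub>\<alpha>\<close> on \<open>V\<^sub>\<alpha>\<close> and image the right-hand side.\<close>

definition is_irr_Hodge_filtration ::
    "nat \<Rightarrow> (nat \<Rightarrow> real) \<Rightarrow> (real \<Rightarrow> (O_t \<Rightarrow> O_t) set set) \<Rightarrow> bool"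
  where "is_irr_Hodge_filtration n a F \<longleftrightarrow>
    (\<forall>\<alpha>. {C\<in>V_filtration n a \<alpha>. \<forall>x\<in>C. \<forall>p. restrict_\<tau>z n a x p = \<zero>\<^bsub>hypH n a\<^esub>}
           = smult (rescaled n a) (tau - mon (1, 0, 0)) ` V_filtration n a \<alpha> \<and>
         restrict_\<tau>z n a ` \<Union>(V_filtration n a \<alpha>)
           = {h. (\<forall>p. h p \<in> F (\<alpha> + of_int p)) \<and> finite {p. h p \<noteq> \<zero>\<^bsub>hypH n a\<^esub>}})"

definition F_irr :: "nat \<Rightarrow> (nat \<Rightarrow> real) \<Rightarrow> real \<Rightarrow> (O_t \<Rightarrow> O_t) set set"
  where "F_irr n a = (THE F. is_irr_Hodge_filtration n a F)"

definition gr_F_irr ::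
    "nat \<Rightarrow> (nat \<Rightarrow> real) \<Rightarrow> real \<Rightarrow> (O_t, (O_t \<Rightarrow> O_t) set set) module"
  where "gr_F_irr n a x = quot_module ((hypH_O n a)\<lparr>carrier := F_irr n a x\<rparr>) (below (F_irr n a) x)"

definition jumping_numbers :: "nat \<Rightarrow> (nat \<Rightarrow> real) \<Rightarrow> real set"
  where "jumping_numbers n a = {x. carrier (gr_F_irr n a x) \<noteq> {\<zero>\<^bsub>gr_F_irr n a x\<^esub>}}"

definition irr_Hodge_number :: "nat \<Rightarrow> (nat \<Rightarrow> real) \<Rightarrow> real \<Rightarrow> enat"
  where "irr_Hodge_number n a x = rank (gr_F_irr n a x)"

definition rho :: "nat \<Rightarrow> (nat \<Rightarrow> real) \<Rightarrow> nat \<Rightarrow> real"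
  where "rho n a k = - real n * a k + real k"

definition nu :: "nat \<Rightarrow> (nat \<Rightarrow> real) \<Rightarrow> real \<Rightarrow> nat \<Rightarrow> int"
  where "nu n a \<alpha> r = \<lceil>- \<alpha> + real r - gam n a - real n * a (r + 1)\<rceil>"

definition Qbar :: "nat \<Rightarrow> (nat \<Rightarrow> real) \<Rightarrow> nat \<Rightarrow> (O_t \<Rightarrow> O_t) set"
  where "Qbar n a r =
    hypH_class n a (\<lambda>f. (- of_nat n) ^ r * op_prod (\<lambda>i. tdt_shift (a i)) r f)"

end

theory Submission
  imports Defs "HOL-Library.Function_Algebras" "HOL-Computational_Algebra.Polynomial"
begin

text \<open>Everything is reduced to computations with coordinate vectors. Write \<open>Q\<^sub>r\<close> for the product of the first
  \<open>r\<close> factors \<open>z(t\<partial>\<^sub>t - a\<^sub>i)\<close>. Both hypergeometric modules are free on \<open>Q\<^sub>0, \<dots>, Q\<^sub>n\<^sub>-\<^sub>1\<close>. That these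
  classes generate is division by the defining relations (\<open>span_left\<close>). That they are independent
  rests on the formal solution \<open>\<Sum>c\<^sub>b t\<^sup>b\<close> of the hypergeometric equation: its coefficients grow like a
  power \<open>n\<close> of a factorial, so the terms \<open>t\<^sup>j Q\<^sub>r\<close> with \<open>r < n\<close> have the pairwise distinct growth rates
  \<open>r + nj\<close> (\<open>solution_degrees_independent\<close>). Over the \<open>z\<close>-line one lets the solution be homogeneous of
  weight \<open>w\<close> for the Euler field, and compares the dependence on \<open>w\<close> (\<open>independence_Hhat\<close>).
  
  The ideals, and likewise the relations of the tensor product, are therefore the kernels of coordinate
  maps, so that elements of all the quotient modules are fibres of these maps (\<open>additive_fibres\<close>). In
  the rescaled module, up to the contribution of the next basis vector,
  \<open>z\<tau>\<partial>\<^sub>\<tau>\<close> multiplies \<open>\<tau>\<^sup>m Q\<^sub>r\<close> by \<open>(m - jump r) z\<close>, where \<open>jump r = r - \<gamma> - n a\<^sub>r\<^sub>+\<^sub>1\<close>. Thus \<open>\<tau>\<^sup>m Q\<^sub>r\<close>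
  should have order \<open>jump r - m\<close>, and the vectors \<open>\<Sum>f\<^sub>r Q\<^sub>r\<close> with \<open>f\<^sub>r\<close> divisible by \<open>\<tau>\<close> to the power
  \<open>\<nu>\<^sub>\<alpha>(r)\<close> form a V-filtration: since \<open>a\<^sub>1 \<le> \<dots> \<le> a\<^sub>n\<close> the passage from \<open>Q\<^sub>r\<close> to \<open>\<tau>Q\<^sub>r\<^sub>+\<^sub>1\<close> does not raise
  the order, and since \<open>a\<^sub>n - a\<^sub>1 < 1\<close> the passage from \<open>Q\<^sub>n\<^sub>-\<^sub>1\<close> to \<open>\<tau>tQ\<^sub>0\<close> lowers it, which makes
  \<open>z\<tau>\<partial>\<^sub>\<tau> + \<alpha>z\<close> nilpotent on the graded pieces (\<open>is_Vmod_Vmod\<close>). It is the only one (\<open>Vmod_unique\<close>):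
  if \<open>\<alpha> < \<beta>\<close>, then \<open>z\<tau>\<partial>\<^sub>\<tau> + \<alpha>z\<close> differs from the nilpotent \<open>z\<tau>\<partial>\<^sub>\<tau> + \<beta>z\<close> by a nonzero multiple of \<open>z\<close>,
  so by strictness it is injective on the \<open>\<beta>\<close>-graded piece of any V-filtration, although it is
  nilpotent on the \<open>\<alpha>\<close>-graded piece of any other.
  
  Setting \<open>\<tau> = z\<close> turns \<open>\<tau>\<^sup>m Q\<^sub>r\<close> into \<open>z\<^sup>m\<close> times the class of \<open>Q\<^sub>r\<close> at \<open>z = 1\<close>. Hence \<open>F\<^sub>x\<close> is spanned by
  the classes with \<open>jump r \<le> x\<close> (\<open>F_irr_eq\<close>), its graded pieces are free on the classes with
  \<open>jump r = x\<close> (\<open>gr_rank\<close>), and \<open>jump (k - 1) = \<rho>(k) - 1 - \<gamma>\<close> identifies the overall shift.\<close>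

section \<open>Monoid algebras: derivations and substitutions\<close>

abbreviation (input) "lk \<equiv> Poly_Mapping.lookup"
abbreviation (input) "kys \<equiv> Poly_Mapping.keys"
abbreviation (input) "sg \<equiv> Poly_Mapping.single"

lemma poly_mapping_add_induct [case_names single add]:
  fixes f :: "'k \<Rightarrow>\<^sub>0 'c::comm_monoid_add"
  assumes s: "\<And>k c. P (sg k c)" and a: "\<And>f g. P f \<Longrightarrow> P g \<Longrightarrow> P (f + g)"
  shows "P f"
proof (induction f rule: Poly_Mapping.update_induct)
  case const
  have "P (sg undefined 0)" by (rule s)
  then show ?case by simp
next
  case (update f k c)
  have "Poly_Mapping.update k c f = f + sg k c"
    using update(1) by (intro poly_mapping_eqI) (auto simp: lookup_update lookup_add lookup_single when_def in_keys_iff)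
  then show ?case using a[OF update(3) s] by simp
qed

text \<open>The derivations, pull-backs and evaluations on functions are all sums over monomials. In the common
  form \<open>lin h\<close> they inherit additivity and multiplicativity from statements about single monomials.\<close>

definition lin :: "('k \<Rightarrow> complex \<Rightarrow> 'b::comm_monoid_add) \<Rightarrow> ('k \<Rightarrow>\<^sub>0 complex) \<Rightarrow> 'b"
  where "lin h f = (\<Sum>k\<in>kys f. h k (lk f k))"

definition coeff_additive :: "('k \<Rightarrow> complex \<Rightarrow> 'b::comm_monoid_add) \<Rightarrow> bool"
  where "coeff_additive h \<longleftrightarrow> (\<forall>k. h k 0 = 0) \<and> (\<forall>k c d. h k (c + d) = h k c + h k d)"

lemma lin_single: "coeff_additive h \<Longrightarrow> lin h (sg k c) = h k c"
  by (cases "c = 0") (auto simp: lin_def coeff_additive_def)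

lemma lin_add: "coeff_additive h \<Longrightarrow> lin h (f + g) = lin h f + lin h g"
  unfolding lin_def by (rule setsum_keys_plus_distrib) (auto simp: coeff_additive_def)

lemma lin_mult:
  fixes h :: "'k::comm_monoid_add \<Rightarrow> complex \<Rightarrow> 'b::comm_semiring_0"
  assumes h: "coeff_additive h" and m: "\<And>k l c d. h (k + l) (c * d) = h k c * h l d"
  shows "lin h (f * g) = lin h f * lin h g"
proof (induction f rule: poly_mapping_add_induct)
  case (single k c)
  show ?case
    by (induction g rule: poly_mapping_add_induct)
       (simp_all add: mult_single lin_single[OF h] lin_add[OF h] m distrib_left)
next
  case (add f g)
  then show ?case by (simp add: distrib_right lin_add[OF h])
qed

lemma additive_diff:
  fixes T :: "'a::ab_group_add \<Rightarrow> 'b::ab_group_add"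
  assumes "\<And>f g. T (f + g) = T f + T g"
  shows "T 0 = 0" "T (- f) = - T f" "T (f - g) = T f - T g"
proof -
  show z: "T 0 = 0" using assms[of 0 0] by simp
  show u: "T (- f) = - T f" for f
    using assms[of "- f" f] z by (simp add: eq_neg_iff_add_eq_0)
  show "T (f - g) = T f - T g" using assms[of f "- g"] u by simp
qed

lemma additive_sum:
  fixes T :: "'a::ab_group_add \<Rightarrow> 'b::ab_group_add"
  assumes "\<And>f g. T (f + g) = T f + T g"
  shows "T (\<Sum>i\<in>I. f i) = (\<Sum>i\<in>I. T (f i))"
  by (induction I rule: infinite_finite_induct) (simp_all add: assms additive_diff[OF assms])

lemma monomial_deriv_lin:
  "monomial_deriv e s = lin (\<lambda>k c. sg (s k) (of_int (e k) * c))"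
  by (rule ext) (simp add: monomial_deriv_def lin_def)

lemma coeff_additive_deriv: "coeff_additive (\<lambda>k c. sg (s k) (of_int (e k) * c))"
  by (auto simp: coeff_additive_def distrib_left single_add)

lemma monomial_deriv_single: "monomial_deriv e s (sg k c) = sg (s k) (of_int (e k) * c)"
  unfolding monomial_deriv_lin by (rule lin_single) (rule coeff_additive_deriv)

lemma monomial_deriv_add: "monomial_deriv e s (f + g) = monomial_deriv e s f + monomial_deriv e s g"
  unfolding monomial_deriv_lin by (rule lin_add) (rule coeff_additive_deriv)

text \<open>The shift \<open>s\<close> of exponents has to be compatible with addition only where the coefficient does not
  vanish. This admits the truncated subtraction in \<open>d_z\<close>.\<close>

lemma monomial_deriv_mult:
  fixes f g :: "'k::comm_monoid_add \<Rightarrow>\<^sub>0 complex"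
  assumes e: "\<And>k l. e (k + l) = e k + e l" and s: "\<And>k l. e k \<noteq> 0 \<Longrightarrow> s (k + l) = s k + l"
  shows "monomial_deriv e s (f * g) = monomial_deriv e s f * g + f * monomial_deriv e s g"
proof (induction f rule: poly_mapping_add_induct)
  case (single k c)
  show ?case
  proof (induction g rule: poly_mapping_add_induct)
    case (single l d)
    have 1: "sg (s (k + l)) (of_int (e k) * (c * d)) = sg (s k + l) (of_int (e k) * c * d)"
      by (cases "e k = 0") (simp_all add: s mult.assoc)
    have 2: "sg (s (k + l)) (of_int (e l) * (c * d)) = sg (k + s l) (c * (of_int (e l) * d))"
      using s[of l k] by (cases "e l = 0") (simp_all add: add.commute mult.left_commute)
    show ?case
      by (simp add: mult_single monomial_deriv_single e distrib_right single_add 1 2 del: mult.assoc)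
  next
    case (add g g')
    then show ?case by (simp add: distrib_left monomial_deriv_add)
  qed
next
  case (add f f')
  then show ?case by (simp add: distrib_right monomial_deriv_add)
qed

lemmas deriv_defs = d_t_def d_z_def d_t'_def d_t''_def d_\<theta>_def

lemma deriv_single:
  "d_t (sg b c) = sg (b - 1) (of_int b * c)"
  "d_z (sg (x, b) c) = sg (x - 1, b) (of_nat x * c)"
  "d_t' (sg (x, b) c) = sg (x, b - 1) (of_int b * c)"
  "d_t'' (sg (x, b, d) c) = sg (x, b - 1, d) (of_int b * c)"
  "d_\<theta> (sg (x, b, d) c) = sg (x, b, d - 1) (of_int d * c)"
  by (simp_all add: deriv_defs monomial_deriv_single)

lemma deriv_add:
  "d_t (f + g) = d_t f + d_t g" "d_z (h + k) = d_z h + d_z k" "d_t' (h + k) = d_t' h + d_t' k"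
  "d_t'' (p + q) = d_t'' p + d_t'' q" "d_\<theta> (p + q) = d_\<theta> p + d_\<theta> q"
  by (simp_all add: deriv_defs monomial_deriv_add)

lemma deriv_mult:
  "d_t (f * g) = d_t f * g + f * d_t g"
  "d_z (h * k) = d_z h * k + h * d_z k"
  "d_t' (h * k) = d_t' h * k + h * d_t' k"
  "d_t'' (p * q) = d_t'' p * q + p * d_t'' q"
  "d_\<theta> (p * q) = d_\<theta> p * q + p * d_\<theta> q"
  unfolding deriv_defs by (rule monomial_deriv_mult; force)+

lemmas deriv_diff =
  additive_diff[of d_t, OF deriv_add(1)] additive_diff[of d_z, OF deriv_add(2)]
  additive_diff[of d_t', OF deriv_add(3)] additive_diff[of d_t'', OF deriv_add(4)]
  additive_diff[of d_\<theta>, OF deriv_add(5)]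

lemma deriv_cst: "d_t (cst c) = 0" "d_z (cst c) = 0" "d_t' (cst c) = 0" "d_t'' (cst c) = 0" "d_\<theta> (cst c) = 0"
  by (simp_all add: deriv_single zero_prod_def)

lemma cst_one: "cst 1 = 1" by (simp add: single_one)

lemma mu_pull_lin: "mu_pull = lin (\<lambda>(a, b) c. sg (a, b, int a) c)"
  by (rule ext) (simp add: mu_pull_def lin_def case_prod_beta)

lemma ev_z1_lin: "ev_z1 = lin (\<lambda>(a, b) c. sg b c)"
  by (rule ext) (simp add: ev_z1_def lin_def case_prod_beta)

lemma ev_\<tau>z_lin: "ev_\<tau>z = lin (\<lambda>(a, b, d) c. sg (int a - d) (sg b c))"
  by (rule ext) (simp add: ev_\<tau>z_def lin_def case_prod_beta)

lemma coeff_additive_subst: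
  "coeff_additive (\<lambda>(a, b) c. sg (a, b, int a) c :: O_zt\<theta>)"
  "coeff_additive (\<lambda>(a::nat, b) c. sg b c :: O_t)"
  "coeff_additive (\<lambda>(a, b, d) c. sg (int a - d) (sg b c) :: int \<Rightarrow>\<^sub>0 O_t)"
  by (auto simp: coeff_additive_def single_add)

lemma subst_single:
  "mu_pull (sg (x, b) c) = sg (x, b, int x) c"
  "ev_z1 (sg (x, b) c) = sg b c"
  "ev_\<tau>z (sg (x, b, d) c) = sg (int x - d) (sg b c)"
  by (simp_all add: mu_pull_lin ev_z1_lin ev_\<tau>z_lin lin_single coeff_additive_subst)

lemma subst_add:
  "mu_pull (f + g) = mu_pull f + mu_pull g"
  "ev_z1 (f + g) = ev_z1 f + ev_z1 g"
  "ev_\<tau>z (p + q) = ev_\<tau>z p + ev_\<tau>z q"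
  by (simp_all add: mu_pull_lin ev_z1_lin ev_\<tau>z_lin lin_add coeff_additive_subst)

lemma subst_mult:
  "mu_pull (f * g) = mu_pull f * mu_pull g"
  "ev_z1 (f * g) = ev_z1 f * ev_z1 g"
  "ev_\<tau>z (p * q) = ev_\<tau>z p * ev_\<tau>z q"
  unfolding mu_pull_lin ev_z1_lin ev_\<tau>z_lin
  by (rule lin_mult[OF coeff_additive_subst(1)], force simp: mult_single)
     (rule lin_mult[OF coeff_additive_subst(2)], force simp: mult_single,
      rule lin_mult[OF coeff_additive_subst(3)], clarsimp simp: mult_single algebra_simps)

lemma subst_cst: "mu_pull (cst c) = cst c" "ev_z1 (cst c) = cst c" "ev_\<tau>z (cst c) = sg 0 (sg 0 c)"
  by (simp_all add: zero_prod_def subst_single)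

lemmas subst_diff =
  additive_diff[of mu_pull, OF subst_add(1)] additive_diff[of ev_z1, OF subst_add(2)]
  additive_diff[of ev_\<tau>z, OF subst_add(3)]

lemma subst_one: "mu_pull 1 = 1" "ev_z1 1 = 1" "ev_\<tau>z 1 = 1"
  using subst_cst[of 1] by (simp_all add: single_one)

text \<open>The map \<open>\<mu>\<close> sends the locus \<open>\<tau> = z\<close> to \<open>z = 1\<close>. This makes the restriction compatible with the
  relations of the tensor product.\<close>

lemma ev_mu: "ev_\<tau>z (mu_pull f) = sg 0 (ev_z1 f)"
  by (induction f rule: poly_mapping_add_induct; (clarsimp simp: subst_single subst_add single_add)?)

section \<open>Quotients by kernels of additive maps\<close>

text \<open>A coset of the kernel of an additive map \<open>\<Psi>\<close> is a fibre of \<open>\<Psi>\<close>, so computations in the quotient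
  become computations with values of \<open>\<Psi>\<close>. The group laws enter in the form that right cosets call
  for, because the locale is applied to operators, to formal sums, and also to steps of a filtration,
  whose elements are cosets already.\<close>

locale additive_fibres =
  fixes M :: "('s, 'a) module" and \<Psi> :: "'a \<Rightarrow> 'v::ab_group_add"
  assumes add_closed: "\<And>x y. x \<in> carrier M \<Longrightarrow> y \<in> carrier M \<Longrightarrow> x \<oplus>\<^bsub>M\<^esub> y \<in> carrier M"
    and \<Psi>_add: "\<And>x y. x \<in> carrier M \<Longrightarrow> y \<in> carrier M \<Longrightarrow> \<Psi> (x \<oplus>\<^bsub>M\<^esub> y) = \<Psi> x + \<Psi> y"
    and subtract: "\<And>x y. x \<in> carrier M \<Longrightarrow> y \<in> carrier M \<Longrightarrow> \<exists>z\<in>carrier M. z \<oplus>\<^bsub>M\<^esub> x = y"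
    and nonempty: "carrier M \<noteq> {}"
begin

definition fib :: "'v \<Rightarrow> 'a set"
  where "fib v = {x \<in> carrier M. \<Psi> x = v}"

abbreviation Im :: "'v set"
  where "Im \<equiv> \<Psi> ` carrier M"

lemma subtract_\<Psi>:
  assumes "x \<in> carrier M" "y \<in> carrier M"
  obtains z where "z \<in> carrier M" "z \<oplus>\<^bsub>M\<^esub> x = y" "\<Psi> z = \<Psi> y - \<Psi> x"
  using subtract[OF assms] \<Psi>_add assms by (metis add_diff_cancel_right')

lemma Im_diff:
  assumes "v \<in> Im" "w \<in> Im"
  shows "v - w \<in> Im"
proof -
  obtain x y where "x \<in> carrier M" "y \<in> carrier M" "v = \<Psi> x" "w = \<Psi> y" using assms by blast
  then show ?thesis using subtract_\<Psi>[of y x] by (metis imageI)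
qed

lemma Im_zero: "0 \<in> Im"
proof -
  obtain x where "x \<in> carrier M" using nonempty by blast
  then show ?thesis using Im_diff[of "\<Psi> x" "\<Psi> x"] by simp
qed

lemma Im_add: "v \<in> Im \<Longrightarrow> w \<in> Im \<Longrightarrow> v + w \<in> Im"
  using Im_diff[of v "0 - w"] Im_diff[OF Im_zero, of w] by simp

lemma Im_sum: "(\<And>i. i \<in> I \<Longrightarrow> v i \<in> Im) \<Longrightarrow> (\<Sum>i\<in>I. v i) \<in> Im"
  by (induction I rule: infinite_finite_induct) (simp_all add: Im_zero Im_add)

lemma fib_ne: "v \<in> Im \<Longrightarrow> fib v \<noteq> {}"
  by (auto simp: fib_def)

lemma fib_eq_iff: "v \<in> Im \<Longrightarrow> fib v = fib w \<longleftrightarrow> v = w"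
  by (auto simp: fib_def)

lemma coset:
  assumes x: "x \<in> carrier M"
  shows "fib 0 +>\<^bsub>M\<^esub> x = fib (\<Psi> x)"
proof
  show "fib 0 +>\<^bsub>M\<^esub> x \<subseteq> fib (\<Psi> x)"
    using x unfolding a_r_coset_def r_coset_def by (auto simp: fib_def add_closed \<Psi>_add)
  show "fib (\<Psi> x) \<subseteq> fib 0 +>\<^bsub>M\<^esub> x"
  proof
    fix y assume y: "y \<in> fib (\<Psi> x)"
    then obtain z where "z \<in> carrier M" "z \<oplus>\<^bsub>M\<^esub> x = y" "\<Psi> z = \<Psi> y - \<Psi> x"
      using x subtract_\<Psi>[of x y] by (auto simp: fib_def)
    then show "y \<in> fib 0 +>\<^bsub>M\<^esub> x"
      using y unfolding a_r_coset_def r_coset_def by (auto simp: fib_def)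
  qed
qed

lemma fib_add:
  assumes "v \<in> Im" "w \<in> Im"
  shows "fib v <+>\<^bsub>M\<^esub> fib w = fib (v + w)"
proof
  show "fib v <+>\<^bsub>M\<^esub> fib w \<subseteq> fib (v + w)"
    unfolding set_add_def set_mult_def by (auto simp: fib_def add_closed \<Psi>_add)
  show "fib (v + w) \<subseteq> fib v <+>\<^bsub>M\<^esub> fib w"
  proof
    fix z assume z: "z \<in> fib (v + w)"
    obtain y where y: "y \<in> carrier M" "\<Psi> y = w" using assms by blast
    obtain u where "u \<in> carrier M" "u \<oplus>\<^bsub>M\<^esub> y = z" "\<Psi> u = \<Psi> z - \<Psi> y"
      using subtract_\<Psi>[of y z] y z by (auto simp: fib_def)
    then show "z \<in> fib v <+>\<^bsub>M\<^esub> fib w"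
      using y z unfolding set_add_def set_mult_def by (auto simp: fib_def)
  qed
qed

lemma carrier_quot: "carrier (quot_module M (fib 0)) = fib ` Im"
  unfolding quot_module_def A_RCOSETS_def RCOSETS_def
  using coset by (auto simp: a_r_coset_def)

lemma add_quot: "v \<in> Im \<Longrightarrow> w \<in> Im \<Longrightarrow> fib v \<oplus>\<^bsub>quot_module M (fib 0)\<^esub> fib w = fib (v + w)"
  by (simp add: quot_module_def fib_add)

lemma zero_quot: "\<zero>\<^bsub>quot_module M (fib 0)\<^esub> = fib 0"
  by (simp add: quot_module_def)

text \<open>An operator is single-valued on the quotient as soon as the value of \<open>\<Psi>\<close> on its results is
  constant along the fibre; this takes the place of separate proofs of well-definedness.\<close>

lemma induced_fib:
  assumes "v \<in> Im" and "\<And>x. x \<in> carrier M \<Longrightarrow> \<Psi> x = v \<Longrightarrow> T x \<in> carrier M \<and> \<Psi> (T x) = w"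
  shows "induced_op M (fib 0) T (fib v) = fib w"
proof -
  have "fib 0 +>\<^bsub>M\<^esub> T x = fib w" if "x \<in> fib v" for x
    using that assms(2)[of x] coset[of "T x"] by (auto simp: fib_def)
  then show ?thesis using fib_ne[OF assms(1)] by (auto simp: induced_op_def)
qed

lemma smult_quot: "module.smult (quot_module M (fib 0)) r = induced_op M (fib 0) (module.smult M r)"
  by (simp add: quot_module_def)

lemma comm_monoid_quot: "comm_monoid (add_monoid (quot_module M (fib 0)))"
  by (rule comm_monoidI)
     (auto simp: carrier_quot add_quot zero_quot Im_add Im_zero ac_simps)

lemma finsum_quot:
  assumes "finite I" and "\<And>i. i \<in> I \<Longrightarrow> v i \<in> Im"
  shows "finsum (quot_module M (fib 0)) (\<lambda>i. fib (v i)) I = fib (\<Sum>i\<in>I. v i)"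
proof -
  interpret Q: comm_monoid "add_monoid (quot_module M (fib 0))" by (rule comm_monoid_quot)
  show ?thesis using assms unfolding finsum_def
  proof (induction I rule: finite_induct)
    case empty
    have "finprod (add_monoid (quot_module M (fib 0))) (\<lambda>i. fib (v i)) {} = \<zero>\<^bsub>quot_module M (fib 0)\<^esub>"
      using Q.finprod_empty by simp
    then show ?case by (simp only: zero_quot sum.empty)
  next
    case (insert i I)
    then show ?case
      by (subst Q.finprod_insert) (auto simp: carrier_quot add_quot Im_sum)
  qed
qed

end

lemma finsum_restrict_scalars: "finsum (restrict_scalars \<phi> M) f I = finsum M f I"
  by (simp add: finsum_def finprod_def restrict_scalars_def)

section \<open>Rings of differential operators\<close>

lemma abelian_group_End_C: "abelian_group (End_C :: (('k::comm_monoid_add \<Rightarrow>\<^sub>0 complex) \<Rightarrow> _) ring)"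
proof (rule abelian_groupI)
  fix S T U :: "('k \<Rightarrow>\<^sub>0 complex) \<Rightarrow> ('k \<Rightarrow>\<^sub>0 complex)"
  assume *: "S \<in> carrier End_C" "T \<in> carrier End_C"
  then show "S \<oplus>\<^bsub>End_C\<^esub> T \<in> carrier End_C" by (simp add: End_C_def algebra_simps)
  have "(\<lambda>f. - S f) \<in> carrier End_C" using * by (simp add: End_C_def)
  moreover have "(\<lambda>f. - S f) \<oplus>\<^bsub>End_C\<^esub> S = \<zero>\<^bsub>End_C\<^esub>" by (simp add: End_C_def)
  ultimately show "\<exists>y\<in>carrier End_C. y \<oplus>\<^bsub>End_C\<^esub> S = \<zero>\<^bsub>End_C\<^esub>" by blast
qed (auto simp: End_C_def algebra_simps)

lemma ring_End_C: "ring (End_C :: (('k::comm_monoid_add \<Rightarrow>\<^sub>0 complex) \<Rightarrow> _) ring)"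
proof (rule ringI)
  show "abelian_group (End_C :: (('k::comm_monoid_add \<Rightarrow>\<^sub>0 complex) \<Rightarrow> _) ring)"
    by (rule abelian_group_End_C)
  show "Group.monoid (End_C :: (('k::comm_monoid_add \<Rightarrow>\<^sub>0 complex) \<Rightarrow> _) ring)"
    by (rule monoidI) (auto simp: End_C_def)
qed (auto simp: End_C_def fun_eq_iff)

lemma End_C_simps [simp]:
  "(\<otimes>\<^bsub>End_C\<^esub>) = (\<circ>)" "\<one>\<^bsub>End_C\<^esub> = id" "\<zero>\<^bsub>End_C\<^esub> = (\<lambda>_. 0)" "S \<oplus>\<^bsub>End_C\<^esub> T = (\<lambda>f. S f + T f)"
  by (simp_all add: End_C_def)

lemma carrier_End_C: "T \<in> carrier End_C \<longleftrightarrow>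
    (\<forall>f g. T (f + g) = T f + T g) \<and> (\<forall>c f. T (cst c * f) = cst c * T f)"
  by (simp add: End_C_def)

lemma End_C_neg: "T \<in> carrier End_C \<Longrightarrow> \<ominus>\<^bsub>End_C\<^esub> T = (\<lambda>f. - T f)"
proof -
  interpret abelian_group "End_C :: (('a::comm_monoid_add \<Rightarrow>\<^sub>0 complex) \<Rightarrow> _) ring" by (rule abelian_group_End_C)
  assume "T \<in> carrier End_C"
  then show ?thesis
    by (intro minus_equality) (auto simp: carrier_End_C)
qed

lemma mult_End_C: "(*) (f :: 'k::comm_monoid_add \<Rightarrow>\<^sub>0 complex) \<in> carrier End_C"
  by (simp add: carrier_End_C distrib_left mult.left_commute)

lemma diff_ops_simps [simp]:
  "(\<otimes>\<^bsub>diff_ops G\<^esub>) = (\<circ>)" "\<one>\<^bsub>diff_ops G\<^esub> = id" "\<zero>\<^bsub>diff_ops G\<^esub> = (\<lambda>_. 0)"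
  "S \<oplus>\<^bsub>diff_ops G\<^esub> T = (\<lambda>f. S f + T f)"
  by (simp_all add: diff_ops_def End_C_def)

lemma carrier_diff_ops: "carrier (diff_ops G) = generate_ring End_C (range (*) \<union> G)"
  by (simp add: diff_ops_def)

context
  fixes G :: "(('k::comm_monoid_add \<Rightarrow>\<^sub>0 complex) \<Rightarrow> ('k \<Rightarrow>\<^sub>0 complex)) set"
  assumes G: "G \<subseteq> carrier End_C"
begin

lemma gen_sub: "range (*) \<union> G \<subseteq> carrier End_C"
  using G mult_End_C by auto

lemma ring_diff_ops: "ring (diff_ops G)"
  unfolding diff_ops_def by (rule ring.generate_ring_is_ring[OF ring_End_C gen_sub])

lemma diff_ops_End: "T \<in> carrier (diff_ops G) \<Longrightarrow> T \<in> carrier End_C"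
  unfolding carrier_diff_ops by (rule ring.generate_ring_in_carrier[OF ring_End_C gen_sub])

lemma diff_ops_additive: "T \<in> carrier (diff_ops G) \<Longrightarrow> T (f + g) = T f + T g"
  using diff_ops_End by (auto simp: carrier_End_C)

lemma diff_ops_closed:
  "id \<in> carrier (diff_ops G)" "(*) f \<in> carrier (diff_ops G)" "D \<in> G \<Longrightarrow> D \<in> carrier (diff_ops G)"
  "S \<in> carrier (diff_ops G) \<Longrightarrow> T \<in> carrier (diff_ops G) \<Longrightarrow> (\<lambda>f. S f + T f) \<in> carrier (diff_ops G)"
  "S \<in> carrier (diff_ops G) \<Longrightarrow> T \<in> carrier (diff_ops G) \<Longrightarrow> S \<circ> T \<in> carrier (diff_ops G)"
  "S \<in> carrier (diff_ops G) \<Longrightarrow> (\<lambda>f. - S f) \<in> carrier (diff_ops G)"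
proof -
  interpret ring "diff_ops G" by (rule ring_diff_ops)
  show "id \<in> carrier (diff_ops G)" using one_closed by simp
  show "(*) f \<in> carrier (diff_ops G)" "D \<in> G \<Longrightarrow> D \<in> carrier (diff_ops G)"
    unfolding carrier_diff_ops by (auto intro: generate_ring.incl)
  show "S \<in> carrier (diff_ops G) \<Longrightarrow> T \<in> carrier (diff_ops G) \<Longrightarrow> (\<lambda>f. S f + T f) \<in> carrier (diff_ops G)"
    using a_closed by simp
  show "S \<in> carrier (diff_ops G) \<Longrightarrow> T \<in> carrier (diff_ops G) \<Longrightarrow> S \<circ> T \<in> carrier (diff_ops G)"
    using m_closed by simp
  show "S \<in> carrier (diff_ops G) \<Longrightarrow> (\<lambda>f. - S f) \<in> carrier (diff_ops G)"
    using End_C_neg[OF diff_ops_End, of S] generate_ring.a_inv[of S End_C "range (*) \<union> G"]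
    by (simp add: carrier_diff_ops)
qed

lemma diff_ops_induct [consumes 1, case_names id mult gen neg add comp]:
  assumes T: "T \<in> carrier (diff_ops G)"
    and "P id" "\<And>f. P ((*) f)" "\<And>D. D \<in> G \<Longrightarrow> P D"
    and "\<And>S. S \<in> carrier (diff_ops G) \<Longrightarrow> P S \<Longrightarrow> P (\<lambda>f. - S f)"
    and "\<And>S T. S \<in> carrier (diff_ops G) \<Longrightarrow> T \<in> carrier (diff_ops G) \<Longrightarrow> P S \<Longrightarrow> P T \<Longrightarrow> P (\<lambda>f. S f + T f)"
    and "\<And>S T. S \<in> carrier (diff_ops G) \<Longrightarrow> T \<in> carrier (diff_ops G) \<Longrightarrow> P S \<Longrightarrow> P T \<Longrightarrow> P (S \<circ> T)"
  shows "P T"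
  using T unfolding carrier_diff_ops
proof (induction T rule: generate_ring.induct)
  case (a_inv h)
  then have "h \<in> carrier (diff_ops G)" by (simp add: carrier_diff_ops)
  then show ?case using assms(5)[of h] a_inv End_C_neg[OF diff_ops_End] by simp
next
  case one
  show ?case using assms(2) by (simp only: End_C_simps)
next
  case (incl h)
  then show ?case using assms(3,4) by auto
next
  case (eng_add h1 h2)
  then show ?case using assms(6)[of h1 h2] by (simp add: carrier_diff_ops)
next
  case (eng_mult h1 h2)
  then have "P (h1 \<circ> h2)" using assms(7)[of h1 h2] by (simp add: carrier_diff_ops)
  then show ?case by (simp only: End_C_simps)
qed

end

lemma left_ideal_pair:
  fixes R (structure)
  assumes "ring R" and s: "s1 \<in> carrier R" "s2 \<in> carrier R"
  shows "left_ideal R {s1, s2} = {A \<otimes> s1 \<oplus> B \<otimes> s2 | A B. A \<in> carrier R \<and> B \<in> carrier R}"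
    (is "?L = ?K")
proof
  interpret ring R by fact
  let ?G = "{r \<otimes> s | r s. r \<in> carrier R \<and> s \<in> {s1, s2}}"
  have K_incl: "r \<otimes> s \<in> ?K" if "r \<in> carrier R" "s \<in> {s1, s2}" for r s
  proof -
    have "r \<otimes> s1 = r \<otimes> s1 \<oplus> \<zero> \<otimes> s2" "r \<otimes> s2 = \<zero> \<otimes> s1 \<oplus> r \<otimes> s2"
      using that s by simp_all
    then show ?thesis using that by blast
  qed
  show "?L \<subseteq> ?K"
  proof
    fix x assume "x \<in> ?L"
    then show "x \<in> ?K" unfolding left_ideal_def
    proof (induction x rule: generate.induct)
      case one
      have "\<zero> = \<zero> \<otimes> s1 \<oplus> \<zero> \<otimes> s2" using s by simp
      then show ?case by (auto intro!: exI[of _ \<zero>])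
    next
      case (incl h)
      then show ?case using K_incl by blast
    next
      case (inv h)
      then obtain r s' where h: "h = r \<otimes> s'" "r \<in> carrier R" "s' \<in> {s1, s2}" by blast
      have "inv\<^bsub>add_monoid R\<^esub> h = (\<ominus> r) \<otimes> s'"
        using h s l_minus[of r s'] by (auto simp: a_inv_def)
      then show ?case using K_incl[of "\<ominus> r" s'] h by simp
    next
      case (eng h h')
      then obtain A B A' B' where *: "h = A \<otimes> s1 \<oplus> B \<otimes> s2" "h' = A' \<otimes> s1 \<oplus> B' \<otimes> s2"
        "A \<in> carrier R" "B \<in> carrier R" "A' \<in> carrier R" "B' \<in> carrier R" by blast
      have "h \<oplus> h' = (A \<oplus> A') \<otimes> s1 \<oplus> (B \<oplus> B') \<otimes> s2"
        using * s by (simp add: l_distr a_ac)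
      moreover have "A \<oplus> A' \<in> carrier R" "B \<oplus> B' \<in> carrier R" using * by simp_all
      ultimately show ?case by auto
    qed
  qed
  show "?K \<subseteq> ?L"
  proof
    fix x assume "x \<in> ?K"
    then obtain A B where x: "x = A \<otimes> s1 \<oplus> B \<otimes> s2" and AB: "A \<in> carrier R" "B \<in> carrier R" by blast
    have "A \<otimes> s1 \<in> ?L" "B \<otimes> s2 \<in> ?L"
      unfolding left_ideal_def using AB by (auto intro!: generate.incl)
    then show "x \<in> ?L" unfolding x left_ideal_def
      using generate.eng[of _ "add_monoid R"] by fastforce
  qed
qed

section \<open>The formal solution\<close>

lemma op_prod_0 [simp]: "op_prod L 0 = id"
  by (simp add: op_prod_def)

lemma op_prod_Suc: "op_prod L (Suc r) f = op_prod L r (L (Suc r) f)"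
proof -
  have "foldr (\<circ>) xs g = foldr (\<circ>) xs id \<circ> g" for xs :: "('a \<Rightarrow> 'a) list" and g
    by (induction xs) (simp_all add: comp_assoc)
  from this[of "map L [1..<Suc r]" "L (Suc r)"] show ?thesis
    by (simp add: op_prod_def fun_eq_iff)
qed

lemma op_prod_commute:
  assumes "\<And>i f. L i (T f) = T (L i f)"
  shows "op_prod L r (T f) = T (op_prod L r f)"
  by (induction r arbitrary: f) (simp_all add: op_prod_Suc assms)

lemma op_prod_Suc':
  assumes "\<And>i j f. L i (L j f) = L j (L i f)"
  shows "op_prod L (Suc r) f = L (Suc r) (op_prod L r f)"
  using op_prod_commute[of L "L (Suc r)" r f, OF assms] by (simp add: op_prod_Suc)

text \<open>Among the terms with nonzero coefficient only the one of largest degree reaches the top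
  coefficient of the sum.\<close>

lemma distinct_degrees_independent:
  fixes p :: "'i \<Rightarrow> 'c::idom poly"
  assumes I: "finite I" and inj: "inj_on (\<lambda>i. degree (p i)) I" and ne: "\<And>i. i \<in> I \<Longrightarrow> p i \<noteq> 0"
    and sum: "(\<Sum>i\<in>I. Polynomial.smult (g i) (p i)) = 0" and i: "i \<in> I"
  shows "g i = 0"
proof (rule ccontr)
  define J where "J = {i \<in> I. g i \<noteq> 0}"
  assume "g i \<noteq> 0"
  then have J: "finite J" "J \<noteq> {}" using i I by (auto simp: J_def)
  define m where "m = Max ((\<lambda>i. degree (p i)) ` J)"
  obtain j where j: "j \<in> J" "degree (p j) = m"
    using Max_in[of "(\<lambda>i. degree (p i)) ` J"] J unfolding m_def by fastforce
  have "0 = coeff (\<Sum>i\<in>I. Polynomial.smult (g i) (p i)) m" by (simp add: sum)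
  also have "\<dots> = (\<Sum>i\<in>I. g i * coeff (p i) m)" by (simp add: coeff_sum)
  also have "\<dots> = (\<Sum>i\<in>I. if i = j then g j * coeff (p j) m else 0)"
  proof (rule sum.cong)
    fix i assume i: "i \<in> I"
    show "g i * coeff (p i) m = (if i = j then g j * coeff (p j) m else 0)"
    proof (cases "i \<in> J \<and> i \<noteq> j")
      case True
      then have "degree (p i) \<le> m" using J by (simp add: m_def)
      moreover have "degree (p i) \<noteq> m"
        using True j inj i by (auto simp: inj_on_def J_def)
      ultimately show ?thesis using True by (simp add: coeff_eq_0)
    qed (use i in \<open>auto simp: J_def\<close>)
  qed simp
  also have "\<dots> = g j * lead_coeff (p j)" using j I by (simp add: J_def del: leading_coeff_0_iff)
  finally have "g j * lead_coeff (p j) = 0" by (rule sym)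
  moreover have "g j \<noteq> 0" "p j \<noteq> 0" using j ne[of j] by (auto simp: J_def)
  ultimately show False by (metis leading_coeff_0_iff mult_eq_0_iff)
qed

locale hypergeometric =
  fixes n :: nat and a :: "nat \<Rightarrow> real"
  assumes n: "n \<ge> 1"
    and a_range: "\<And>i. i \<in> {1..n} \<Longrightarrow> 0 \<le> a i \<and> a i < 1"
    and a_mono: "\<And>i j. i \<in> {1..n} \<Longrightarrow> j \<in> {1..n} \<Longrightarrow> i \<le> j \<Longrightarrow> a i \<le> a j"
begin

text \<open>The scalar by which \<open>\<Prod>\<^sub>i\<^sub>\<le>\<^sub>r (t\<partial>\<^sub>t - a\<^sub>i)\<close> acts on \<open>t\<^sup>b\<close>.\<close>

definition ind :: "nat \<Rightarrow> int \<Rightarrow> complex"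
  where "ind r b = (\<Prod>i=1..r. of_int b - of_real (a i))"

text \<open>Coefficients of a formal solution \<open>\<Sum>c\<^sub>b t\<^sup>b\<close> of the hypergeometric equation, followed towards
  \<open>b \<rightarrow> -\<infinity>\<close>. The indicial polynomial has no negative integer zeros because all \<open>a\<^sub>i\<close> are nonnegative,
  so the recursion never meets a zero coefficient.\<close>

definition sol_coeff :: "int \<Rightarrow> complex"
  where "sol_coeff b = (\<Prod>m=b+1..-1. ind n m)"

lemma sol_coeff_rec: "b \<le> -1 \<Longrightarrow> sol_coeff (b - 1) = ind n b * sol_coeff b"
proof -
  assume "b \<le> -1"
  then have "{b..-1} = insert b {b+1..-1}" by auto
  then show ?thesis by (simp add: sol_coeff_def)
qed

lemma sol_coeff_nonzero: "sol_coeff b \<noteq> 0"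
proof -
  have "complex_of_int m - complex_of_real (a i) \<noteq> 0" if "m \<le> -1" "i \<in> {1..n}" for m i
  proof
    assume "complex_of_int m - complex_of_real (a i) = 0"
    then have "complex_of_real (real_of_int m) = complex_of_real (a i)" by simp
    then have "real_of_int m = a i" by (simp only: of_real_eq_iff)
    then show False using a_range[of i] that by auto
  qed
  then show ?thesis by (auto simp: sol_coeff_def ind_def)
qed

lemma sol_coeff_shift: "b \<le> -1 \<Longrightarrow> sol_coeff (b - int k) = sol_coeff b * (\<Prod>l<k. ind n (b - int l))"
proof (induction k)
  case (Suc k)
  have "b - int k \<le> -1" "b - int (Suc k) = b - int k - 1" using Suc.prems by simp_all
  then have "sol_coeff (b - int (Suc k)) = ind n (b - int k) * sol_coeff (b - int k)"
    using sol_coeff_rec[of "b - int k"] by metis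
  also have "\<dots> = sol_coeff b * (\<Prod>l<Suc k. ind n (b - int l))"
    using Suc by (simp only: lessThan_Suc prod.insert finite_lessThan lessThan_iff mult_ac)
  finally show ?case .
qed simp

definition ind_poly :: "nat \<Rightarrow> int \<Rightarrow> complex poly"
  where "ind_poly r j = (\<Prod>i=1..r. [:- of_int j - of_real (a i), 1:])"

lemma ind_poly: "poly (ind_poly r j) (of_int b) = ind r (b - j)"
  by (simp add: ind_poly_def ind_def poly_prod algebra_simps)

lemma ind_poly_degree: "ind_poly r j \<noteq> 0" "degree (ind_poly r j) = r"
proof -
  show "ind_poly r j \<noteq> 0" by (simp add: ind_poly_def)
  show "degree (ind_poly r j) = r"
    unfolding ind_poly_def by (subst degree_prod_sum_eq) auto
qed

text \<open>After division by one coefficient \<open>c\<^sub>b\<^sub>-\<^sub>J\<close>, the coefficient \<open>c\<^sub>b\<^sub>-\<^sub>j\<close> is a polynomial in \<open>b\<close> of degree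
  \<open>n(j - J)\<close>, and the factor in front of it has degree \<open>r < n\<close>. By division with remainder by \<open>n\<close> the
  pairs \<open>(r, j)\<close> have distinct total degrees, and an identity at infinitely many \<open>b\<close> is an identity of
  polynomials.\<close>

lemma solution_degrees_independent:
  fixes g :: "nat \<times> int \<Rightarrow> complex"
  assumes I: "finite I" and r: "\<And>r j. (r, j) \<in> I \<Longrightarrow> r < n"
    and z: "\<And>b. b \<le> B \<Longrightarrow> (\<Sum>(r, j)\<in>I. g (r, j) * ind r (b - j) * sol_coeff (b - j)) = 0"
    and rj: "rj \<in> I"
  shows "g rj = 0"
proof -
  define J where "J = Min (snd ` I)"
  have J: "J \<le> j" if "(r, j) \<in> I" for r j
    unfolding J_def using I image_eqI[OF _ that, of j snd] by (intro Min_le) auto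
  \<comment> \<open>the cofactor of \<open>g (r, j)\<close>, divided by the coefficient \<open>c\<^sub>b\<^sub>-\<^sub>J\<close>\<close>
  define p where "p = (\<lambda>(r, j). ind_poly r j * (\<Prod>l<nat (j - J). ind_poly n (J + int l)))"
  have pne: "p i \<noteq> 0" for i
    by (auto simp: p_def ind_poly_degree case_prod_beta)
  have deg: "degree (p (r, j)) = r + n * nat (j - J)" for r j
  proof -
    have "degree (\<Prod>l<nat (j - J). ind_poly n (J + int l)) = n * nat (j - J)"
      by (subst degree_prod_sum_eq) (auto simp: ind_poly_degree)
    then show ?thesis by (simp add: p_def degree_mult_eq ind_poly_degree)
  qed
  have "(\<Sum>i\<in>I. Polynomial.smult (g i) (p i)) = 0" (is "?S = 0")
  proof (rule ccontr)
    assume "?S \<noteq> 0"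
    then have fin: "finite {x. poly ?S x = 0}" by (rule poly_roots_finite)
    have "poly ?S (of_int b) = 0" if b: "b \<le> min B (J - 1)" for b
    proof -
      have "g (r, j) * ind r (b - j) * sol_coeff (b - j) = sol_coeff (b - J) * (g (r, j) * poly (p (r, j)) (of_int b))"
        if rj: "(r, j) \<in> I" for r j
      proof -
        have "sol_coeff (b - j) = sol_coeff (b - J) * (\<Prod>l<nat (j - J). ind n (b - J - int l))"
          using sol_coeff_shift[of "b - J" "nat (j - J)"] J[OF rj] b by simp
        then show ?thesis
          by (simp add: p_def ind_poly poly_prod diff_diff_eq mult_ac)
      qed
      then have "(\<Sum>(r, j)\<in>I. g (r, j) * ind r (b - j) * sol_coeff (b - j))
          = (\<Sum>i\<in>I. sol_coeff (b - J) * (g i * poly (p i) (of_int b)))"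
        by (intro sum.cong) auto
      also have "\<dots> = sol_coeff (b - J) * poly ?S (of_int b)"
        by (simp add: poly_sum sum_distrib_left)
      finally show ?thesis using z[of b] b sol_coeff_nonzero[of "b - J"] by simp
    qed
    then have "of_int ` {..min B (J - 1)} \<subseteq> {x. poly ?S x = 0}" by auto
    then have "finite (of_int ` {..min B (J - 1)} :: complex set)" using fin finite_subset by blast
    then have "finite {..min B (J - 1)}"
      by (rule finite_imageD) (simp add: inj_on_def)
    then show False using infinite_Iic by blast
  qed
  moreover have "inj_on (\<lambda>i. degree (p i)) I"
  proof (rule inj_onI, clarify)
    fix r j r' j' assume *: "(r, j) \<in> I" "(r', j') \<in> I" and eq: "degree (p (r, j)) = degree (p (r', j'))"
    have lt: "r < n" "r' < n" using * r by auto
    have e: "r + n * nat (j - J) = r' + n * nat (j' - J)" using eq by (simp add: deg)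
    have "r = r'" using arg_cong[OF e, of "\<lambda>x. x mod n"] lt by simp
    moreover have "nat (j - J) = nat (j' - J)" using e \<open>r = r'\<close> n by simp
    ultimately show "r = r' \<and> j = j'" using J[OF *(1)] J[OF *(2)] by auto
  qed
  ultimately show ?thesis
    using distinct_degrees_independent[OF I, of p g rj] pne rj by blast
qed

end

section \<open>Linear independence in the D-module\<close>

lemma lookup_single_mult:
  fixes w :: "('k::ab_group_add) \<Rightarrow>\<^sub>0 complex"
  shows "lk (sg k c * w) b = c * lk w (b - k)"
  by (induction w rule: poly_mapping_add_induct)
     (auto simp: mult_single lookup_single when_def distrib_left lookup_add)

lemma finite_bound_abs:
  fixes \<tau> :: "'i \<Rightarrow> int"
  assumes "finite S"
  obtains N where "N \<ge> 0" "\<And>k. k \<in> S \<Longrightarrow> \<bar>\<tau> k\<bar> \<le> N"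
proof
  have *: "\<bar>\<tau> k\<bar> \<le> (\<Sum>k\<in>S. \<bar>\<tau> k\<bar>)" if "k \<in> S" for k
    using assms that by (intro member_le_sum) auto
  then show "\<And>k. k \<in> S \<Longrightarrow> \<bar>\<tau> k\<bar> \<le> (\<Sum>k\<in>S. \<bar>\<tau> k\<bar>)" .
  show "(\<Sum>k\<in>S. \<bar>\<tau> k\<bar>) \<ge> 0" by (simp add: sum_nonneg)
qed

lemma lookup_mult_int:
  fixes v w :: O_t
  shows "lk (v * w) b = (\<Sum>j\<in>kys v. lk v j * lk w (b - j))"
proof -
  have c: "coeff_additive (\<lambda>j c. c * lk w (b - j))"
    by (simp add: coeff_additive_def distrib_right)
  have "lk (v * w) b = lin (\<lambda>j c. c * lk w (b - j)) v"
    by (induction v rule: poly_mapping_add_induct)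
       (simp_all add: lookup_single_mult distrib_right lookup_add lin_single[OF c] lin_add[OF c])
  then show ?thesis by (simp add: lin_def)
qed

lemma lookup_single_mult_zt:
  fixes w :: O_zt
  shows "lk (sg (x, j) c * w) (y, b) = (if x \<le> y then c * lk w (y - x, b - j) else 0)"
  by (induction w rule: poly_mapping_add_induct)
     (auto simp: mult_single lookup_single when_def distrib_left lookup_add)

lemma lookup_mult_zt:
  fixes v w :: O_zt
  shows "lk (v * w) (y, b) = (\<Sum>(x, j)\<in>kys v. lk v (x, j) * (if x \<le> y then lk w (y - x, b - j) else 0))"
proof -
  let ?h = "\<lambda>(x, j) c. c * (if x \<le> y then lk w (y - x, b - j) else 0)"
  have c: "coeff_additive ?h"
    by (simp add: coeff_additive_def distrib_right)
  have "lk (v * w) (y, b) = lin ?h v"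
  proof (induction v rule: poly_mapping_add_induct)
    case (single k c)
    then show ?case by (cases k) (simp add: lookup_single_mult_zt lin_single[OF \<open>coeff_additive ?h\<close>])
  qed (simp add: distrib_right lookup_add lin_add[OF c])
  then show ?thesis by (simp add: lin_def case_prod_beta)
qed

text \<open>Differential operators change the exponent of \<open>t\<close> by a bounded amount. For this reason a truncated
  solution is as good as an infinite one, away from the two ends of the truncation.\<close>

definition banded :: "('k \<Rightarrow> int) \<Rightarrow> (('k \<Rightarrow>\<^sub>0 complex) \<Rightarrow> ('k \<Rightarrow>\<^sub>0 complex)) \<Rightarrow> bool"
  where "banded \<tau> A \<longleftrightarrow> (\<exists>N\<ge>0. \<forall>f l h. \<tau> ` kys f \<subseteq> {l..h} \<longrightarrow> \<tau> ` kys (A f) \<subseteq> {l-N..h+N})"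

lemma banded_id: "banded \<tau> id"
  unfolding banded_def by (intro exI[of _ 0]) simp

lemma banded_add:
  assumes "banded \<tau> A" "banded \<tau> B"
  shows "banded \<tau> (\<lambda>f. A f + B f)"
proof -
  obtain N N' where N: "N \<ge> 0" "\<And>f l h. \<tau> ` kys f \<subseteq> {l..h} \<Longrightarrow> \<tau> ` kys (A f) \<subseteq> {l-N..h+N}"
    and N': "N' \<ge> 0" "\<And>f l h. \<tau> ` kys f \<subseteq> {l..h} \<Longrightarrow> \<tau> ` kys (B f) \<subseteq> {l-N'..h+N'}"
    using assms unfolding banded_def by metis
  have "\<tau> ` kys (A f + B f) \<subseteq> {l-(N+N')..h+(N+N')}" if f: "\<tau> ` kys f \<subseteq> {l..h}" for f l h
  proof -
    have "\<tau> ` kys (A f + B f) \<subseteq> \<tau> ` kys (A f) \<union> \<tau> ` kys (B f)"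
      using Poly_Mapping.keys_add[of "A f" "B f"] by blast
    also have "\<dots> \<subseteq> {l-N..h+N} \<union> {l-N'..h+N'}" using N(2)[OF f] N'(2)[OF f] by blast
    also have "\<dots> \<subseteq> {l-(N+N')..h+(N+N')}" using N(1) N'(1) by auto
    finally show ?thesis .
  qed
  then show ?thesis unfolding banded_def using N(1) N'(1) by (intro exI[of _ "N + N'"]) auto
qed

lemma banded_uminus: "banded \<tau> A \<Longrightarrow> banded \<tau> (\<lambda>f. - A f)"
  unfolding banded_def by simp

lemma banded_comp:
  assumes "banded \<tau> A" "banded \<tau> B"
  shows "banded \<tau> (A \<circ> B)"
proof -
  obtain N N' where N: "N \<ge> 0" "\<And>f l h. \<tau> ` kys f \<subseteq> {l..h} \<Longrightarrow> \<tau> ` kys (A f) \<subseteq> {l-N..h+N}"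
    and N': "N' \<ge> 0" "\<And>f l h. \<tau> ` kys f \<subseteq> {l..h} \<Longrightarrow> \<tau> ` kys (B f) \<subseteq> {l-N'..h+N'}"
    using assms unfolding banded_def by metis
  have "\<tau> ` kys ((A \<circ> B) f) \<subseteq> {l-(N+N')..h+(N+N')}" if f: "\<tau> ` kys f \<subseteq> {l..h}" for f l h
    using N(2)[OF N'(2)[OF f]] by (simp add: algebra_simps)
  then show ?thesis unfolding banded_def using N(1) N'(1) by (intro exI[of _ "N + N'"]) auto
qed

lemma banded_mult:
  fixes g :: "'k::comm_monoid_add \<Rightarrow>\<^sub>0 complex"
  assumes \<tau>: "\<And>k l. \<tau> (k + l) = \<tau> k + \<tau> l"
  shows "banded \<tau> ((*) g)"
proof -
  obtain N where N: "\<And>k. k \<in> kys g \<Longrightarrow> \<bar>\<tau> k\<bar> \<le> N" "N \<ge> 0"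
    using finite_bound_abs[of "kys g" \<tau>] finite_keys by metis
  have "\<tau> ` kys (g * f) \<subseteq> {l-N..h+N}" if f: "\<tau> ` kys f \<subseteq> {l..h}" for f l h
  proof clarify
    fix k assume "k \<in> kys (g * f)"
    then obtain i j where ij: "k = i + j" "i \<in> kys g" "j \<in> kys f"
      using Poly_Mapping.keys_mult[of g f] by blast
    then have "l \<le> \<tau> j" "\<tau> j \<le> h" "\<bar>\<tau> i\<bar> \<le> N" using f N by auto
    then show "\<tau> k \<in> {l-N..h+N}" using ij(1) by (simp add: \<tau> abs_le_iff)
  qed
  then show ?thesis unfolding banded_def using N(2) by (intro exI[of _ N]) auto
qed

lemma keys_monomial_deriv: "kys (monomial_deriv e s f) \<subseteq> s ` kys f"
proof -
  have "kys (monomial_deriv e s f) \<subseteq> (\<Union>k\<in>kys f. kys (sg (s k) (of_int (e k) * lk f k)))"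
    unfolding monomial_deriv_def by (rule Poly_Mapping.keys_sum)
  then show ?thesis by (auto split: if_splits)
qed

lemma banded_deriv:
  assumes "\<And>k. \<tau> (s k) \<in> {\<tau> k - 1..\<tau> k}"
  shows "banded \<tau> (monomial_deriv e s)"
proof -
  have "\<tau> ` kys (monomial_deriv e s f) \<subseteq> {l-1..h+1}" if f: "\<tau> ` kys f \<subseteq> {l..h}" for f l h
  proof clarify
    fix k assume "k \<in> kys (monomial_deriv e s f)"
    then have "k \<in> s ` kys f" using keys_monomial_deriv[of e s f] by (rule rev_subsetD)
    then obtain j where j: "k = s j" "j \<in> kys f" by (rule imageE)
    then have "\<tau> j \<in> {l..h}" using f by blast
    then show "\<tau> k \<in> {l-1..h+1}" using assms[of j] j(1) by simp
  qed
  then show ?thesis unfolding banded_def by (intro exI[of _ 1]) auto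
qed

lemma gens_End_C: "{d_t} \<subseteq> carrier End_C" "{z2dz, zdt} \<subseteq> carrier End_C"
  by (auto simp: carrier_End_C deriv_add deriv_mult deriv_cst z2dz_def zdt_def distrib_left mult.left_commute)

lemmas D_Gm_induct = diff_ops_induct[OF gens_End_C(1), folded D_Gm_def,
  consumes 1, case_names id mult gen neg add comp]

lemmas R_int_induct = diff_ops_induct[OF gens_End_C(2), folded R_int_def,
  consumes 1, case_names id mult gen neg add comp]

lemma banded_D_Gm: "A \<in> carrier D_Gm \<Longrightarrow> banded (\<lambda>b. b) A"
proof (induction A rule: D_Gm_induct)
  case (gen D)
  have "banded (\<lambda>b. b) d_t" unfolding d_t_def by (rule banded_deriv) simp
  then show ?case using gen by simp
next
  case id
  show ?case by (rule banded_id)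
next
  case (mult f)
  show ?case by (rule banded_mult) simp
next
  case (neg S)
  show ?case by (rule banded_uminus) (rule neg)
next
  case (add S T)
  show ?case by (rule banded_add) (rule add)+
next
  case (comp S T)
  show ?case by (rule banded_comp) (rule comp)+
qed

lemma banded_R_int: "A \<in> carrier R_int \<Longrightarrow> banded snd A"
proof (induction A rule: R_int_induct)
  case (gen D)
  have "banded snd d_z" "banded snd d_t'"
    unfolding d_z_def d_t'_def by (rule banded_deriv, force)+
  moreover have "banded snd ((*) g)" for g :: O_zt
    by (rule banded_mult) simp
  ultimately have "banded snd ((*) (mon (2, 0)) \<circ> d_z)" "banded snd ((*) (mon (1, 0)) \<circ> d_t')"
    by (intro banded_comp; simp)+
  moreover have "(*) (mon (2, 0)) \<circ> d_z = z2dz" "(*) (mon (1, 0)) \<circ> d_t' = zdt"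
    by (simp_all add: fun_eq_iff z2dz_def zdt_def)
  ultimately show ?case using gen by auto
next
  case id
  show ?case by (rule banded_id)
next
  case (mult f)
  show ?case by (rule banded_mult) simp
next
  case (neg S)
  show ?case by (rule banded_uminus) (rule neg)
next
  case (add S T)
  show ?case by (rule banded_add) (rule add)+
next
  case (comp S T)
  show ?case by (rule banded_comp) (rule comp)+
qed

context hypergeometric
begin

definition Q :: "nat \<Rightarrow> O_t \<Rightarrow> O_t"
  where "Q = op_prod (\<lambda>i. tdt_shift (a i))"

lemma tdt_shift_single: "tdt_shift c (sg b y) = sg b ((of_int b - of_real c) * y)"
  by (simp add: tdt_shift_def deriv_single mult_single single_diff algebra_simps)

lemma tdt_shift_add: "tdt_shift c (f + g) = tdt_shift c f + tdt_shift c g"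
  by (simp add: tdt_shift_def deriv_add algebra_simps)

lemma Q_add: "Q r (f + g) = Q r f + Q r g"
  unfolding Q_def by (induction r arbitrary: f g) (simp_all add: op_prod_Suc tdt_shift_add)

lemma ind_Suc: "ind (Suc r) b = (of_int b - of_real (a (Suc r))) * ind r b"
  by (simp add: ind_def)

lemma Q_single: "Q r (sg b y) = sg b (ind r b * y)"
  unfolding Q_def
  by (induction r arbitrary: y) (simp_all add: op_prod_Suc tdt_shift_single ind_Suc ac_simps, simp add: ind_def)

lemma lookup_Q: "lk (Q r f) b = ind r b * lk f b"
  by (induction f rule: poly_mapping_add_induct)
     (simp_all add: Q_single Q_add lookup_single when_def lookup_add distrib_left)

text \<open>The truncated solution. The equation holds for it except for one term at each end (\<open>hyp_op_u\<close>).\<close>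

definition u :: "nat \<Rightarrow> O_t"
  where "u M = (\<Sum>k<M. sg (- int (Suc k)) (sol_coeff (- int (Suc k))))"

lemma lookup_u: "lk (u M) b = (if - int M \<le> b \<and> b \<le> -1 then sol_coeff b else 0)"
proof (induction M)
  case (Suc M)
  have "lk (u (Suc M)) b = lk (u M) b + lk (sg (- int (Suc M)) (sol_coeff (- int (Suc M)))) b"
    by (simp add: u_def lookup_add)
  also have "\<dots> = (if - int (Suc M) \<le> b \<and> b \<le> -1 then sol_coeff b else 0)"
    unfolding Suc lookup_single when_def by (cases "b = - int (Suc M)") auto
  finally show ?case .
qed (auto simp: u_def)

lemma hyp_op_Q: "hyp_op n a f = Q n f - mon 1 * f"
  by (simp add: hyp_op_def Q_def)

lemma hyp_op_u: "hyp_op n a (u M) = sg (- int M) (sol_coeff (- int M - 1)) - sg 0 (sol_coeff (-1))"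
proof (induction M)
  case 0
  then show ?case by (simp add: u_def hyp_op_Q Q_add additive_diff[of "Q n", OF Q_add])
next
  case (Suc M)
  have e: "- int (Suc M) + 1 = - int M" "- int M - 1 = - int (Suc M)" by simp_all
  have "sol_coeff (- int (Suc M) - 1) = ind n (- int (Suc M)) * sol_coeff (- int (Suc M))"
    by (rule sol_coeff_rec) simp
  then have "hyp_op n a (sg (- int (Suc M)) (sol_coeff (- int (Suc M)))) =
      sg (- int (Suc M)) (sol_coeff (- int (Suc M) - 1)) - sg (- int M) (sol_coeff (- int (Suc M)))"
    unfolding hyp_op_Q Q_single mult_single using e(1) by (simp only: add.commute[of 1] mult_1_left)
  moreover have "u (Suc M) = u M + sg (- int (Suc M)) (sol_coeff (- int (Suc M)))" by (simp add: u_def)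
  moreover have "hyp_op n a (f + g) = hyp_op n a f + hyp_op n a g" for f g
    by (simp add: hyp_op_Q Q_add algebra_simps)
  ultimately show ?case using Suc unfolding e(2) by simp
qed

text \<open>Apply both sides to a long truncation of the solution. Because \<open>A\<close> is banded, the right-hand side has
  no coefficients in the middle range, where the left-hand side is the sum of
  \<open>solution_degrees_independent\<close>.\<close>

lemma independence_H:
  assumes A: "A \<in> carrier D_Gm"
    and eq: "\<And>f. (\<Sum>r<n. v r * Q r f) = A (hyp_op n a f)" and r: "r < n"
  shows "v r = 0"
proof -
  obtain N where N: "N \<ge> 0" "\<And>f l h. (\<lambda>b. b) ` kys f \<subseteq> {l..h} \<Longrightarrow> (\<lambda>b. b) ` kys (A f) \<subseteq> {l-N..h+N}"
    using banded_D_Gm[OF A] unfolding banded_def by metis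
  define I where "I = (SIGMA r:{..<n}. kys (v r))"
  have I: "finite I" by (simp add: I_def)
  obtain J where J: "\<And>r j. (r, j) \<in> I \<Longrightarrow> \<bar>j\<bar> \<le> J" "J \<ge> 0"
    using finite_bound_abs[of I snd] I by (metis snd_conv)
  have z: "(\<Sum>(r, j)\<in>I. lk (v r) j * ind r (b - j) * sol_coeff (b - j)) = 0" if b: "b \<le> - N - J - 1" for b
  proof -
    define M where "M = nat (J - b + N + 1)"
    have M: "int M = J - b + N + 1" using b J N(1) by (simp add: M_def)
    have zero: "lk (A (sg k c)) b = 0" if "b < k - N \<or> b > k + N" for k c
    proof -
      have "kys (A (sg k c)) \<subseteq> {k-N..k+N}" using N(2)[of "sg k c" k k] by simp
      then show ?thesis using that by (auto simp: in_keys_iff)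
    qed
    have add: "A (f + g) = A f + A g" for f g
      using diff_ops_additive[OF gens_End_C(1)] A by (simp add: D_Gm_def)
    have "lk (A (hyp_op n a (u M))) b = 0"
      using zero[of "- int M"] zero[of 0] b J N(1) M
      by (simp add: hyp_op_u additive_diff(3)[of A, OF add] lookup_minus)
    then have "0 = (\<Sum>r<n. lk (v r * Q r (u M)) b)"
      by (simp add: eq[symmetric] lookup_sum)
    also have "\<dots> = (\<Sum>r<n. \<Sum>j\<in>kys (v r). lk (v r) j * ind r (b - j) * sol_coeff (b - j))"
    proof (intro sum.cong refl)
      fix r assume r: "r \<in> {..<n}"
      have "- int M \<le> b - j \<and> b - j \<le> -1" if "j \<in> kys (v r)" for j
        using J(1)[of r j] that r b N(1) J(2) M by (auto simp: I_def)
      then show "lk (v r * Q r (u M)) b = (\<Sum>j\<in>kys (v r). lk (v r) j * ind r (b - j) * sol_coeff (b - j))"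
        unfolding lookup_mult_int by (intro sum.cong) (simp_all add: lookup_Q lookup_u)
    qed
    also have "\<dots> = (\<Sum>(r, j)\<in>I. lk (v r) j * ind r (b - j) * sol_coeff (b - j))"
      unfolding I_def by (subst sum.Sigma) auto
    finally show ?thesis by simp
  qed
  have "lk (v r) j = 0" if "j \<in> kys (v r)" for j
    using solution_degrees_independent[of I "- N - J - 1" "\<lambda>(r, j). lk (v r) j" "(r, j)"] I z that r
    by (auto simp: I_def)
  then show ?thesis by (intro poly_mapping_eqI) (auto simp: in_keys_iff)
qed

end

section \<open>Linear independence over the z-line\<close>

text \<open>Families of functions, indexed by \<open>w\<close>, in which the monomial of bidegree \<open>(w + i, j)\<close> has a
  coefficient polynomial in \<open>w\<close>. Operators preserve such families, and so identities known for
  natural numbers \<open>w\<close> can be continued to \<open>w = -\<gamma>\<close>.\<close>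

inductive polyfam :: "(nat \<Rightarrow> O_zt) \<Rightarrow> bool" where
  zero: "polyfam (\<lambda>_. 0)"
| single: "polyfam (\<lambda>w. sg (w + i, j) (poly p (of_nat w)))"
| add: "polyfam F \<Longrightarrow> polyfam G \<Longrightarrow> polyfam (\<lambda>w. F w + G w)"

lemma polyfam_lookup: "polyfam F \<Longrightarrow> \<exists>p. \<forall>w. lk (F w) (w + m, b) = poly p (of_nat w)"
proof (induction F rule: polyfam.induct)
  case zero
  show ?case by (intro exI[of _ 0]) simp
next
  case (single i j p)
  show ?case by (intro exI[of _ "if i = m \<and> j = b then p else 0"]) (auto simp: lookup_single when_def)
next
  case (add F G)
  then obtain p q where "\<forall>w. lk (F w) (w + m, b) = poly p (of_nat w)" "\<forall>w. lk (G w) (w + m, b) = poly q (of_nat w)"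
    by blast
  then show ?case by (intro exI[of _ "p + q"]) (simp add: lookup_add)
qed

lemma polyfam_sum: "(\<And>i. i \<in> I \<Longrightarrow> polyfam (F i)) \<Longrightarrow> polyfam (\<lambda>w. \<Sum>i\<in>I. F i w)"
  by (induction I rule: infinite_finite_induct) (simp_all add: polyfam.zero polyfam.add)

lemma polyfam_map:
  assumes F: "polyfam F" and add: "\<And>f g. T (f + g) = T f + T g"
    and sgl: "\<And>i j p. polyfam (\<lambda>w. T (sg (w + i, j) (poly p (of_nat w))))"
  shows "polyfam (\<lambda>w. T (F w))"
  using F by (induction F rule: polyfam.induct)
     (simp_all add: additive_diff[of T, OF add] polyfam.zero sgl add polyfam.add)

lemma polyfam_mult: "polyfam F \<Longrightarrow> polyfam (\<lambda>w. g * F w)"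
proof (induction g rule: poly_mapping_add_induct)
  case (single k c)
  obtain x b where k: "k = (x, b)" by (cases k)
  show ?case
  proof (rule polyfam_map[OF single])
    fix i j p
    have "sg k c * sg (w + i, j) (poly p (of_nat w)) = sg (w + (x + i), b + j) (poly (Polynomial.smult c p) (of_nat w))" for w
      by (simp add: k mult_single ac_simps)
    then show "polyfam (\<lambda>w. sg k c * sg (w + i, j) (poly p (of_nat w)))"
      by (simp only: polyfam.single)
  qed (rule distrib_left)
next
  case (add f g)
  then show ?case by (simp add: distrib_right polyfam.add)
qed

lemma z2dz_single: "z2dz (sg (x, b) c) = sg (Suc x, b) (of_nat x * c)"
  by (cases x) (simp_all add: z2dz_def deriv_single mult_single)

lemma zdt_single: "zdt (sg (x, b) c) = sg (Suc x, b - 1) (of_int b * c)"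
  by (simp add: zdt_def deriv_single mult_single)

lemma z_ops_add: "z2dz (f + g) = z2dz f + z2dz g" "zdt (f + g) = zdt f + zdt g"
  by (simp_all add: z2dz_def zdt_def deriv_add distrib_left)

lemma z_ops_mult: "z2dz (f * g) = z2dz f * g + f * z2dz g" "zdt (f * g) = zdt f * g + f * zdt g"
  by (simp_all add: z2dz_def zdt_def deriv_mult algebra_simps)

lemma polyfam_R_int: "A \<in> carrier R_int \<Longrightarrow> polyfam F \<Longrightarrow> polyfam (\<lambda>w. A (F w))"
proof (induction A arbitrary: F rule: R_int_induct)
  case id
  then show ?case by (simp only: id_apply)
next
  case (mult f)
  then show ?case by (rule polyfam_mult)
next
  case (gen D)
  then consider "D = z2dz" | "D = zdt" by auto
  then show ?case
  proof cases
    case 1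
    show ?thesis unfolding 1
    proof (rule polyfam_map[OF gen(2) z_ops_add(1)])
      fix i j p
      have "z2dz (sg (w + i, j) (poly p (of_nat w))) = sg (w + Suc i, j) (poly ([:of_nat i, 1:] * p) (of_nat w))" for w
        by (simp add: z2dz_single algebra_simps)
      then show "polyfam (\<lambda>w. z2dz (sg (w + i, j) (poly p (of_nat w))))" by (simp only: polyfam.single)
    qed
  next
    case 2
    show ?thesis unfolding 2
    proof (rule polyfam_map[OF gen(2) z_ops_add(2)])
      fix i j p
      have "zdt (sg (w + i, j) (poly p (of_nat w))) = sg (w + Suc i, j - 1) (poly (Polynomial.smult (of_int j) p) (of_nat w))" for w
        by (simp add: zdt_single algebra_simps)
      then show "polyfam (\<lambda>w. zdt (sg (w + i, j) (poly p (of_nat w))))" by (simp only: polyfam.single)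
    qed
  qed
next
  case (neg S)
  from polyfam_mult[OF neg(2)[OF neg(3)], of "- 1"] show ?case by simp
next
  case (add S T)
  show ?case by (rule polyfam.add) (rule add(3,4)[OF add(5)])+
next
  case (comp S T)
  show ?case unfolding comp_def by (rule comp(3)) (rule comp(4)[OF comp(5)])
qed

lemma of_nat_mult_single:
  "of_nat n * sg (k :: 'k::comm_monoid_add) c = (sg k (of_nat n * c) :: 'k \<Rightarrow>\<^sub>0 complex)"
proof -
  have "sg 0 (of_nat n) * sg k c = (sg k (of_nat n * c) :: 'k \<Rightarrow>\<^sub>0 complex)"
    by (simp only: mult_single add_0_left)
  then show ?thesis by (simp only: single_of_nat)
qed

context hypergeometric
begin

abbreviation \<gamma> :: real where "\<gamma> \<equiv> gam n a"

definition Qh :: "nat \<Rightarrow> O_zt \<Rightarrow> O_zt"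
  where "Qh = op_prod (\<lambda>i. ztdt_shift (a i))"

lemma ztdt_shift_single: "ztdt_shift c (sg (x, b) y) = sg (Suc x, b) ((of_int b - of_real c) * y)"
  by (simp add: ztdt_shift_def deriv_single mult_single single_diff algebra_simps zero_prod_def)

lemma ztdt_shift_add: "ztdt_shift c (f + g) = ztdt_shift c f + ztdt_shift c g"
  by (simp add: ztdt_shift_def deriv_add algebra_simps)

lemma Qh_add: "Qh r (f + g) = Qh r f + Qh r g"
  unfolding Qh_def by (induction r arbitrary: f g) (simp_all add: op_prod_Suc ztdt_shift_add)

lemma Qh_single: "Qh r (sg (x, b) y) = sg (x + r, b) (ind r b * y)"
  unfolding Qh_def
  by (induction r arbitrary: x y) (simp_all add: op_prod_Suc ztdt_shift_single ind_Suc ac_simps, simp add: ind_def)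

lemma rel_t_Qh: "hyp_rel_t n a f = Qh n f - mon (0, 1) * f"
  by (simp add: hyp_rel_t_def Qh_def)

lemma rel_z_single:
  "hyp_rel_z n a (sg (x, b) y) = sg (Suc x, b) ((of_nat x + of_nat n * of_int b + of_real \<gamma>) * y)"
proof -
  have "of_nat n * mon (0, 1) * zdt (sg (x, b) y) = sg (Suc x, b) (of_nat n * (of_int b * y))"
    by (simp only: zdt_single mult_single of_nat_mult_single) (simp add: of_nat_mult_single)
  moreover have "cst (of_real \<gamma>) * mon (1, 0) * sg (x, b) y = sg (Suc x, b) (of_real \<gamma> * y)"
    by (simp add: mult_single mult.assoc)
  ultimately show ?thesis
    by (simp add: hyp_rel_z_def z2dz_single distrib_right mult.assoc flip: single_add)
qed

lemma rel_z_add: "hyp_rel_z n a (f + g) = hyp_rel_z n a f + hyp_rel_z n a g"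
  by (simp add: hyp_rel_z_def z_ops_add algebra_simps)

lemma rel_t_add: "hyp_rel_t n a (f + g) = hyp_rel_t n a f + hyp_rel_t n a g"
  by (simp add: rel_t_Qh Qh_add algebra_simps)

text \<open>The truncated solution made homogeneous of weight \<open>w\<close>, where \<open>z\<close> has weight 1 and \<open>t\<close> has weight \<open>n\<close>.
  The Euler relation acts on it as \<open>(w + \<gamma>)z\<close>, whereas its coefficients do not involve \<open>w\<close>.\<close>

definition u_weight :: "nat \<Rightarrow> nat \<Rightarrow> O_zt"
  where "u_weight M w = (\<Sum>k<M. sg (w + n * Suc k, - int (Suc k)) (sol_coeff (- int (Suc k))))"

lemma rel_z_u_weight: "hyp_rel_z n a (u_weight M w) = cst (of_nat w + of_real \<gamma>) * (mon (1, 0) * u_weight M w)"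
proof -
  have "hyp_rel_z n a (sg (w + n * Suc k, - int (Suc k)) y)
      = cst (of_nat w + of_real \<gamma>) * (mon (1, 0) * sg (w + n * Suc k, - int (Suc k)) y)" for k y
    by (simp add: rel_z_single mult_single zero_prod_def algebra_simps)
  then show ?thesis
    unfolding u_weight_def additive_sum[of "hyp_rel_z n a", OF rel_z_add] sum_distrib_left by simp
qed

lemma rel_t_u_weight:
  "hyp_rel_t n a (u_weight M w) = sg (w + n * Suc M, - int M) (sol_coeff (- int M - 1)) - sg (w + n, 0) (sol_coeff (-1))"
proof (induction M)
  case 0
  then show ?case by (simp add: u_weight_def additive_diff[of "hyp_rel_t n a", OF rel_t_add])
next
  case (Suc M)
  have e: "- int (Suc M) + 1 = - int M" "- int M - 1 = - int (Suc M)"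
    "w + n * Suc M + n = w + n * Suc (Suc M)" by simp_all
  have "sol_coeff (- int (Suc M) - 1) = ind n (- int (Suc M)) * sol_coeff (- int (Suc M))"
    by (rule sol_coeff_rec) simp
  then have "hyp_rel_t n a (sg (w + n * Suc M, - int (Suc M)) (sol_coeff (- int (Suc M)))) =
      sg (w + n * Suc (Suc M), - int (Suc M)) (sol_coeff (- int (Suc M) - 1)) - sg (w + n * Suc M, - int M) (sol_coeff (- int (Suc M)))"
    unfolding rel_t_Qh Qh_single mult_single using e
    by (simp only: add.commute[of 1] mult_1_left add_Pair add_0_left)
  moreover have "u_weight (Suc M) w = u_weight M w + sg (w + n * Suc M, - int (Suc M)) (sol_coeff (- int (Suc M)))"
    by (simp add: u_weight_def)
  ultimately show ?case using Suc unfolding e(2) by (simp add: rel_t_add)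
qed

lemma lookup_Qh_u_weight:
  "lk (Qh r (u_weight M w)) (p, q) =
    (if - int M \<le> q \<and> q \<le> -1 \<and> int p = int w - int n * q + int r then ind r q * sol_coeff q else 0)"
proof (induction M)
  case 0
  then show ?case by (auto simp: u_weight_def additive_diff[of "Qh r", OF Qh_add])
next
  case (Suc M)
  have "lk (Qh r (u_weight (Suc M) w)) (p, q) = lk (Qh r (u_weight M w)) (p, q)
      + lk (sg (w + n * Suc M + r, - int (Suc M)) (ind r (- int (Suc M)) * sol_coeff (- int (Suc M)))) (p, q)"
    by (simp add: u_weight_def Qh_add Qh_single lookup_add)
  also have "\<dots> = (if - int (Suc M) \<le> q \<and> q \<le> -1 \<and> int p = int w - int n * q + int r then ind r q * sol_coeff q else 0)"
  proof (cases "q = - int (Suc M)")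
    case True
    have "w + n * Suc M + r = p \<longleftrightarrow> int (w + n * Suc M + r) = int p" by (simp only: of_nat_eq_iff)
    also have "\<dots> \<longleftrightarrow> int p = int w - int n * q + int r"
      unfolding True by (simp add: algebra_simps) auto
    finally have *: "w + n * Suc M + r = p \<longleftrightarrow> int p = int w - int n * q + int r" .
    have "\<not> (- int M \<le> q)" "- int (Suc M) \<le> q" "q \<le> -1" using True by simp_all
    then show ?thesis unfolding Suc lookup_single when_def prod.inject * using True by simp
  next
    case False
    then have "- int (Suc M) \<le> q \<longleftrightarrow> - int M \<le> q" by auto
    then show ?thesis unfolding Suc lookup_single when_def prod.inject using False by simp
  qed
  finally show ?case .
qed

text \<open>Apply both sides to the solution of weight \<open>w\<close> and compare one coefficient in the middle range, where
  the relation in \<open>t\<close> contributes nothing. The left-hand side is independent of \<open>w\<close>, and the Euler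
  relation contributes \<open>w + \<gamma>\<close> times a polynomial in \<open>w\<close>. A constant of this form vanishes at
  \<open>w = -\<gamma>\<close>, hence is zero, and \<open>solution_degrees_independent\<close> applies.\<close>

lemma independence_Hhat:
  assumes A: "A \<in> carrier R_int" and B: "B \<in> carrier R_int"
    and eq: "\<And>f. (\<Sum>r<n. v r * Qh r f) = A (hyp_rel_z n a f) + B (hyp_rel_t n a f)" and r0: "r0 < n"
  shows "v r0 = 0"
proof -
  obtain N where N: "N \<ge> 0" "\<And>f l h. snd ` kys f \<subseteq> {l..h} \<Longrightarrow> snd ` kys (B f) \<subseteq> {l-N..h+N}"
    using banded_R_int[OF B] unfolding banded_def by metis
  have B_add: "B (f + g) = B f + B g" for f g
    using diff_ops_additive[OF gens_End_C(2)] B by (simp add: R_int_def)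
  have A_hom: "A (cst c * f) = cst c * A f" for c f
    using diff_ops_End[OF gens_End_C(2)] A by (simp add: R_int_def carrier_End_C)
  define T where "T = (SIGMA r:{..<n}. kys (v r))"
  have T: "finite T" by (simp add: T_def)
  obtain J where J: "\<And>r x j. (r, (x, j)) \<in> T \<Longrightarrow> \<bar>j\<bar> \<le> J" "J \<ge> 0"
    using finite_bound_abs[of T "\<lambda>t. snd (snd t)"] T by (metis snd_conv)
  have "lk (v r0) (x0, j0) = 0" if in0: "(x0, j0) \<in> kys (v r0)" for x0 j0
  proof -
    \<comment> \<open>\<open>I\<close> collects the pairs \<open>(r, j)\<close>, each with the exponent \<open>xx (r, j)\<close> of \<open>z\<close>, of all terms that meet the
      term \<open>(r0, x0, j0)\<close> in the same coefficient\<close>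
    define e where "e = int n * j0 + int r0 + int x0"
    define I where "I = {(r, j). r < n \<and> (\<exists>x. (x, j) \<in> kys (v r) \<and> int n * j + int r + int x = e)}"
    define xx where "xx = (\<lambda>(r, j). nat (e - int n * j - int r))"
    define T' where "T' = {(r, (x, j)) \<in> T. int n * j + int r + int x = e}"
    have T': "finite T'" unfolding T'_def by (rule finite_subset[OF _ T]) auto
    have bij: "bij_betw (\<lambda>(r, j). (r, (xx (r, j), j))) I T'"
      by (rule bij_betwI[of _ _ _ "\<lambda>(r, (x, j)). (r, j)"])
         (auto simp: I_def T'_def T_def xx_def)
    have I: "finite I" using bij_betw_finite[OF bij] T' by simp
    define Jb where "Jb = - N - J - \<bar>e\<bar> - 1"
    have z: "(\<Sum>(r, j)\<in>I. lk (v r) (xx (r, j), j) * ind r (b - j) * sol_coeff (b - j)) = 0" (is "?s = 0")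
      if b: "b \<le> Jb" for b
    proof -
      define M where "M = nat (J - b + N + 1)"
      have M: "int M = J - b + N + 1" using b J(2) N(1) by (simp add: M_def Jb_def)
      \<comment> \<open>the coefficient of bidegree \<open>(w + m, b)\<close> is compared, for all \<open>w\<close> at once\<close>
      define m where "m = nat (e - int n * b)"
      have "e - int n * b \<ge> 0"
      proof -
        have "- b \<le> int n * (- b)" using mult_right_mono[of 1 "int n" "- b"] b J(2) N(1) n by (simp add: Jb_def)
        then show ?thesis using b J(2) N(1) by (simp add: Jb_def)
      qed
      then have m: "int m = e - int n * b" by (simp add: m_def)
      have zero: "lk (B (sg k c)) (p, b) = 0" if "b < snd k - N \<or> b > snd k + N" for k c p
      proof -
        have "snd ` kys (B (sg k c)) \<subseteq> {snd k-N..snd k+N}" using N(2)[of "sg k c" "snd k" "snd k"] by simp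
        then have "(p, b) \<notin> kys (B (sg k c))" using that by fastforce
        then show ?thesis by (simp add: in_keys_iff)
      qed
      have "polyfam (\<lambda>w. A (mon (1, 0) * u_weight M w))"
      proof (rule polyfam_R_int[OF A], rule polyfam_mult)
        have "polyfam (\<lambda>w. sg (w + n * Suc k, - int (Suc k)) (poly [:sol_coeff (- int (Suc k)):] (of_nat w)))" for k
          by (rule polyfam.single)
        then show "polyfam (u_weight M)" unfolding u_weight_def by (intro polyfam_sum) simp
      qed
      then obtain p where p: "\<And>w. lk (A (mon (1, 0) * u_weight M w)) (w + m, b) = poly p (of_nat w)"
        using polyfam_lookup by blast
      have s: "?s = (of_nat w + of_real \<gamma>) * poly p (of_nat w)" for w
      proof -
        have main: "lk (v r) (x, j) * (if x \<le> w + m then lk (Qh r (u_weight M w)) (w + m - x, b - j) else 0) =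
             (if int n * j + int r + int x = e then lk (v r) (x, j) * ind r (b - j) * sol_coeff (b - j) else 0)"
          if "r < n" "(x, j) \<in> kys (v r)" for r x j
        proof -
          have "\<bar>j\<bar> \<le> J" using J(1)[of r x j] that by (simp add: T_def)
          then have 1: "- int M \<le> b - j" "b - j \<le> -1" using M b J(2) N(1) by (auto simp: Jb_def)
          have 2: "x \<le> w + m \<and> int (w + m - x) = int w - int n * (b - j) + int r \<longleftrightarrow>
              x \<le> w + m \<and> int n * j + int r + int x = e"
            using m by (auto simp: of_nat_diff algebra_simps)
          have 3: "x \<le> w + m" if "int n * j + int r + int x = e"
          proof -
            have "0 \<le> int n * (j - b)" using 1(2) by simp
            then have "int x \<le> int w + int m" using that m by (simp add: algebra_simps)
            then show ?thesis by simp
          qed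
          show ?thesis unfolding lookup_Qh_u_weight using 1 2 3 by auto
        qed
        have "b < - N" using b J(2) abs_ge_zero[of e] by (simp only: Jb_def)
        then have "lk (B (hyp_rel_t n a (u_weight M w))) (w + m, b) = 0"
          using zero[of "(w + n * Suc M, - int M)"] zero[of "(w + n, 0)"] b J(2) N(1) M
          by (simp add: rel_t_u_weight additive_diff(3)[of B, OF B_add] lookup_minus Jb_def)
        moreover have "lk (cst c * f) k = c * lk f k" for c k and f :: O_zt
          by (cases k) (simp add: zero_prod_def lookup_single_mult_zt)
        ultimately have "(of_nat w + of_real \<gamma>) * poly p (of_nat w) = lk (\<Sum>r<n. v r * Qh r (u_weight M w)) (w + m, b)"
          unfolding eq rel_z_u_weight A_hom lookup_add by (simp add: p del: One_nat_def)
        also have "\<dots> = (\<Sum>r<n. \<Sum>(x, j)\<in>kys (v r).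
            if int n * j + int r + int x = e then lk (v r) (x, j) * ind r (b - j) * sol_coeff (b - j) else 0)"
          unfolding lookup_sum lookup_mult_zt
        proof (intro sum.cong refl)
          fix r k assume "r \<in> {..<n}" "k \<in> kys (v r)"
          then show "(case k of (x, j) \<Rightarrow> lk (v r) (x, j) *
                (if x \<le> w + m then lk (Qh r (u_weight M w)) (w + m - x, b - j) else 0)) =
              (case k of (x, j) \<Rightarrow>
                if int n * j + int r + int x = e then lk (v r) (x, j) * ind r (b - j) * sol_coeff (b - j) else 0)"
            using main[of r "fst k" "snd k"] by (simp add: case_prod_beta)
        qed
        also have "\<dots> = (\<Sum>(r, (x, j))\<in>T.
            if int n * j + int r + int x = e then lk (v r) (x, j) * ind r (b - j) * sol_coeff (b - j) else 0)"
          unfolding T_def by (subst sum.Sigma) (auto simp: case_prod_beta)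
        also have "\<dots> = (\<Sum>(r, (x, j))\<in>T'. lk (v r) (x, j) * ind r (b - j) * sol_coeff (b - j))"
          unfolding T'_def using T by (intro sum.mono_neutral_cong_right) (auto split: if_splits)
        also have "\<dots> = ?s"
          using sum.reindex_bij_betw[OF bij, of "\<lambda>(r, (x, j)). lk (v r) (x, j) * ind r (b - j) * sol_coeff (b - j)"]
          by (simp add: case_prod_beta)
        finally show ?thesis by simp
      qed
      define q where "q = [:of_real \<gamma>, 1:] * p - [:?s:]"
      have "q = 0"
      proof (rule ccontr)
        assume "q \<noteq> 0"
        then have fin: "finite {x. poly q x = 0}" by (rule poly_roots_finite)
        have "poly q (of_nat w) = 0" for w using s[of w] by (simp add: q_def algebra_simps)
        then have "range of_nat \<subseteq> {x. poly q x = 0}" by auto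
        then have "finite (range (of_nat :: nat \<Rightarrow> complex))" using fin finite_subset by blast
        then show False using infinite_UNIV_nat finite_imageD[of of_nat "UNIV :: nat set"] inj_of_nat by blast
      qed
      then have "poly q (- of_real \<gamma>) = 0" by simp
      then show ?thesis by (simp add: q_def)
    qed
    have "(r0, j0) \<in> I" using in0 r0 by (auto simp: I_def e_def)
    have "(\<lambda>(r, j). lk (v r) (xx (r, j), j)) (r0, j0) = 0"
    proof (rule solution_degrees_independent[OF I])
      show "r < n" if "(r, j) \<in> I" for r j using that by (simp add: I_def)
      show "(\<Sum>(r, j)\<in>I. (\<lambda>(r, j). lk (v r) (xx (r, j), j)) (r, j) * ind r (b - j) * sol_coeff (b - j)) = 0"
        if "b \<le> Jb" for b using z[OF that] by simp
    qed fact
    then show ?thesis by (simp add: xx_def e_def)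
  qed
  then show ?thesis by (intro poly_mapping_eqI) (auto simp: in_keys_iff)
qed

end

section \<open>Free cyclic quotients\<close>

definition Vn :: "nat \<Rightarrow> (nat \<Rightarrow> 'b::zero) set"
  where "Vn n = {v. \<forall>r\<ge>n. v r = 0}"

definition unit_vec :: "nat \<Rightarrow> nat \<Rightarrow> 'b::zero_neq_one"
  where "unit_vec r s = (if s = r then 1 else 0)"

definition comb :: "nat \<Rightarrow> (nat \<Rightarrow> ('k::comm_monoid_add \<Rightarrow>\<^sub>0 complex) \<Rightarrow> ('k \<Rightarrow>\<^sub>0 complex)) \<Rightarrow> (nat \<Rightarrow> 'k \<Rightarrow>\<^sub>0 complex)
    \<Rightarrow> ('k \<Rightarrow>\<^sub>0 complex) \<Rightarrow> ('k \<Rightarrow>\<^sub>0 complex)"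
  where "comb n Q v f = (\<Sum>r<n. v r * Q r f)"

text \<open>The effect on coordinates of \<open>Q\<^sub>r \<mapsto> Q\<^sub>r\<^sub>+\<^sub>1\<close>, where \<open>Q\<^sub>n\<close> is congruent to \<open>T Q\<^sub>0\<close> modulo the relations.\<close>

definition cyc :: "nat \<Rightarrow> 'b::mult_zero \<Rightarrow> (nat \<Rightarrow> 'b) \<Rightarrow> nat \<Rightarrow> 'b"
  where "cyc n T v r = (if r = 0 then T * v (n - 1) else if r < n then v (r - 1) else 0)"

lemma unit_vec_Vn: "r < n \<Longrightarrow> unit_vec r \<in> Vn n"
  by (auto simp: Vn_def unit_vec_def)

lemma comb_unit_vec: "r < n \<Longrightarrow> comb n Q (unit_vec r) = Q r"
  by (rule ext) (simp add: comb_def unit_vec_def if_distrib[of "\<lambda>x. x * _"] cong: if_cong)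

lemma comb_add: "comb n Q (v + w) f = comb n Q v f + comb n Q w f"
  by (simp add: comb_def distrib_right sum.distrib)

lemma comb_diff: "comb n Q (v - w) f = comb n Q v f - comb n Q w f"
  by (simp add: comb_def left_diff_distrib sum_subtractf)

lemma comb_scale: "comb n Q (\<lambda>r. g * v r) f = g * comb n Q v f"
  by (simp add: comb_def sum_distrib_left mult.assoc)

lemma Vn_closed:
  "0 \<in> Vn n" "v \<in> Vn n \<Longrightarrow> w \<in> Vn n \<Longrightarrow> v + w \<in> Vn n" "v \<in> Vn n \<Longrightarrow> w \<in> Vn n \<Longrightarrow> v - w \<in> Vn n"
  for v w :: "nat \<Rightarrow> 'b::ab_group_add"
  by (simp_all add: Vn_def)

lemma Vn_scale: "v \<in> Vn n \<Longrightarrow> (\<lambda>r. g * v r) \<in> Vn n" for g :: "'b::mult_zero"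
  by (simp add: Vn_def)

lemma cyc_Vn: "n \<ge> 1 \<Longrightarrow> cyc n T v \<in> Vn n"
  by (simp add: Vn_def cyc_def)

lemma cyc_sum:
  fixes q :: "nat \<Rightarrow> 'b::comm_ring_1"
  assumes "n \<ge> 1"
  shows "(\<Sum>r<n. v r * q (Suc r)) = (\<Sum>r<n. cyc n T v r * q r) + v (n - 1) * (q n - T * q 0)"
proof -
  obtain m where n: "n = Suc m" using assms by (cases n) auto
  have "(\<Sum>r<n. cyc n T v r * q r) = T * v m * q 0 + (\<Sum>r<m. v r * q (Suc r))"
    unfolding n sum.lessThan_Suc_shift by (simp add: cyc_def)
  then show ?thesis by (simp add: n algebra_simps)
qed

text \<open>A cyclic left module with two relations \<open>E1\<close> and \<open>E2\<close> that is free on the classes of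
  \<open>Q 0, \<dots>, Q (n - 1)\<close> over the functions. The condition \<open>gen\<close> is the division by the relations, which
  is known for generators only; \<open>indep\<close> is the independence shown with formal solutions. A module with
  a single relation is included by taking \<open>E1 = E2\<close>.\<close>

locale free_quotient =
  fixes n :: nat
    and G :: "(('k::comm_monoid_add \<Rightarrow>\<^sub>0 complex) \<Rightarrow> ('k \<Rightarrow>\<^sub>0 complex)) set"
    and R :: "(('k \<Rightarrow>\<^sub>0 complex) \<Rightarrow> ('k \<Rightarrow>\<^sub>0 complex)) ring"
    and I :: "(('k \<Rightarrow>\<^sub>0 complex) \<Rightarrow> ('k \<Rightarrow>\<^sub>0 complex)) set"
    and E1 E2 :: "('k \<Rightarrow>\<^sub>0 complex) \<Rightarrow> ('k \<Rightarrow>\<^sub>0 complex)"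
    and Q :: "nat \<Rightarrow> ('k \<Rightarrow>\<^sub>0 complex) \<Rightarrow> ('k \<Rightarrow>\<^sub>0 complex)"
  assumes n_pos: "n \<ge> 1" and R: "R = diff_ops G" and G: "G \<subseteq> carrier End_C"
    and I: "I = left_ideal R {E1, E2}" and E1: "E1 \<in> carrier R" and E2: "E2 \<in> carrier R"
    and Q: "\<And>r. Q r \<in> carrier R" and Q_0: "Q 0 = id"
    and gen: "\<And>D v. D \<in> G \<Longrightarrow> \<exists>w. \<exists>A\<in>carrier R. \<exists>B\<in>carrier R.
      \<forall>f. D (comb n Q v f) = comb n Q w f + (A (E1 f) + B (E2 f))"
    and indep: "\<And>A B v r. A \<in> carrier R \<Longrightarrow> B \<in> carrier R \<Longrightarrow>
      (\<And>f. comb n Q v f = A (E1 f) + B (E2 f)) \<Longrightarrow> r < n \<Longrightarrow> v r = 0"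
begin

lemmas R_closed = diff_ops_closed[OF G, folded R]

lemma comp_closed: "S \<in> carrier R \<Longrightarrow> T \<in> carrier R \<Longrightarrow> (\<lambda>f. S (T f)) \<in> carrier R"
  using R_closed(5)[of S T] by (simp add: comp_def)

lemma R_add: "S \<in> carrier R \<Longrightarrow> S (f + g) = S f + S g"
  unfolding R by (rule diff_ops_additive[OF G])

lemma R_zero: "(\<lambda>_. 0) \<in> carrier R"
proof -
  have "(*) 0 = (\<lambda>_. 0 :: 'k \<Rightarrow>\<^sub>0 complex)" by (rule ext) simp
  then show ?thesis using R_closed(2)[of 0] by (simp only:)
qed

lemma I_eq: "I = {\<lambda>f. A (E1 f) + B (E2 f) | A B. A \<in> carrier R \<and> B \<in> carrier R}"
proof -
  have "ring R" unfolding R by (rule ring_diff_ops[OF G])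
  from left_ideal_pair[OF this E1 E2] show ?thesis by (simp add: I R comp_def)
qed

lemma I_intro:
  assumes "A \<in> carrier R" "B \<in> carrier R" "\<And>f. S f = A (E1 f) + B (E2 f)"
  shows "S \<in> I"
proof -
  have "S = (\<lambda>f. A (E1 f) + B (E2 f))" using assms(3) by (rule ext)
  then show ?thesis unfolding I_eq using assms(1,2) by blast
qed

lemma I_elim:
  assumes "S \<in> I"
  obtains A B where "A \<in> carrier R" "B \<in> carrier R" "S = (\<lambda>f. A (E1 f) + B (E2 f))"
  using assms unfolding I_eq by blast

lemma I_zero: "(\<lambda>_. 0) \<in> I"
  by (rule I_intro[OF R_zero R_zero]) simp

lemma I_carrier: "I \<subseteq> carrier R"
proof
  fix S assume "S \<in> I"
  then show "S \<in> carrier R" using R_closed(4)[OF comp_closed[OF _ E1] comp_closed[OF _ E2]] by (elim I_elim) simp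
qed

lemma I_add:
  assumes "S \<in> I" "T \<in> I" shows "(\<lambda>f. S f + T f) \<in> I"
proof -
  obtain A B A' B' where *: "A \<in> carrier R" "B \<in> carrier R" "S = (\<lambda>f. A (E1 f) + B (E2 f))"
    "A' \<in> carrier R" "B' \<in> carrier R" "T = (\<lambda>f. A' (E1 f) + B' (E2 f))"
    using assms by (elim I_elim) blast
  show ?thesis by (rule I_intro[OF R_closed(4)[OF *(1,4)] R_closed(4)[OF *(2,5)]]) (simp add: *(3,6))
qed

lemma I_left:
  assumes S: "S \<in> carrier R" and T: "T \<in> I" shows "(\<lambda>f. S (T f)) \<in> I"
proof -
  obtain A B where *: "A \<in> carrier R" "B \<in> carrier R" "T = (\<lambda>f. A (E1 f) + B (E2 f))"
    using T by (rule I_elim)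
  show ?thesis by (rule I_intro[OF comp_closed[OF S *(1)] comp_closed[OF S *(2)]]) (simp add: *(3) R_add[OF S])
qed

lemma I_neg: "S \<in> I \<Longrightarrow> (\<lambda>f. - S f) \<in> I"
  using I_left[OF R_closed(2)[of "-1"], of S] by simp

lemma I_diff: "S \<in> I \<Longrightarrow> T \<in> I \<Longrightarrow> (\<lambda>f. S f - T f) \<in> I"
  using I_add[OF _ I_neg, of S T] by simp

lemma comb_carrier: "comb n Q v \<in> carrier R"
proof -
  have "(\<lambda>f. \<Sum>r<k. v r * Q r f) \<in> carrier R" for k
  proof (induction k)
    case 0
    show ?case using R_zero by simp
  next
    case (Suc k)
    have "(\<lambda>f. v k * Q k f) \<in> carrier R" using comp_closed[OF R_closed(2) Q] .
    from R_closed(4)[OF Suc this] show ?case by simp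
  qed
  then show ?thesis by (simp add: comb_def[abs_def])
qed

text \<open>The combinations of the \<open>Q r\<close> modulo \<open>I\<close> are stable under left multiplication by generators, hence by
  every operator. They contain \<open>Q 0 = id\<close>, and therefore exhaust the ring.\<close>

lemma span_left:
  assumes "S \<in> carrier R" "(\<lambda>f. P f - comb n Q v f) \<in> I"
  shows "\<exists>w. (\<lambda>f. S (P f) - comb n Q w f) \<in> I"
proof -
  have "\<exists>w. (\<lambda>f. S (comb n Q v f) - comb n Q w f) \<in> I" for v
    using assms(1) unfolding R
  proof (induction S arbitrary: v rule: diff_ops_induct[OF G, consumes 1, case_names id mult gen neg add comp])
    case id
    show ?case by (rule exI[of _ v]) (simp add: I_zero)
  next
    case (mult g)
    show ?case by (rule exI[of _ "\<lambda>r. g * v r"]) (simp add: comb_scale I_zero)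
  next
    case (gen D)
    obtain w A B where "A \<in> carrier R" "B \<in> carrier R"
      "\<forall>f. D (comb n Q v f) = comb n Q w f + (A (E1 f) + B (E2 f))"
      using free_quotient_axioms gen unfolding free_quotient_def by blast
    then show ?case by (intro exI[of _ w] I_intro) simp_all
  next
    case (neg S)
    from neg(2) obtain w where "(\<lambda>f. S (comb n Q v f) - comb n Q w f) \<in> I" by blast
    from I_neg[OF this] show ?case
      by (intro exI[of _ "\<lambda>r. - w r"]) (simp add: comb_def sum_negf)
  next
    case (add S T)
    from add(3,4) obtain w w' where "(\<lambda>f. S (comb n Q v f) - comb n Q w f) \<in> I"
      "(\<lambda>f. T (comb n Q v f) - comb n Q w' f) \<in> I" by blast
    from I_add[OF this] show ?case by (intro exI[of _ "\<lambda>r. w r + w' r"]) (simp add: comb_def distrib_right sum.distrib algebra_simps)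
  next
    case (comp S T)
    from comp(4) obtain w where w: "(\<lambda>f. T (comb n Q v f) - comb n Q w f) \<in> I" by blast
    from comp(3) obtain w' where w': "(\<lambda>f. S (comb n Q w f) - comb n Q w' f) \<in> I" by blast
    have S: "S \<in> carrier R" using comp(1) by (simp add: R)
    from I_add[OF I_left[OF S w] w'] show ?case
      by (intro exI[of _ w']) (simp add: additive_diff(3)[of S, OF R_add[OF S]])
  qed
  then obtain w where "(\<lambda>f. S (comb n Q v f) - comb n Q w f) \<in> I" by blast
  from I_add[OF I_left[OF assms] this] show ?thesis
    by (intro exI[of _ w]) (simp add: additive_diff(3)[of S, OF R_add[OF assms(1)]])
qed

lemma span: "P \<in> carrier R \<Longrightarrow> \<exists>v. (\<lambda>f. P f - comb n Q v f) \<in> I"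
proof -
  have "(\<lambda>f. Q 0 f - comb n Q (unit_vec 0) f) \<in> I"
    using n_pos I_zero by (simp add: comb_unit_vec)
  from span_left[OF _ this, of P] show "P \<in> carrier R \<Longrightarrow> ?thesis" by (simp add: Q_0)
qed

lemma indep_I: "comb n Q v \<in> I \<Longrightarrow> r < n \<Longrightarrow> v r = 0"
  by (elim I_elim) (rule indep, simp_all)

definition coords :: "(('k \<Rightarrow>\<^sub>0 complex) \<Rightarrow> ('k \<Rightarrow>\<^sub>0 complex)) \<Rightarrow> nat \<Rightarrow> 'k \<Rightarrow>\<^sub>0 complex"
  where "coords P = (THE v. v \<in> Vn n \<and> (\<lambda>f. P f - comb n Q v f) \<in> I)"

lemma coords_unique:
  assumes "v \<in> Vn n" "(\<lambda>f. P f - comb n Q v f) \<in> I" "w \<in> Vn n" "(\<lambda>f. P f - comb n Q w f) \<in> I"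
  shows "v = w"
proof -
  have "comb n Q (v - w) \<in> I"
    using I_diff[OF assms(4,2)] by (simp add: comb_diff[abs_def])
  then have "(v - w) r = 0" if "r < n" for r using indep_I that by blast
  moreover have "v r = w r" if "r \<ge> n" for r using assms that by (simp add: Vn_def)
  ultimately show ?thesis by (intro ext) (metis eq_iff_diff_eq_0 minus_apply not_le)
qed

lemma coords_eq:
  assumes "v \<in> Vn n" "(\<lambda>f. P f - comb n Q v f) \<in> I"
  shows "coords P = v"
  unfolding coords_def using assms coords_unique by (intro the_equality) blast+

lemma coords:
  assumes "P \<in> carrier R"
  shows "coords P \<in> Vn n" "(\<lambda>f. P f - comb n Q (coords P) f) \<in> I"
proof -
  obtain v where v: "(\<lambda>f. P f - comb n Q v f) \<in> I" using span[OF assms] by blast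
  define w where "w = (\<lambda>r. if r < n then v r else 0)"
  have "comb n Q w = comb n Q v" by (rule ext) (simp add: comb_def w_def)
  then have w: "w \<in> Vn n" "(\<lambda>f. P f - comb n Q w f) \<in> I" using v by (simp_all add: w_def Vn_def)
  have "coords P = w" by (rule coords_eq[OF w])
  then show "coords P \<in> Vn n" "(\<lambda>f. P f - comb n Q (coords P) f) \<in> I" using w by simp_all
qed

lemma coords_add:
  assumes "S \<in> carrier R" "T \<in> carrier R"
  shows "coords (\<lambda>f. S f + T f) = coords S + coords T"
proof (rule coords_eq)
  show "coords S + coords T \<in> Vn n" using coords(1) assms by (intro Vn_closed)
  show "(\<lambda>f. S f + T f - comb n Q (coords S + coords T) f) \<in> I"
    using I_add[OF coords(2)[OF assms(1)] coords(2)[OF assms(2)]] by (simp add: comb_add algebra_simps)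
qed

lemma coords_comb: "v \<in> Vn n \<Longrightarrow> coords (comb n Q v) = v"
  using I_zero by (intro coords_eq) simp_all

lemma coords_I: "P \<in> I \<Longrightarrow> coords P = 0"
  by (intro coords_eq) (simp_all add: Vn_closed comb_def)

lemma coords_op:
  assumes D: "D \<in> carrier R" and P: "P \<in> carrier R" and v: "coords P = v"
    and w: "w \<in> Vn n" "(\<lambda>f. D (comb n Q v f) - comb n Q w f) \<in> I"
  shows "coords (\<lambda>f. D (P f)) = w"
proof (rule coords_eq[OF w(1)])
  have "(\<lambda>f. D (P f) - D (comb n Q v f)) \<in> I"
    using I_left[OF D coords(2)[OF P]] v by (simp add: additive_diff(3)[of D, OF R_add[OF D]])
  from I_add[OF this w(2)] show "(\<lambda>f. D (P f) - comb n Q w f) \<in> I" by simp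
qed

lemma coords_mult:
  assumes "P \<in> carrier R"
  shows "coords (\<lambda>f. g * P f) = (\<lambda>r. g * coords P r)"
  using I_zero by (intro coords_op[OF R_closed(2) assms refl Vn_scale[OF coords(1)[OF assms]]]) (simp add: comb_scale)

sublocale additive_fibres "regular_module R" coords
proof
  fix S T assume *: "S \<in> carrier (regular_module R)" "T \<in> carrier (regular_module R)"
  then have c: "S \<in> carrier R" "T \<in> carrier R" by (simp_all add: regular_module_def)
  show "S \<oplus>\<^bsub>regular_module R\<^esub> T \<in> carrier (regular_module R)"
    using R_closed(4)[OF c] by (simp add: regular_module_def R)
  show "coords (S \<oplus>\<^bsub>regular_module R\<^esub> T) = coords S + coords T"
    using coords_add[OF c] by (simp add: regular_module_def R)
  have "(\<lambda>f. T f + - S f) \<in> carrier R" by (rule R_closed(4)[OF c(2) R_closed(6)[OF c(1)]])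
  then show "\<exists>z\<in>carrier (regular_module R). z \<oplus>\<^bsub>regular_module R\<^esub> S = T"
    by (intro bexI[of _ "\<lambda>f. T f + - S f"]) (simp_all add: regular_module_def R)
next
  show "carrier (regular_module R) \<noteq> {}" using R_closed(1) by (auto simp: regular_module_def)
qed

lemma carrier_regular: "carrier (regular_module R) = carrier R"
  by (simp add: regular_module_def)

lemma smult_regular: "module.smult (regular_module R) r P = (\<lambda>f. r (P f))"
  by (simp add: regular_module_def R comp_def)

lemma fib_zero: "fib 0 = I"
proof
  show "I \<subseteq> fib 0" using I_carrier coords_I by (auto simp: fib_def carrier_regular)
  show "fib 0 \<subseteq> I"
  proof
    fix P assume "P \<in> fib 0"
    then have "P \<in> carrier R" "coords P = 0" by (auto simp: fib_def carrier_regular)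
    then show "P \<in> I" using coords(2)[of P] by (simp add: comb_def)
  qed
qed

lemma Im_eq: "Im = Vn n"
proof
  show "Im \<subseteq> Vn n" using coords(1) by (auto simp: carrier_regular)
  show "Vn n \<subseteq> Im" using coords_comb comb_carrier by (metis carrier_regular imageI subsetI)
qed

abbreviation "M \<equiv> quot_module (regular_module R) I"

lemmas M_carrier = carrier_quot[unfolded fib_zero Im_eq]
lemmas M_add = add_quot[unfolded fib_zero Im_eq]
lemmas M_zero = zero_quot[unfolded fib_zero]
lemmas M_inj = fib_eq_iff[unfolded Im_eq]
lemma M_class:
  assumes "P \<in> carrier R"
  shows "I +>\<^bsub>R\<^esub> P = fib (coords P)"
proof -
  have "S +>\<^bsub>R\<^esub> P = S +>\<^bsub>regular_module R\<^esub> P" for S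
    by (simp add: a_r_coset_def r_coset_def regular_module_def)
  then show ?thesis using coset[of P] assms by (simp add: fib_zero carrier_regular)
qed

lemma M_smult:
  assumes D: "D \<in> carrier R" and v: "v \<in> Vn n"
    and w: "w \<in> Vn n" "(\<lambda>f. D (comb n Q v f) - comb n Q w f) \<in> I"
  shows "D \<odot>\<^bsub>M\<^esub> fib v = fib w"
proof -
  have "induced_op (regular_module R) (fib 0) (module.smult (regular_module R) D) (fib v) = fib w"
  proof (rule induced_fib)
    show "v \<in> Im" using v by (simp add: Im_eq)
    fix P assume P: "P \<in> carrier (regular_module R)" "coords P = v"
    then show "D \<odot>\<^bsub>regular_module R\<^esub> P \<in> carrier (regular_module R) \<and> coords (D \<odot>\<^bsub>regular_module R\<^esub> P) = w"
      using coords_op[OF D _ P(2) w] comp_closed[OF D] by (simp add: carrier_regular smult_regular)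
  qed
  then show ?thesis by (simp add: fib_zero quot_module_def)
qed

lemma M_mult:
  assumes "v \<in> Vn n"
  shows "(*) g \<odot>\<^bsub>M\<^esub> fib v = fib (\<lambda>r. g * v r)"
  using I_zero by (intro M_smult[OF R_closed(2) assms Vn_scale[OF assms]]) (simp add: comb_scale)

end

context hypergeometric
begin

text \<open>The connections in the basis \<open>Q\<^sub>r\<close>. They come from \<open>t\<partial>\<^sub>t Q\<^sub>r = Q\<^sub>r\<^sub>+\<^sub>1 + a\<^sub>r\<^sub>+\<^sub>1 Q\<^sub>r\<close> and its analogue with \<open>z\<close>,
  and from the elimination of \<open>z\<^sup>2\<partial>\<^sub>z\<close> by the Euler relation.\<close>

definition conn :: "(nat \<Rightarrow> O_t) \<Rightarrow> nat \<Rightarrow> O_t"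
  where "conn v r = d_t (v r) + mon (-1) * (cst (of_real (a (Suc r))) * v r + cyc n (mon 1) v r)"

definition conn_t :: "(nat \<Rightarrow> O_zt) \<Rightarrow> nat \<Rightarrow> O_zt"
  where "conn_t v r = zdt (v r)
    + mon (0, -1) * (cst (of_real (a (Suc r))) * mon (1, 0) * v r + cyc n (mon (0, 1)) v r)"

definition conn_z :: "(nat \<Rightarrow> O_zt) \<Rightarrow> nat \<Rightarrow> O_zt"
  where "conn_z v r = z2dz (v r)
    + cst (of_real (real r - \<gamma> - real n * a (Suc r))) * mon (1, 0) * v r - of_nat n * cyc n (mon (0, 1)) v r"

lemma conn_Vn: "v \<in> Vn n \<Longrightarrow> conn v \<in> Vn n" "w \<in> Vn n \<Longrightarrow> conn_t w \<in> Vn n" "w \<in> Vn n \<Longrightarrow> conn_z w \<in> Vn n"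
  using cyc_Vn[OF n, of "mon 1" v] cyc_Vn[OF n, of "mon (0, 1)" w]
  by (simp_all add: Vn_def conn_def conn_t_def conn_z_def deriv_diff z2dz_def zdt_def)

lemma tinv: "mon (-1) * (mon 1 * f) = (f :: O_t)" "mon (0, -1) * (mon (0, 1) * g) = (g :: O_zt)"
  by (simp_all add: mult_single single_one zero_prod_def flip: mult.assoc)
     (metis mult_1_left single_one zero_prod_def)

lemma d_t_Q: "d_t (Q r f) = mon (-1) * (Q (Suc r) f + cst (of_real (a (Suc r))) * Q r f)"
proof -
  have "Q (Suc r) f = tdt_shift (a (Suc r)) (Q r f)"
    unfolding Q_def by (rule op_prod_Suc')
      (simp add: tdt_shift_def deriv_diff deriv_add deriv_mult deriv_cst algebra_simps)
  then have "Q (Suc r) f + cst (of_real (a (Suc r))) * Q r f = mon 1 * d_t (Q r f)"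
    by (simp add: tdt_shift_def)
  then show ?thesis by (simp add: tinv)
qed

lemma conn_comb:
  "d_t (comb n Q v f) = comb n Q (conn v) f + mon (-1) * v (n - 1) * hyp_op n a f"
proof -
  have "d_t (comb n Q v f) = (\<Sum>r<n. d_t (v r) * Q r f + v r * d_t (Q r f))"
    by (simp add: comb_def additive_sum[of d_t, OF deriv_add(1)] deriv_mult)
  also have "\<dots> = (\<Sum>r<n. (d_t (v r) + mon (-1) * (cst (of_real (a (Suc r))) * v r)) * Q r f)
      + mon (-1) * (\<Sum>r<n. v r * Q (Suc r) f)"
    unfolding sum_distrib_left sum.distrib[symmetric]
    by (intro sum.cong refl) (simp add: d_t_Q algebra_simps)
  also have "(\<Sum>r<n. v r * Q (Suc r) f) = comb n Q (cyc n (mon 1) v) f + v (n - 1) * hyp_op n a f"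
    using cyc_sum[OF n, of v "\<lambda>r. Q r f" "mon 1"] by (simp add: comb_def hyp_op_Q Q_def)
  finally show ?thesis
    by (simp add: comb_def conn_def sum_distrib_left sum.distrib algebra_simps)
qed

lemma zdt_Qh: "zdt (Qh r f) = mon (0, -1) * (Qh (Suc r) f + cst (of_real (a (Suc r))) * mon (1, 0) * Qh r f)"
proof -
  have "Qh (Suc r) f = ztdt_shift (a (Suc r)) (Qh r f)"
    unfolding Qh_def by (rule op_prod_Suc')
      (simp add: ztdt_shift_def deriv_diff deriv_add deriv_mult deriv_cst deriv_single algebra_simps)
  then have "Qh (Suc r) f + cst (of_real (a (Suc r))) * mon (1, 0) * Qh r f = mon (0, 1) * zdt (Qh r f)"
    by (simp add: ztdt_shift_def zdt_def algebra_simps)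
  then show ?thesis by (simp add: tinv)
qed

lemma conn_t_comb:
  "zdt (comb n Qh v f) = comb n Qh (conn_t v) f + mon (0, -1) * v (n - 1) * hyp_rel_t n a f"
proof -
  have "zdt (comb n Qh v f) = (\<Sum>r<n. zdt (v r) * Qh r f + v r * zdt (Qh r f))"
    by (simp add: comb_def additive_sum[of zdt, OF z_ops_add(2)] z_ops_mult)
  also have "\<dots> = (\<Sum>r<n. (zdt (v r) + mon (0, -1) * (cst (of_real (a (Suc r))) * mon (1, 0) * v r)) * Qh r f)
      + mon (0, -1) * (\<Sum>r<n. v r * Qh (Suc r) f)"
    unfolding sum_distrib_left sum.distrib[symmetric]
    by (intro sum.cong refl) (simp add: zdt_Qh algebra_simps)
  also have "(\<Sum>r<n. v r * Qh (Suc r) f) = comb n Qh (cyc n (mon (0, 1)) v) f + v (n - 1) * hyp_rel_t n a f"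
    using cyc_sum[OF n, of v "\<lambda>r. Qh r f" "mon (0, 1)"] by (simp add: comb_def rel_t_Qh Qh_def)
  finally show ?thesis
    by (simp add: comb_def conn_t_def sum_distrib_left sum.distrib algebra_simps)
qed

text \<open>\<open>Q\<^sub>r\<close> is homogeneous of degree \<open>r\<close> in \<open>z\<close>, so moving \<open>z\<^sup>2\<partial>\<^sub>z\<close> across it costs \<open>rz\<close>. Then the Euler relation
  replaces \<open>z\<^sup>2\<partial>\<^sub>z\<close> by \<open>-ntz\<partial>\<^sub>t - \<gamma>z\<close>, which commutes with \<open>Q\<^sub>r\<close>.\<close>

lemma z2dz_Qh: "z2dz (Qh r f) = cst (of_real (real r - \<gamma> - real n * a (Suc r))) * mon (1, 0) * Qh r f
    - of_nat n * Qh (Suc r) f + Qh r (hyp_rel_z n a f)"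
proof (induction f rule: poly_mapping_add_induct)
  case (single k c)
  obtain x b where k: "k = (x, b)" by (cases k)
  have 1: "cst d * mon (1, 0) * sg (y, b) e = sg (Suc y, b) (d * e)" for d e :: complex and y
    by (simp add: mult_single mult.assoc)
  show ?case
    unfolding k rel_z_single Qh_single z2dz_single 1 of_nat_mult_single ind_Suc
    by (simp add: algebra_simps flip: single_add single_diff)
next
  case (add f g)
  then show ?case by (simp add: Qh_add z_ops_add rel_z_add algebra_simps)
qed

lemma conn_z_comb:
  "z2dz (comb n Qh v f) = comb n Qh (conn_z v) f + comb n Qh v (hyp_rel_z n a f)
    - of_nat n * v (n - 1) * hyp_rel_t n a f"
proof -
  have "z2dz (comb n Qh v f) = (\<Sum>r<n. z2dz (v r) * Qh r f + v r * z2dz (Qh r f))"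
    by (simp add: comb_def additive_sum[of z2dz, OF z_ops_add(1)] z_ops_mult)
  also have "\<dots> = (\<Sum>r<n. (z2dz (v r) + cst (of_real (real r - \<gamma> - real n * a (Suc r))) * mon (1, 0) * v r) * Qh r f)
      - of_nat n * (\<Sum>r<n. v r * Qh (Suc r) f) + comb n Qh v (hyp_rel_z n a f)"
    unfolding sum_distrib_left sum.distrib[symmetric] sum_subtractf[symmetric] comb_def
    by (intro sum.cong refl) (simp add: z2dz_Qh algebra_simps)
  also have "(\<Sum>r<n. v r * Qh (Suc r) f) = comb n Qh (cyc n (mon (0, 1)) v) f + v (n - 1) * hyp_rel_t n a f"
    using cyc_sum[OF n, of v "\<lambda>r. Qh r f" "mon (0, 1)"] by (simp add: comb_def rel_t_Qh Qh_def)
  finally show ?thesis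
    by (simp add: comb_def conn_z_def sum_distrib_left sum.distrib sum_subtractf algebra_simps)
qed

end

section \<open>The hypergeometric modules in coordinates\<close>

lemmas D_Gm_closed = diff_ops_closed[OF gens_End_C(1), folded D_Gm_def]
lemmas R_int_closed = diff_ops_closed[OF gens_End_C(2), folded R_int_def]

lemma D_Gm_comp: "S \<in> carrier D_Gm \<Longrightarrow> T \<in> carrier D_Gm \<Longrightarrow> (\<lambda>f. S (T f)) \<in> carrier D_Gm"
  using D_Gm_closed(5)[of S T] by (simp add: comp_def)

lemma R_int_comp: "S \<in> carrier R_int \<Longrightarrow> T \<in> carrier R_int \<Longrightarrow> (\<lambda>f. S (T f)) \<in> carrier R_int"
  using R_int_closed(5)[of S T] by (simp add: comp_def)

lemma d_t_D_Gm: "d_t \<in> carrier D_Gm" by (rule D_Gm_closed(3)) simp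
lemma zdt_R_int: "zdt \<in> carrier R_int" by (rule R_int_closed(3)) simp
lemma z2dz_R_int: "z2dz \<in> carrier R_int" by (rule R_int_closed(3)) simp

context hypergeometric
begin

lemma Q_D_Gm: "Q r \<in> carrier D_Gm"
proof -
  have t: "tdt_shift c \<in> carrier D_Gm" for c
  proof -
    have "(\<lambda>f. mon 1 * d_t f + - cst (of_real c) * f) \<in> carrier D_Gm"
      by (rule D_Gm_closed(4)[OF D_Gm_comp[OF D_Gm_closed(2) d_t_D_Gm] D_Gm_closed(2)])
    then show ?thesis by (simp add: tdt_shift_def[abs_def])
  qed
  show ?thesis
  proof (induction r)
    case 0
    show ?case unfolding Q_def op_prod_0 by (rule D_Gm_closed(1))
  next
    case (Suc r)
    have "Q (Suc r) = (\<lambda>f. Q r (tdt_shift (a (Suc r)) f))" by (simp add: Q_def op_prod_Suc fun_eq_iff)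
    then show ?case using D_Gm_comp[OF Suc t] by simp
  qed
qed

lemma Qh_R_int: "Qh r \<in> carrier R_int"
proof -
  have t: "ztdt_shift c \<in> carrier R_int" for c
  proof -
    have "(\<lambda>f. mon (0, 1) * zdt f + (- cst (of_real c) * mon (1, 0)) * f) \<in> carrier R_int"
      by (rule R_int_closed(4)[OF R_int_comp[OF R_int_closed(2) zdt_R_int] R_int_closed(2)])
    then show ?thesis by (simp add: ztdt_shift_def[abs_def] zdt_def algebra_simps)
  qed
  show ?thesis
  proof (induction r)
    case 0
    show ?case unfolding Qh_def op_prod_0 by (rule R_int_closed(1))
  next
    case (Suc r)
    have "Qh (Suc r) = (\<lambda>f. Qh r (ztdt_shift (a (Suc r)) f))" by (simp add: Qh_def op_prod_Suc fun_eq_iff)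
    then show ?case using R_int_comp[OF Suc t] by simp
  qed
qed

lemma comb_R_int: "comb m Qh v \<in> carrier R_int"
proof (induction m)
  case 0
  show ?case using R_int_closed(2)[of 0] by (simp add: comb_def[abs_def] mult_zero_left[abs_def])
next
  case (Suc m)
  have "(\<lambda>f. comb m Qh v f + v m * Qh m f) \<in> carrier R_int"
    by (rule R_int_closed(4)[OF Suc R_int_comp[OF R_int_closed(2) Qh_R_int]])
  then show ?case by (simp add: comb_def[abs_def])
qed

lemma hyp_op_D_Gm: "hyp_op n a \<in> carrier D_Gm"
proof -
  have "(\<lambda>f. Q n f + - mon 1 * f) \<in> carrier D_Gm"
    by (rule D_Gm_closed(4)[OF Q_D_Gm D_Gm_closed(2)])
  then show ?thesis by (simp add: hyp_op_Q[abs_def])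
qed

lemma rel_t_R_int: "hyp_rel_t n a \<in> carrier R_int"
proof -
  have "(\<lambda>f. Qh n f + - mon (0, 1) * f) \<in> carrier R_int"
    by (rule R_int_closed(4)[OF Qh_R_int R_int_closed(2)])
  then show ?thesis by (simp add: rel_t_Qh[abs_def])
qed

lemma rel_z_R_int: "hyp_rel_z n a \<in> carrier R_int"
proof -
  have "(\<lambda>f. (z2dz f + (of_nat n * mon (0, 1)) * zdt f) + (cst (of_real \<gamma>) * mon (1, 0)) * f) \<in> carrier R_int"
    by (rule R_int_closed(4)[OF R_int_closed(4)[OF z2dz_R_int R_int_comp[OF R_int_closed(2) zdt_R_int]] R_int_closed(2)])
  then show ?thesis by (simp add: hyp_rel_z_def[abs_def])
qed

lemma Q_0: "Q 0 = id"
  by (simp add: Q_def)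

lemma Qh_0: "Qh 0 = id"
  by (simp add: Qh_def)

sublocale H: free_quotient n "{d_t}" D_Gm "hyp_ideal n a" "hyp_op n a" "hyp_op n a" Q
proof
  show "hyp_ideal n a = left_ideal D_Gm {hyp_op n a, hyp_op n a}" by (simp add: hyp_ideal_def)
  show "\<exists>w. \<exists>A\<in>carrier D_Gm. \<exists>B\<in>carrier D_Gm.
      \<forall>f. D (comb n Q v f) = comb n Q w f + (A (hyp_op n a f) + B (hyp_op n a f))"
    if "D \<in> {d_t}" for D v
    using that
    by (intro exI[of _ "conn v"] bexI[of _ "(*) (mon (-1) * v (n - 1))"] bexI[of _ "(*) 0"])
       (simp_all add: conn_comb D_Gm_closed(2))
  show "v r = 0" if "A \<in> carrier D_Gm" "B \<in> carrier D_Gm"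
    "\<And>f. comb n Q v f = A (hyp_op n a f) + B (hyp_op n a f)" "r < n" for A B v r
    using independence_H[OF D_Gm_closed(4)[OF that(1,2)] _ that(4)] that(3) by (simp add: comb_def)
qed (rule n D_Gm_def gens_End_C hyp_op_D_Gm Q_D_Gm Q_0)+

sublocale Hh: free_quotient n "{z2dz, zdt}" R_int "Hhat_ideal n a" "hyp_rel_z n a" "hyp_rel_t n a" Qh
proof
  show "\<exists>w. \<exists>A\<in>carrier R_int. \<exists>B\<in>carrier R_int.
      \<forall>f. D (comb n Qh v f) = comb n Qh w f + (A (hyp_rel_z n a f) + B (hyp_rel_t n a f))"
    if "D \<in> {z2dz, zdt}" for D v
  proof (cases "D = z2dz")
    case True
    then show ?thesis
      by (intro exI[of _ "conn_z v"] bexI[of _ "comb n Qh v"] bexI[of _ "(*) (- (of_nat n * v (n - 1)))"])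
         (simp_all add: conn_z_comb R_int_closed(2) comb_R_int)
  next
    case False
    then show ?thesis using that
      by (intro exI[of _ "conn_t v"] bexI[of _ "(*) 0"] bexI[of _ "(*) (mon (0, -1) * v (n - 1))"])
         (simp_all add: conn_t_comb R_int_closed(2))
  qed
  show "v r = 0" if "A \<in> carrier R_int" "B \<in> carrier R_int"
    "\<And>f. comb n Qh v f = A (hyp_rel_z n a f) + B (hyp_rel_t n a f)" "r < n" for A B v r
    using independence_Hhat[OF that(1,2) _ that(4)] that(3) by (simp add: comb_def)
qed (rule n R_int_def gens_End_C Hhat_ideal_def rel_z_R_int rel_t_R_int Qh_R_int Qh_0)+

lemma hypH_eq: "hypH n a = H.M"
  by (simp add: hypH_def)

lemma Hhat_eq: "Hhat n a = Hh.M"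
  by (simp add: Hhat_def)

lemma hypH_smult:
  "v \<in> Vn n \<Longrightarrow> f \<odot>\<^bsub>hypH_O n a\<^esub> H.fib v = H.fib (\<lambda>r. f * v r)"
  "v \<in> Vn n \<Longrightarrow> d_t \<odot>\<^bsub>hypH n a\<^esub> H.fib v = H.fib (conn v)"
proof -
  show "v \<in> Vn n \<Longrightarrow> f \<odot>\<^bsub>hypH_O n a\<^esub> H.fib v = H.fib (\<lambda>r. f * v r)"
    using H.M_mult by (simp add: hypH_O_def restrict_scalars_def hypH_eq)
  assume v: "v \<in> Vn n"
  have "(\<lambda>f. d_t (comb n Q v f) - comb n Q (conn v) f) \<in> hyp_ideal n a"
    by (rule H.I_intro[of "(*) (mon (-1) * v (n - 1))" "(*) 0"]) (simp_all add: conn_comb D_Gm_closed(2))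
  then show "d_t \<odot>\<^bsub>hypH n a\<^esub> H.fib v = H.fib (conn v)"
    unfolding hypH_eq by (rule H.M_smult[OF d_t_D_Gm v conn_Vn(1)[OF v]])
qed

lemma Hhat_smult:
  "v \<in> Vn n \<Longrightarrow> f \<odot>\<^bsub>Hhat_O n a\<^esub> Hh.fib v = Hh.fib (\<lambda>r. f * v r)"
  "v \<in> Vn n \<Longrightarrow> zdt \<odot>\<^bsub>Hhat n a\<^esub> Hh.fib v = Hh.fib (conn_t v)"
  "v \<in> Vn n \<Longrightarrow> z2dz \<odot>\<^bsub>Hhat n a\<^esub> Hh.fib v = Hh.fib (conn_z v)"
proof -
  show "v \<in> Vn n \<Longrightarrow> f \<odot>\<^bsub>Hhat_O n a\<^esub> Hh.fib v = Hh.fib (\<lambda>r. f * v r)"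
    using Hh.M_mult by (simp add: Hhat_O_def restrict_scalars_def Hhat_eq)
  assume v: "v \<in> Vn n"
  have "(\<lambda>f. zdt (comb n Qh v f) - comb n Qh (conn_t v) f) \<in> Hhat_ideal n a"
    by (rule Hh.I_intro[of "(*) 0" "(*) (mon (0, -1) * v (n - 1))"]) (simp_all add: conn_t_comb R_int_closed(2))
  then show "zdt \<odot>\<^bsub>Hhat n a\<^esub> Hh.fib v = Hh.fib (conn_t v)"
    unfolding Hhat_eq by (rule Hh.M_smult[OF zdt_R_int v conn_Vn(2)[OF v]])
  have "(\<lambda>f. z2dz (comb n Qh v f) - comb n Qh (conn_z v) f) \<in> Hhat_ideal n a"
    by (rule Hh.I_intro[of "comb n Qh v" "(*) (- (of_nat n * v (n - 1)))"])
       (simp_all add: conn_z_comb R_int_closed(2) comb_R_int)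
  then show "z2dz \<odot>\<^bsub>Hhat n a\<^esub> Hh.fib v = Hh.fib (conn_z v)"
    unfolding Hhat_eq by (rule Hh.M_smult[OF z2dz_R_int v conn_Vn(3)[OF v]])
qed

lemma hypH_model:
  "carrier (hypH n a) = H.fib ` Vn n"
  "v \<in> Vn n \<Longrightarrow> w \<in> Vn n \<Longrightarrow> H.fib v \<oplus>\<^bsub>hypH n a\<^esub> H.fib w = H.fib (v + w)"
  "\<zero>\<^bsub>hypH n a\<^esub> = H.fib 0"
  by (simp_all only: hypH_eq H.M_carrier H.M_add H.M_zero H.fib_zero)

lemma Hhat_model:
  "carrier (Hhat n a) = Hh.fib ` Vn n"
  "v \<in> Vn n \<Longrightarrow> w \<in> Vn n \<Longrightarrow> Hh.fib v \<oplus>\<^bsub>Hhat n a\<^esub> Hh.fib w = Hh.fib (v + w)"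
  "\<zero>\<^bsub>Hhat n a\<^esub> = Hh.fib 0"
  by (simp_all only: Hhat_eq Hh.M_carrier Hh.M_add Hh.M_zero Hh.fib_zero)

lemma class_H: "r < n \<Longrightarrow> hypH_class n a (Q r) = H.fib (unit_vec r)"
  unfolding hypH_class_def H.M_class[OF Q_D_Gm]
  using H.coords_comb[OF unit_vec_Vn, of r] by (simp add: comb_unit_vec)

lemma class_Hhat: "r < n \<Longrightarrow> Hhat_ideal n a +>\<^bsub>R_int\<^esub> Qh r = Hh.fib (unit_vec r)"
  unfolding Hh.M_class[OF Qh_R_int]
  using Hh.coords_comb[OF unit_vec_Vn, of r] by (simp add: comb_unit_vec)

end

section \<open>The rescaled module\<close>

definition frag_sum :: "('k \<Rightarrow> nat \<Rightarrow> 'b::comm_ring_1) \<Rightarrow> ('k \<Rightarrow>\<^sub>0 int) \<Rightarrow> nat \<Rightarrow> 'b"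
  where "frag_sum h x = (\<Sum>k\<in>kys x. (\<lambda>r. of_int (lk x k) * h k r))"

lemma frag_sum_add: "frag_sum h (x + y) = frag_sum h x + frag_sum h y"
  unfolding frag_sum_def
  by (rule setsum_keys_plus_distrib[where f="\<lambda>k c r. of_int c * h k r"])
     (auto simp: fun_eq_iff distrib_right)

lemma frag_sum_of: "frag_sum h (frag_of k) = h k"
  by (simp add: frag_sum_def)

lemma keys_diff_subset: "kys x \<subseteq> K \<Longrightarrow> kys y \<subseteq> K \<Longrightarrow> kys (x - y) \<subseteq> K"
  using Poly_Mapping.keys_diff[of x y] by blast

lemma keys_add_subset: "kys x \<subseteq> K \<Longrightarrow> kys y \<subseteq> K \<Longrightarrow> kys (x + y) \<subseteq> K"
  using Poly_Mapping.keys_add[of x y] by blast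

text \<open>The two identities of the chain rule: with them the summands of \<open>chain_rule_op\<close> combine to the
  derivative of a product.\<close>

lemma mu_zdt: "mon (0, 0, -1) * mu_pull (zdt h) = mon (1, 0, 0) * d_t'' (mu_pull h)"
  by (induction h rule: poly_mapping_add_induct)
     (auto simp: zdt_single subst_single deriv_single mult_single z_ops_add subst_add deriv_add distrib_left
       split: prod.splits)

lemma mu_z2dz: "mon (0, 0, -2) * mu_pull (z2dz h) = mon (1, 0, 0) * d_\<theta> (mu_pull h)"
proof (induction h rule: poly_mapping_add_induct)
  case (single k c)
  then show ?case by (cases k) (simp add: z2dz_single subst_single deriv_single mult_single)
qed (simp add: z_ops_add subst_add deriv_add distrib_left)

lemma cyc_scale: "cyc n T (\<lambda>r. f * v r) r = f * cyc n T v r" for f :: "'b::comm_ring_1"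
  by (simp add: cyc_def)

lemma mu_cyc: "mu_pull (cyc n (mon (0, 1)) v r) = cyc n (mon (0, 1, 0)) (\<lambda>r. mu_pull (v r)) r"
  by (simp add: cyc_def subst_mult subst_single subst_diff)

lemma cyc_add:
  "cyc n T (v + w) r = cyc n T v r + cyc n T w r"
  "cyc n T (\<lambda>r. v r + w r) r = cyc n T v r + cyc n T w r" for T :: "'b::comm_ring_1"
  by (simp_all add: cyc_def distrib_left)

context hypergeometric
begin

definition hat_coord :: "(O_zt \<Rightarrow> O_zt) set \<Rightarrow> nat \<Rightarrow> O_zt"
  where "hat_coord C = (THE v. v \<in> Vn n \<and> C = Hh.fib v)"

lemma hat_coord: "v \<in> Vn n \<Longrightarrow> hat_coord (Hh.fib v) = v"
  unfolding hat_coord_def using Hh.M_inj by (intro the_equality) auto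

text \<open>The coordinates of \<open>f \<otimes> \<Sum>w\<^sub>r Q\<^sub>r\<close> are \<open>f \<cdot> \<mu>\<^sup>*w\<^sub>r\<close>.\<close>

definition tcoord :: "presc \<Rightarrow> nat \<Rightarrow> O_zt\<theta>"
  where "tcoord = frag_sum (\<lambda>(f, m) r. f * mu_pull (hat_coord m r))"

abbreviation TF where "TF \<equiv> tensor_free (Hhat_O n a) :: (O_zt\<theta>, presc) module"

lemma carrier_Hhat_O: "carrier (Hhat_O n a) = Hh.fib ` Vn n"
  by (simp add: Hhat_O_def restrict_scalars_def Hhat_model)

lemma add_Hhat_O: "(\<oplus>\<^bsub>Hhat_O n a\<^esub>) = (\<oplus>\<^bsub>Hhat n a\<^esub>)"
  by (simp add: Hhat_O_def restrict_scalars_def)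

lemma TF_simps:
  "carrier TF = {x. kys x \<subseteq> UNIV \<times> Hh.fib ` Vn n}" "x \<oplus>\<^bsub>TF\<^esub> y = x + y" "\<zero>\<^bsub>TF\<^esub> = 0"
  by (simp_all add: tensor_free_def carrier_Hhat_O)

lemma TF_closed:
  "x \<in> carrier TF \<Longrightarrow> y \<in> carrier TF \<Longrightarrow> x + y \<in> carrier TF"
  "x \<in> carrier TF \<Longrightarrow> y \<in> carrier TF \<Longrightarrow> x - y \<in> carrier TF"
  "w \<in> Vn n \<Longrightarrow> frag_of (f, Hh.fib w) \<in> carrier TF"
  "0 \<in> carrier TF"
  using keys_add_subset[of x _ y] keys_diff_subset[of x _ y] by (auto simp: TF_simps)

lemma tcoord_of: "w \<in> Vn n \<Longrightarrow> tcoord (frag_of (f, Hh.fib w)) = (\<lambda>r. f * mu_pull (w r))"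
  by (simp add: tcoord_def frag_sum_of hat_coord)

lemma tcoord_add: "tcoord (x + y) = tcoord x + tcoord y"
  by (simp add: tcoord_def frag_sum_add)

lemmas tcoord_diff = additive_diff[of tcoord, OF tcoord_add]

lemma TF_induct [consumes 1, case_names zero one diff]:
  assumes "x \<in> carrier TF" "P 0" "\<And>f w. w \<in> Vn n \<Longrightarrow> P (frag_of (f, Hh.fib w))"
    "\<And>x y. P x \<Longrightarrow> P y \<Longrightarrow> P (x - y)"
  shows "P x"
proof -
  from assms(1) have "kys x \<subseteq> UNIV \<times> Hh.fib ` Vn n" by (simp add: TF_simps)
  then show ?thesis
    by (induction x rule: frag_induction) (use assms(2-) in auto)
qed

sublocale T: additive_fibres TF tcoord
proof
  fix x y assume *: "x \<in> carrier TF" "y \<in> carrier TF"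
  show "x \<oplus>\<^bsub>TF\<^esub> y \<in> carrier TF" using TF_closed(1)[OF *] by (simp add: TF_simps)
  show "tcoord (x \<oplus>\<^bsub>TF\<^esub> y) = tcoord x + tcoord y" by (simp add: TF_simps tcoord_add)
  show "\<exists>z\<in>carrier TF. z \<oplus>\<^bsub>TF\<^esub> x = y"
    using TF_closed(2)[OF *(2,1)] by (intro bexI[of _ "y - x"]) (simp_all add: TF_simps)
next
  show "carrier TF \<noteq> {}" using TF_closed(4) by blast
qed

lemma group_TF: "group (add_monoid TF)"
proof (rule groupI)
  fix x assume "x \<in> carrier (add_monoid TF)"
  then show "\<exists>y\<in>carrier (add_monoid TF). y \<otimes>\<^bsub>add_monoid TF\<^esub> x = \<one>\<^bsub>add_monoid TF\<^esub>"
    using TF_closed(2)[OF TF_closed(4), of x] by (intro bexI[of _ "0 - x"]) (simp_all add: TF_simps)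
qed (use TF_closed in \<open>auto simp: TF_simps add.assoc\<close>)

abbreviation trel where "trel \<equiv> tensor_rel mu_pull (Hhat_O n a)"

abbreviation trels :: "presc set" where "trels \<equiv>
     {frag_of (f + g, m) - frag_of (f, m) - frag_of (g, m) | f g m. m \<in> carrier (Hhat_O n a)}
     \<union> {frag_of (f, m \<oplus>\<^bsub>Hhat_O n a\<^esub> m') - frag_of (f, m) - frag_of (f, m') | f m m'.
          m \<in> carrier (Hhat_O n a) \<and> m' \<in> carrier (Hhat_O n a)}
     \<union> {frag_of (f * mu_pull b, m) - frag_of (f, b \<odot>\<^bsub>Hhat_O n a\<^esub> m) | f b m. m \<in> carrier (Hhat_O n a)}"

lemma trel_eq: "trel = generate (add_monoid TF) trels"
  by (simp add: tensor_rel_def)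

lemma trels_kernel: "x \<in> trels \<Longrightarrow> x \<in> carrier TF \<and> tcoord x = 0"
proof (elim UnE CollectE exE conjE, goal_cases)
  case (1 f g m)
  then obtain w where "w \<in> Vn n" "m = Hh.fib w" by (auto simp: carrier_Hhat_O)
  then show ?case using 1 by (auto simp: TF_closed tcoord_diff tcoord_of fun_eq_iff distrib_right)
next
  case (2 f m m')
  then obtain w w' where "w \<in> Vn n" "m = Hh.fib w" "w' \<in> Vn n" "m' = Hh.fib w'" by (auto simp: carrier_Hhat_O)
  then show ?case using 2
    by (auto simp: TF_closed tcoord_diff tcoord_of add_Hhat_O Hhat_model Vn_closed subst_add fun_eq_iff distrib_left)
next
  case (3 f b m)
  then obtain w where "w \<in> Vn n" "m = Hh.fib w" by (auto simp: carrier_Hhat_O)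
  then show ?case using 3
    by (auto simp: TF_closed tcoord_diff tcoord_of Hhat_smult Vn_scale subst_mult fun_eq_iff mult.assoc)
qed

lemma trel_kernel: "x \<in> trel \<Longrightarrow> x \<in> carrier TF \<and> tcoord x = 0"
  unfolding trel_eq
proof (induction x rule: generate.induct)
  case one
  show ?case using TF_closed(4) by (simp add: TF_simps tcoord_diff)
next
  case (incl h)
  then show ?case by (rule trels_kernel)
next
  case (inv h)
  have h: "h \<in> carrier TF" "tcoord h = 0" using trels_kernel[OF inv] by auto
  have "inv\<^bsub>add_monoid TF\<^esub> h = 0 - h"
    using h TF_closed(2)[OF TF_closed(4) h(1)]
    by (intro group.inv_equality[OF group_TF]) (simp_all add: TF_simps)
  then show ?case using h TF_closed(2)[OF TF_closed(4) h(1)] by (simp only: tcoord_diff) simp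
next
  case (eng x y)
  then show ?case using TF_closed(1)[of x y] by (simp add: TF_simps tcoord_add)
qed

lemma trel_zero: "0 \<in> trel"
  using generate.one[of "add_monoid TF" trels] by (simp add: trel_eq TF_simps)

lemma trel_add: "x \<in> trel \<Longrightarrow> y \<in> trel \<Longrightarrow> x + y \<in> trel"
  using generate.eng[of x "add_monoid TF" trels y] by (simp add: trel_eq TF_simps)

lemma trel_diff: "x \<in> trel \<Longrightarrow> y \<in> trel \<Longrightarrow> x - y \<in> trel"
proof -
  assume x: "x \<in> trel" and y: "y \<in> trel"
  have "trels \<subseteq> carrier TF" by (rule subsetI) (drule trels_kernel, rule conjunct1)
  then have t: "trels \<subseteq> carrier (add_monoid TF)" by (simp only: partial_object.simps)
  have yc: "y \<in> carrier TF" using trel_kernel[OF y] by simp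
  have "inv\<^bsub>add_monoid TF\<^esub> y = 0 - y"
    using yc TF_closed(2)[OF TF_closed(4) yc]
    by (intro group.inv_equality[OF group_TF]) (simp_all add: TF_simps)
  moreover have "inv\<^bsub>add_monoid TF\<^esub> y \<in> trel"
    using group.generate_m_inv_closed[OF group_TF t] y by (simp add: trel_eq)
  ultimately show ?thesis using trel_add[OF x, of "0 - y"] by simp
qed

lemma trel_sum: "(\<And>i. i \<in> I \<Longrightarrow> x i \<in> trel) \<Longrightarrow> (\<Sum>i\<in>I. x i) \<in> trel"
  by (induction I rule: infinite_finite_induct) (simp_all add: trel_zero trel_add)

lemma trel_rels:
  "w \<in> Vn n \<Longrightarrow> frag_of (f + g, Hh.fib w) - frag_of (f, Hh.fib w) - frag_of (g, Hh.fib w) \<in> trel"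
  "w \<in> Vn n \<Longrightarrow> w' \<in> Vn n \<Longrightarrow> frag_of (f, Hh.fib (w + w')) - frag_of (f, Hh.fib w) - frag_of (f, Hh.fib w') \<in> trel"
  "w \<in> Vn n \<Longrightarrow> frag_of (f * mu_pull b, Hh.fib w) - frag_of (f, Hh.fib (\<lambda>r. b * w r)) \<in> trel"
proof -
  assume w: "w \<in> Vn n"
  then have m: "Hh.fib w \<in> carrier (Hhat_O n a)" by (simp add: carrier_Hhat_O)
  show "frag_of (f + g, Hh.fib w) - frag_of (f, Hh.fib w) - frag_of (g, Hh.fib w) \<in> trel"
    unfolding trel_eq by (rule generate.incl) (use m in blast)
  have "frag_of (f * mu_pull b, Hh.fib w) - frag_of (f, b \<odot>\<^bsub>Hhat_O n a\<^esub> Hh.fib w) \<in> trel"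
    unfolding trel_eq by (rule generate.incl) (use m in blast)
  then show "frag_of (f * mu_pull b, Hh.fib w) - frag_of (f, Hh.fib (\<lambda>r. b * w r)) \<in> trel"
    by (simp add: Hhat_smult w)
  assume w': "w' \<in> Vn n"
  then have m': "Hh.fib w' \<in> carrier (Hhat_O n a)" by (simp add: carrier_Hhat_O)
  have "frag_of (f, Hh.fib w \<oplus>\<^bsub>Hhat_O n a\<^esub> Hh.fib w') - frag_of (f, Hh.fib w) - frag_of (f, Hh.fib w') \<in> trel"
    unfolding trel_eq by (rule generate.incl) (use m m' in blast)
  then show "frag_of (f, Hh.fib (w + w')) - frag_of (f, Hh.fib w) - frag_of (f, Hh.fib w') \<in> trel"
    by (simp add: add_Hhat_O Hhat_model w w')
qed

lemma trel_zero_coeff: "w \<in> Vn n \<Longrightarrow> frag_of (0, Hh.fib w) \<in> trel" "frag_of (f, Hh.fib 0) \<in> trel"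
proof -
  show "frag_of (0, Hh.fib w) \<in> trel" if "w \<in> Vn n"
    using trel_diff[OF trel_zero trel_rels(1)[OF that, of 0 0]] by simp
  show "frag_of (f, Hh.fib 0) \<in> trel"
    using trel_diff[OF trel_zero trel_rels(2)[OF Vn_closed(1) Vn_closed(1), of f]] by simp
qed

lemma trel_expand_step:
  assumes w: "w \<in> Vn n"
  shows "k \<le> n \<Longrightarrow> frag_of (f, Hh.fib (\<lambda>r. if r < k then w r else 0))
      - (\<Sum>r<k. frag_of (f * mu_pull (w r), Hh.fib (unit_vec r))) \<in> trel"
proof (induction k)
  case 0
  have "(\<lambda>r. 0) = (0 :: nat \<Rightarrow> O_zt)" by (simp add: fun_eq_iff)
  then show ?case using trel_zero_coeff(2) by simp
next
  case (Suc k)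
  let ?t = "\<lambda>k r. if r < k then w r else 0"
  have k: "k < n" using Suc.prems by simp
  have e: "?t (Suc k) = ?t k + (\<lambda>r. w k * unit_vec k r)"
    by (auto simp: fun_eq_iff unit_vec_def less_Suc_eq)
  have t: "?t k \<in> Vn n" using w by (simp add: Vn_def)
  have 1: "frag_of (f, Hh.fib (?t (Suc k))) - frag_of (f, Hh.fib (?t k)) - frag_of (f, Hh.fib (\<lambda>r. w k * unit_vec k r)) \<in> trel"
    unfolding e by (rule trel_rels(2)[OF t Vn_scale[OF unit_vec_Vn[OF k]]])
  have 2: "frag_of (f * mu_pull (w k), Hh.fib (unit_vec k)) - frag_of (f, Hh.fib (\<lambda>r. w k * unit_vec k r)) \<in> trel"
    by (rule trel_rels(3)[OF unit_vec_Vn[OF k]])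
  have 3: "frag_of (f, Hh.fib (?t k)) - (\<Sum>r<k. frag_of (f * mu_pull (w r), Hh.fib (unit_vec r))) \<in> trel"
    using Suc k by simp
  have alg: "A - (S + Z) = (A - B - C) - (Z - C) + (B - S)" for A B C S Z :: presc by simp
  have "frag_of (f, Hh.fib (?t (Suc k))) - (\<Sum>r<Suc k. frag_of (f * mu_pull (w r), Hh.fib (unit_vec r)))
     = (frag_of (f, Hh.fib (?t (Suc k))) - frag_of (f, Hh.fib (?t k)) - frag_of (f, Hh.fib (\<lambda>r. w k * unit_vec k r)))
      - (frag_of (f * mu_pull (w k), Hh.fib (unit_vec k)) - frag_of (f, Hh.fib (\<lambda>r. w k * unit_vec k r)))
      + (frag_of (f, Hh.fib (?t k)) - (\<Sum>r<k. frag_of (f * mu_pull (w r), Hh.fib (unit_vec r))))"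
    unfolding sum.lessThan_Suc by (rule alg)
  also have "\<dots> \<in> trel" by (rule trel_add[OF trel_diff[OF 1 2] 3])
  finally show ?case .
qed

text \<open>Modulo the relations every formal sum becomes \<open>\<Sum>f\<^sub>r \<otimes> Q\<^sub>r\<close>, where \<open>f\<^sub>r\<close> are its coordinates. In
  particular the relations are the kernel of the coordinate map.\<close>

lemma trel_expand:
  assumes x: "x \<in> carrier TF"
  shows "x - (\<Sum>r<n. frag_of (tcoord x r, Hh.fib (unit_vec r))) \<in> trel"
  using x
proof (induction x rule: TF_induct)
  case zero
  show ?case
    using trel_diff[OF trel_zero trel_sum[of "{..<n}" "\<lambda>r. frag_of (0, Hh.fib (unit_vec r))"]]
      trel_zero_coeff(1)[OF unit_vec_Vn] by (simp add: tcoord_diff)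
next
  case (one f w)
  have "(\<lambda>r. if r < n then w r else 0) = w" using one by (auto simp: Vn_def)
  then show ?case using trel_expand_step[OF one, of n f] by (simp add: tcoord_of one)
next
  case (diff x y)
  let ?S = "\<lambda>x. \<Sum>r<n. frag_of (tcoord x r, Hh.fib (unit_vec r)) :: presc"
  have 1: "(\<Sum>r<n. frag_of (tcoord x r, Hh.fib (unit_vec r)) - frag_of (tcoord (x - y) r, Hh.fib (unit_vec r))
      - frag_of (tcoord y r, Hh.fib (unit_vec r))) \<in> trel"
  proof (rule trel_sum)
    fix r assume "r \<in> {..<n}"
    then have "unit_vec r \<in> Vn n" by (simp add: unit_vec_Vn)
    from trel_rels(1)[OF this, of "tcoord (x - y) r" "tcoord y r"]
    show "frag_of (tcoord x r, Hh.fib (unit_vec r)) - frag_of (tcoord (x - y) r, Hh.fib (unit_vec r))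
      - frag_of (tcoord y r, Hh.fib (unit_vec r)) \<in> trel" by (simp add: tcoord_diff)
  qed
  have alg: "x - y - C = (x - A) - (y - B) + (A - C - B)" for A B C :: presc by simp
  have 2: "?S x - ?S (x - y) - ?S y \<in> trel" using 1 by (simp only: sum_subtractf)
  show ?case
    unfolding alg[of "?S (x - y)" "?S x" "?S y"] by (rule trel_add[OF trel_diff[OF diff] 2])
qed

lemma T_fib_zero: "T.fib 0 = trel"
proof
  show "trel \<subseteq> T.fib 0" using trel_kernel by (auto simp: T.fib_def)
  show "T.fib 0 \<subseteq> trel"
  proof
    fix x assume "x \<in> T.fib 0"
    then have x: "x \<in> carrier TF" "tcoord x = 0" by (auto simp: T.fib_def)
    have "(\<Sum>r<n. frag_of (0, Hh.fib (unit_vec r))) \<in> trel"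
      by (rule trel_sum) (simp add: trel_zero_coeff unit_vec_Vn)
    from trel_add[OF trel_expand[OF x(1)] this] show "x \<in> trel" by (simp add: x(2))
  qed
qed

lemma T_Im: "T.Im = Vn n"
proof
  have "tcoord x \<in> Vn n" if "x \<in> carrier TF" for x
    using that by (induction x rule: TF_induct)
      (auto simp: tcoord_diff tcoord_of Vn_def subst_diff)
  then show "T.Im \<subseteq> Vn n" by blast
  show "Vn n \<subseteq> T.Im"
  proof
    fix v :: "nat \<Rightarrow> O_zt\<theta>" assume v: "v \<in> Vn n"
    define x where "x = (\<Sum>r<n. frag_of (v r, Hh.fib (unit_vec r)) :: presc)"
    have xc: "(\<Sum>r\<in>I. frag_of (v r, Hh.fib (unit_vec r))) \<in> carrier TF" if "I \<subseteq> {..<n}" for I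
      using that by (induction I rule: infinite_finite_induct) (auto simp: TF_closed unit_vec_Vn)
    have "tcoord x = (\<Sum>r<n. (\<lambda>s. v r * mu_pull (unit_vec r s)))"
      unfolding x_def additive_sum[of tcoord, OF tcoord_add]
      by (intro sum.cong refl) (simp add: tcoord_of unit_vec_Vn)
    also have "\<dots> = v"
    proof
      fix s
      have "(\<Sum>r<n. (\<lambda>s. v r * mu_pull (unit_vec r s))) s = (\<Sum>r<n. v r * mu_pull (unit_vec r s))"
        by (induction n) simp_all
      also have "\<dots> = (\<Sum>r<n. if r = s then v r else 0)"
        by (intro sum.cong) (auto simp: unit_vec_def subst_one subst_diff)
      also have "\<dots> = v s" using v by (simp add: Vn_def)
      finally show "(\<Sum>r<n. (\<lambda>s. v r * mu_pull (unit_vec r s))) s = v s" .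
    qed
    finally show "v \<in> T.Im" using xc[of "{..<n}"] by (intro image_eqI[of _ _ x]) (simp_all add: x_def)
  qed
qed

lemma rescaled_eq: "rescaled n a = quot_module TF (T.fib 0)"
  by (simp add: rescaled_def tensor_def T_fib_zero)

lemma rescaled_model:
  "carrier (rescaled n a) = T.fib ` Vn n"
  "v \<in> Vn n \<Longrightarrow> w \<in> Vn n \<Longrightarrow> T.fib v \<oplus>\<^bsub>rescaled n a\<^esub> T.fib w = T.fib (v + w)"
  "\<zero>\<^bsub>rescaled n a\<^esub> = T.fib 0"
  unfolding rescaled_eq
  using T.carrier_quot T.add_quot T.zero_quot T_Im by simp_all

lemma T_inj: "v \<in> Vn n \<Longrightarrow> T.fib v = T.fib w \<longleftrightarrow> v = w"
  using T.fib_eq_iff T_Im by simp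

lemma frag_extend_TF:
  assumes x: "x \<in> carrier TF" and add: "\<And>v w. OP (v + w) = OP v + OP w"
    and step: "\<And>f w. w \<in> Vn n \<Longrightarrow> F (f, Hh.fib w) \<in> carrier TF \<and> tcoord (F (f, Hh.fib w)) = OP (\<lambda>r. f * mu_pull (w r))"
  shows "frag_extend F x \<in> carrier TF \<and> tcoord (frag_extend F x) = OP (tcoord x)"
  using x
proof (induction x rule: TF_induct)
  case zero
  show ?case unfolding frag_extend_0 tcoord_diff additive_diff(1)[of OP, OF add]
    using TF_closed(4) by (rule conjI) (rule refl)
next
  case (one f w)
  show ?case unfolding frag_extend_of tcoord_of[OF one] by (rule step[OF one])
next
  case (diff x y)
  then show ?case unfolding frag_extend_diff tcoord_diff additive_diff(3)[of OP, OF add]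
    using TF_closed(2) by (metis (no_types))
qed

lemma rescaled_smult:
  assumes v: "v \<in> Vn n"
  shows "f \<odot>\<^bsub>rescaled n a\<^esub> T.fib v = T.fib (\<lambda>r. f * v r)"
  unfolding rescaled_eq T.smult_quot
proof (rule T.induced_fib)
  show "v \<in> T.Im" using v T_Im by simp
  fix x assume x: "x \<in> carrier TF" "tcoord x = v"
  have "frag_extend (\<lambda>(g, m). frag_of (f * g, m)) x \<in> carrier TF
      \<and> tcoord (frag_extend (\<lambda>(g, m). frag_of (f * g, m)) x) = (\<lambda>v r. f * v r) (tcoord x)"
    by (rule frag_extend_TF[OF x(1)]) (auto simp: fun_eq_iff distrib_left TF_closed tcoord_of mult.assoc)
  then show "f \<odot>\<^bsub>TF\<^esub> x \<in> carrier TF \<and> tcoord (f \<odot>\<^bsub>TF\<^esub> x) = (\<lambda>r. f * v r)"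
    using x(2) by (simp add: tensor_free_def)
qed

lemma chain_rule_fib:
  assumes v: "v \<in> Vn n"
    and P: "\<And>w. w \<in> Vn n \<Longrightarrow> P \<odot>\<^bsub>Hhat n a\<^esub> Hh.fib w = Hh.fib (Pm w) \<and> Pm w \<in> Vn n"
    and add: "\<And>v w. OP (v + w) = OP v + OP w"
    and op: "\<And>f w r. w \<in> Vn n \<Longrightarrow> d f * mu_pull (w r) + f * g * mu_pull (Pm w r) = OP (\<lambda>r. f * mu_pull (w r)) r"
  shows "chain_rule_op n a d g P (T.fib v) = T.fib (OP v)"
  unfolding chain_rule_op_def T_fib_zero[symmetric]
proof (rule T.induced_fib)
  show "v \<in> T.Im" using v T_Im by simp
  fix x assume x: "x \<in> carrier TF" "tcoord x = v"
  let ?F = "\<lambda>(f, m). frag_of (d f, m) + frag_of (f * g, P \<odot>\<^bsub>Hhat n a\<^esub> m)"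
  have "frag_extend ?F x \<in> carrier TF \<and> tcoord (frag_extend ?F x) = OP (tcoord x)"
    by (rule frag_extend_TF[OF x(1) add]) (auto simp: fun_eq_iff TF_closed tcoord_of tcoord_add P op)
  then show "frag_extend ?F x \<in> carrier TF \<and> tcoord (frag_extend ?F x) = OP v" using x(2) by simp
qed

text \<open>The order of \<open>Q\<^sub>r\<close> for the V-filtration: \<open>op_\<tau>\<close> multiplies \<open>\<tau>\<^sup>m Q\<^sub>r\<close> by \<open>(m - jump r) z\<close>, up to a
  multiple of \<open>\<tau>\<^sup>m\<^sup>+\<^sup>1 Q\<^sub>r\<^sub>+\<^sub>1\<close>.\<close>

definition jump :: "nat \<Rightarrow> real"
  where "jump r = real r - \<gamma> - real n * a (Suc r)"

definition op_t :: "(nat \<Rightarrow> O_zt\<theta>) \<Rightarrow> nat \<Rightarrow> O_zt\<theta>"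
  where "op_t v r = mon (1, 0, 0) * d_t'' (v r)
    + mon (0, -1, 0) * (cst (of_real (a (Suc r))) * mon (1, 0, 0) * v r + tau * cyc n (mon (0, 1, 0)) v r)"

definition op_\<theta> :: "(nat \<Rightarrow> O_zt\<theta>) \<Rightarrow> nat \<Rightarrow> O_zt\<theta>"
  where "op_\<theta> v r = mon (1, 0, 0) * d_\<theta> (v r)
    + mon (0, 0, -2) * (cst (of_real (jump r)) * mon (1, 0, 1) * v r - of_nat n * cyc n (mon (0, 1, 0)) v r)"

definition op_\<tau> :: "(nat \<Rightarrow> O_zt\<theta>) \<Rightarrow> nat \<Rightarrow> O_zt\<theta>"
  where "op_\<tau> v r = of_nat n * tau * cyc n (mon (0, 1, 0)) v r
    - (mon (1, 0, 1) * d_\<theta> (v r) + cst (of_real (jump r)) * mon (1, 0, 0) * v r)"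

lemma resc_zdt_fib:
  assumes v: "v \<in> Vn n" shows "resc_zdt n a (T.fib v) = T.fib (op_t v)"
  unfolding resc_zdt_def
proof (rule chain_rule_fib[OF v, where Pm=conn_t])
  fix f :: O_zt\<theta> and w :: "nat \<Rightarrow> O_zt" and r assume w: "w \<in> Vn n"
  have e: "mon (0, 0, -1) * mon (1, 0, 1) = (mon (1, 0, 0) :: O_zt\<theta>)" by (simp add: mult_single)
  have "f * mon (0, 0, -1) * mu_pull (conn_t w r)
      = f * (mon (0, 0, -1) * mu_pull (zdt (w r)))
        + f * (mon (0, -1, 0) * (cst (of_real (a (Suc r))) * (mon (0, 0, -1) * mon (1, 0, 1)) * mu_pull (w r)
        + mon (0, 0, -1) * cyc n (mon (0, 1, 0)) (\<lambda>r. mu_pull (w r)) r))"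
    by (simp add: conn_t_def subst_add subst_mult subst_single mu_cyc subst_cst algebra_simps)
  then show "mon (1, 0, 0) * d_t'' f * mu_pull (w r) + f * mon (0, 0, - 1) * mu_pull (conn_t w r)
      = op_t (\<lambda>r. f * mu_pull (w r)) r"
    unfolding mu_zdt e by (simp add: op_t_def deriv_mult cyc_scale algebra_simps)
qed (simp_all add: Hhat_smult conn_Vn fun_eq_iff op_t_def deriv_add cyc_add algebra_simps)

lemma resc_zd\<theta>_fib:
  assumes v: "v \<in> Vn n" shows "resc_zd\<theta> n a (T.fib v) = T.fib (op_\<theta> v)"
  unfolding resc_zd\<theta>_def
proof (rule chain_rule_fib[OF v, where Pm=conn_z])
  fix f :: O_zt\<theta> and w :: "nat \<Rightarrow> O_zt" and r assume w: "w \<in> Vn n"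
  have o: "mu_pull (of_nat n) = of_nat n"
    by (metis subst_cst(1) single_of_nat)
  have "f * mon (0, 0, -2) * mu_pull (conn_z w r)
      = f * (mon (0, 0, -2) * mu_pull (z2dz (w r)))
        + f * (mon (0, 0, -2) * (cst (of_real (jump r)) * mon (1, 0, 1) * mu_pull (w r)
        - of_nat n * cyc n (mon (0, 1, 0)) (\<lambda>r. mu_pull (w r)) r))"
    by (simp add: conn_z_def jump_def subst_add subst_diff subst_mult subst_single mu_cyc subst_cst o algebra_simps)
  then show "mon (1, 0, 0) * d_\<theta> f * mu_pull (w r) + f * mon (0, 0, - 2) * mu_pull (conn_z w r)
      = op_\<theta> (\<lambda>r. f * mu_pull (w r)) r"
    unfolding mu_z2dz by (simp add: op_\<theta>_def deriv_mult cyc_scale algebra_simps)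
qed (simp_all add: Hhat_smult conn_Vn fun_eq_iff op_\<theta>_def deriv_add cyc_add algebra_simps)

lemma op_Vn: "v \<in> Vn n \<Longrightarrow> op_t v \<in> Vn n" "v \<in> Vn n \<Longrightarrow> op_\<theta> v \<in> Vn n" "v \<in> Vn n \<Longrightarrow> op_\<tau> v \<in> Vn n"
  using cyc_Vn[OF n, of "mon (0, 1, 0)" v]
  by (simp_all add: Vn_def op_t_def op_\<theta>_def op_\<tau>_def deriv_diff)

lemma resc_z\<tau>d\<tau>_fib:
  assumes v: "v \<in> Vn n" shows "resc_z\<tau>d\<tau> n a (T.fib v) = T.fib (op_\<tau> v)"
proof -
  have alg: "- p * (b * A + c * (C * d * V - m * Y)) = m * (p * c) * Y - (p * b * A + C * (p * c * d) * V)"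
    for p b c d A C V Y m :: O_zt\<theta> by (simp add: algebra_simps)
  have e: "mon (0, 0, 1) * mon (1, 0, 0) = (mon (1, 0, 1) :: O_zt\<theta>)"
    "mon (0, 0, 1) * mon (0, 0, -2) = (tau :: O_zt\<theta>)" "tau * mon (1, 0, 1) = (mon (1, 0, 0) :: O_zt\<theta>)"
    by (simp_all add: mult_single)
  have "- mon (0, 0, 1) * op_\<theta> v r = op_\<tau> v r" for r
    unfolding op_\<theta>_def op_\<tau>_def alg e by (rule refl)
  then show ?thesis
    unfolding resc_z\<tau>d\<tau>_def resc_zd\<theta>_fib[OF v] rescaled_smult[OF op_Vn(2)[OF v]] by presburger
qed

end

section \<open>Order of pole along \<tau> = 0\<close>

text \<open>Degree at most \<open>m\<close> in \<open>\<theta> = 1/\<tau>\<close>; for \<open>m = 0\<close> these are the functions that extend over \<open>\<tau> = 0\<close>.\<close>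

definition Fil :: "int \<Rightarrow> O_zt\<theta> set"
  where "Fil m = {f. \<forall>(x, b, d)\<in>kys f. d \<le> m}"

lemma Fil_iff: "f \<in> Fil m \<longleftrightarrow> (\<forall>x b d. lk f (x, b, d) \<noteq> 0 \<longrightarrow> d \<le> m)"
  by (force simp: Fil_def in_keys_iff)

lemma O_zt\<tau>_Fil: "O_zt\<tau> = Fil 0"
  by (simp add: O_zt\<tau>_def Fil_def)

lemma Fil_mono: "f \<in> Fil m \<Longrightarrow> m \<le> m' \<Longrightarrow> f \<in> Fil m'"
  by (force simp: Fil_iff)

lemma Fil_zero: "0 \<in> Fil m"
  by (simp add: Fil_def)

lemma Fil_add: "f \<in> Fil m \<Longrightarrow> g \<in> Fil m \<Longrightarrow> f + g \<in> Fil m"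
  unfolding Fil_iff lookup_add by (metis add.right_neutral)

lemma Fil_uminus: "f \<in> Fil m \<Longrightarrow> - f \<in> Fil m"
  unfolding Fil_iff by simp

lemma Fil_diff: "f \<in> Fil m \<Longrightarrow> g \<in> Fil m \<Longrightarrow> f - g \<in> Fil m"
  using Fil_add[OF _ Fil_uminus] by force

lemma Fil_single: "d \<le> m \<Longrightarrow> sg (x, b, d) c \<in> Fil m"
  by (auto simp: Fil_def)

lemma Fil_mult:
  assumes "f \<in> Fil m" "g \<in> Fil m'"
  shows "f * g \<in> Fil (m + m')"
  unfolding Fil_def
proof (clarify)
  fix x b d assume "(x, b, d) \<in> kys (f * g)"
  then obtain k l where kl: "(x, b, d) = k + l" "k \<in> kys f" "l \<in> kys g"
    using Poly_Mapping.keys_mult[of f g] by blast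
  obtain x1 b1 d1 x2 b2 d2 where "k = (x1, b1, d1)" "l = (x2, b2, d2)" by (cases k, cases l)
  then have "d1 \<le> m" "d2 \<le> m'" "d = d1 + d2" using kl assms by (auto simp: Fil_def)
  then show "d \<le> m + m'" by simp
qed

lemma Fil_mult0: "f \<in> Fil 0 \<Longrightarrow> g \<in> Fil m \<Longrightarrow> f * g \<in> Fil m"
  using Fil_mult[of f 0 g m] by simp

lemma Fil_deriv:
  assumes "f \<in> Fil m" shows "d_t'' f \<in> Fil m" "mon (1, 0, 1) * d_\<theta> f \<in> Fil m"
proof -
  have "kys (d_t'' f) \<subseteq> (\<lambda>(x, b, d). (x, b - 1, d)) ` kys f"
    unfolding d_t''_def by (rule keys_monomial_deriv)
  then show "d_t'' f \<in> Fil m" using assms by (fastforce simp: Fil_def)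
  have "kys (d_\<theta> f) \<subseteq> (\<lambda>(x, b, d). (x, b, d - 1)) ` kys f"
    unfolding d_\<theta>_def by (rule keys_monomial_deriv)
  then have "d_\<theta> f \<in> Fil (m - 1)" using assms by (fastforce simp: Fil_def)
  then show "mon (1, 0, 1) * d_\<theta> f \<in> Fil m"
    using Fil_mult[OF Fil_single[of 1 1]] by fastforce
qed

lemma Fil_cst: "cst c \<in> Fil 0" "of_nat k \<in> Fil 0"
proof -
  show c: "cst c \<in> Fil 0" for c by (simp add: zero_prod_def Fil_single)
  show "of_nat k \<in> Fil 0" using c[of "of_nat k"] by (simp only: single_of_nat)
qed

text \<open>The coefficient of \<open>t\<^sup>b \<theta>\<^sup>d\<close> as a polynomial in \<open>z\<close>. Multiplication by an element of \<open>C_z\<close> acts on each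
  slice separately, and polynomials in \<open>z\<close> have no zero divisors; this gives the strictness in
  \<open>Fil_strict\<close>.\<close>

definition slice :: "int \<Rightarrow> int \<Rightarrow> O_zt\<theta> \<Rightarrow> complex poly"
  where "slice b d = lin (\<lambda>(x, b', d') c. if b' = b \<and> d' = d then monom c x else 0)"

lemma slice_hom: "coeff_additive (\<lambda>(x, b', d') c. if b' = b \<and> d' = d then monom c x else 0)"
  by (auto simp: coeff_additive_def add_monom)

lemma slice_add: "slice b d (f + g) = slice b d f + slice b d g"
  unfolding slice_def by (rule lin_add[OF slice_hom])

lemma slice_single: "slice b d (sg (x, b', d') c) = (if b' = b \<and> d' = d then monom c x else 0)"
  unfolding slice_def by (simp add: lin_single[OF slice_hom])

lemma coeff_slice: "coeff (slice b d f) x = lk f (x, b, d)"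
proof (induction f rule: poly_mapping_add_induct)
  case (single k c)
  then show ?case by (cases k) (auto simp: slice_single lookup_single when_def)
qed (simp add: slice_add lookup_add)

lemma slice_mult:
  assumes "p \<in> C_z"
  shows "slice b d (p * f) = slice 0 0 p * slice b d f"
proof -
  have s: "slice b d (sg (x, 0, 0) c * f) = monom c x * slice b d f" for x c
  proof (induction f rule: poly_mapping_add_induct)
    case (single k e)
    then show ?case by (cases k) (simp add: mult_single slice_single mult_monom)
  qed (simp add: distrib_left slice_add)
  have "p = (\<Sum>k\<in>kys p. sg k (lk p k))"
    by (intro poly_mapping_eqI) (simp add: lookup_sum lookup_single when_def in_keys_iff)
  then have "slice b d (p * f) = (\<Sum>k\<in>kys p. slice b d (sg k (lk p k) * f))"
    by (metis (no_types) additive_sum[of "slice b d", OF slice_add] sum_distrib_right)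
  also have "\<dots> = (\<Sum>k\<in>kys p. slice 0 0 (sg k (lk p k)) * slice b d f)"
    using assms by (intro sum.cong refl) (auto simp: C_z_def s slice_single)
  also have "\<dots> = slice 0 0 p * slice b d f"
    using \<open>p = _\<close> by (metis (no_types) additive_sum[of "slice 0 0", OF slice_add] sum_distrib_right)
  finally show ?thesis .
qed

lemma Fil_strict:
  assumes p: "p \<in> C_z" "p \<noteq> 0" and pf: "p * f \<in> Fil m"
  shows "f \<in> Fil m"
  unfolding Fil_iff
proof (intro allI impI, rule ccontr)
  fix x b d assume f: "lk f (x, b, d) \<noteq> 0" and d: "\<not> d \<le> m"
  have "slice b d (p * f) = 0"
    using pf d by (intro poly_eqI) (auto simp: coeff_slice Fil_iff)
  then have "slice 0 0 p = 0 \<or> slice b d f = 0" by (simp add: slice_mult p)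
  moreover have "slice 0 0 p \<noteq> 0"
  proof
    assume z: "slice 0 0 p = 0"
    have "lk p (x, b, d) = 0" for x b d
    proof (cases "b = 0 \<and> d = 0")
      case False
      then have "(x, b, d) \<notin> kys p" using p(1) by (auto simp: C_z_def dest!: bspec)
      then show ?thesis by (simp add: in_keys_iff)
    qed (use coeff_slice[of 0 0 p x] z in simp)
    then have "lk p k = 0" for k by (cases k) simp
    then have "p = 0" by (intro poly_mapping_eqI) simp
    then show False using p by simp
  qed
  ultimately show False using f coeff_slice[of b d f x] by simp
qed

text \<open>The index set \<open>A + \<int>\<close> is discrete, so a V-filtration is constant on a short interval to the right of
  any index. Infima of sets of indices are attained for this reason.\<close>

lemma no_jumps_right:
  assumes "finite (A :: real set)"
  obtains \<epsilon> where "\<epsilon> > 0" "\<And>s. s < \<mu> + \<epsilon> \<Longrightarrow> \<forall>c\<in>A. \<forall>k::int. c + of_int k \<notin> {\<mu><..s}"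
proof -
  define \<epsilon> where "\<epsilon> = Min (insert 1 ((\<lambda>c. c + of_int \<lfloor>\<mu> - c\<rfloor> + 1 - \<mu>) ` A))"
  have "c + of_int \<lfloor>\<mu> - c\<rfloor> + 1 - \<mu> > 0" for c by linarith
  then have "\<epsilon> > 0" using assms unfolding \<epsilon>_def by (subst Min_gr_iff) auto
  moreover have "c + of_int k \<notin> {\<mu><..s}" if s: "s < \<mu> + \<epsilon>" and c: "c \<in> A" for s c k
  proof
    assume k: "c + of_int k \<in> {\<mu><..s}"
    have "\<epsilon> \<le> c + of_int \<lfloor>\<mu> - c\<rfloor> + 1 - \<mu>" unfolding \<epsilon>_def using assms c by (intro Min_le) auto
    moreover have "\<lfloor>\<mu> - c\<rfloor> < k" using k by (simp add: floor_less_iff)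
    then have "real_of_int \<lfloor>\<mu> - c\<rfloor> + 1 \<le> of_int k" by linarith
    ultimately show False using k s by simp
  qed
  ultimately show ?thesis using that by blast
qed

context hypergeometric
begin

section \<open>Uniqueness of the V-filtration\<close>

definition V0mod :: "(nat \<Rightarrow> O_zt\<theta>) set \<Rightarrow> bool"
  where "V0mod S \<longleftrightarrow> S \<subseteq> Vn n \<and> 0 \<in> S \<and> (\<forall>v\<in>S. \<forall>w\<in>S. v + w \<in> S) \<and>
    (\<forall>f\<in>O_zt\<tau>. \<forall>v\<in>S. (\<lambda>r. f * v r) \<in> S) \<and> (\<forall>v\<in>S. op_t v \<in> S) \<and> (\<forall>v\<in>S. op_\<tau> v \<in> S)"

definition opN :: "real \<Rightarrow> (nat \<Rightarrow> O_zt\<theta>) \<Rightarrow> nat \<Rightarrow> O_zt\<theta>"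
  where "opN \<alpha> v = op_\<tau> v + (\<lambda>r. cst (of_real \<alpha>) * mon (1, 0, 0) * v r)"

text \<open>The axioms of a V-filtration, expressed for coordinate vectors.\<close>

definition is_Vmod :: "(real \<Rightarrow> (nat \<Rightarrow> O_zt\<theta>) set) \<Rightarrow> bool"
  where "is_Vmod W \<longleftrightarrow>
    (\<forall>\<alpha>. V0mod (W \<alpha>)) \<and>
    (\<forall>\<alpha>. \<exists>S. finite S \<and> S \<subseteq> Vn n \<and> W \<alpha> = V0mod hull S) \<and>
    (\<forall>\<alpha> \<beta>. \<alpha> \<le> \<beta> \<longrightarrow> W \<alpha> \<subseteq> W \<beta>) \<and>
    (\<Union>\<alpha>. W \<alpha>) = Vn n \<and>
    (\<exists>A. finite A \<and> (\<forall>\<alpha> \<beta>. \<alpha> \<le> \<beta> \<and> (\<forall>c\<in>A. \<forall>k::int. c + of_int k \<notin> {\<alpha><..\<beta>}) \<longrightarrow> W \<alpha> = W \<beta>)) \<and>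
    (\<forall>\<alpha>. (\<lambda>v r. tau * v r) ` W \<alpha> = W (\<alpha> - 1)) \<and>
    (\<forall>\<alpha>. \<forall>p\<in>C_z. \<forall>v\<in>W \<alpha>. p \<noteq> 0 \<and> (\<lambda>r. p * v r) \<in> below W \<alpha> \<longrightarrow> v \<in> below W \<alpha>) \<and>
    (\<forall>\<alpha>. \<exists>N. \<forall>v\<in>W \<alpha>. (opN \<alpha> ^^ N) v \<in> below W \<alpha>)"

lemma inj_fib: "inj_on T.fib (Vn n)"
  using T_inj by (intro inj_onI) simp

lemma fib_image_iff: "v \<in> Vn n \<Longrightarrow> S \<subseteq> Vn n \<Longrightarrow> T.fib v \<in> T.fib ` S \<longleftrightarrow> v \<in> S"
  by (rule inj_on_image_mem_iff[OF inj_fib])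

lemma fib_image_eq: "S \<subseteq> Vn n \<Longrightarrow> S' \<subseteq> Vn n \<Longrightarrow> T.fib ` S = T.fib ` S' \<longleftrightarrow> S = S'"
  by (rule inj_on_image_eq_iff[OF inj_fib])

lemma fib_image_subset: "S \<subseteq> Vn n \<Longrightarrow> S' \<subseteq> Vn n \<Longrightarrow> T.fib ` S \<subseteq> T.fib ` S' \<longleftrightarrow> S \<subseteq> S'"
proof
  assume S: "S \<subseteq> Vn n" "S' \<subseteq> Vn n" and sub: "T.fib ` S \<subseteq> T.fib ` S'"
  show "S \<subseteq> S'"
  proof
    fix v assume v: "v \<in> S"
    then have "T.fib v \<in> T.fib ` S'" by (rule subsetD[OF sub imageI])
    moreover have "v \<in> Vn n" using v S(1) by (rule rev_subsetD)
    ultimately show "v \<in> S'" using fib_image_iff[OF _ S(2)] by simp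
  qed
qed (rule image_mono)

lemma V0_submodule_fib:
  assumes S: "S \<subseteq> Vn n"
  shows "V0_submodule n a (T.fib ` S) \<longleftrightarrow> V0mod S"
proof -
  have 1: "T.fib ` S \<subseteq> carrier (rescaled n a)" using S by (auto simp: rescaled_model)
  have 2: "\<zero>\<^bsub>rescaled n a\<^esub> \<in> T.fib ` S \<longleftrightarrow> 0 \<in> S"
    using fib_image_iff[OF Vn_closed(1) S] by (simp add: rescaled_model)
  have 3: "(\<forall>x\<in>T.fib ` S. \<forall>y\<in>T.fib ` S. x \<oplus>\<^bsub>rescaled n a\<^esub> y \<in> T.fib ` S) \<longleftrightarrow> (\<forall>v\<in>S. \<forall>w\<in>S. v + w \<in> S)"
  proof -
    have "T.fib v \<oplus>\<^bsub>rescaled n a\<^esub> T.fib w \<in> T.fib ` S \<longleftrightarrow> v + w \<in> S" if "v \<in> S" "w \<in> S" for v w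
    proof -
      have "v \<in> Vn n" "w \<in> Vn n" using that S by auto
      then show ?thesis using rescaled_model(2) fib_image_iff[OF Vn_closed(2) S] by simp
    qed
    then show ?thesis by simp
  qed
  have 4: "(\<forall>f\<in>O_zt\<tau>. \<forall>x\<in>T.fib ` S. f \<odot>\<^bsub>rescaled n a\<^esub> x \<in> T.fib ` S) \<longleftrightarrow>
      (\<forall>f\<in>O_zt\<tau>. \<forall>v\<in>S. (\<lambda>r. f * v r) \<in> S)"
  proof -
    have "f \<odot>\<^bsub>rescaled n a\<^esub> T.fib v \<in> T.fib ` S \<longleftrightarrow> (\<lambda>r. f * v r) \<in> S" if "v \<in> S" for v f
    proof -
      have "v \<in> Vn n" using that S by auto
      then show ?thesis using rescaled_smult fib_image_iff[OF Vn_scale S] by simp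
    qed
    then show ?thesis by simp
  qed
  have 5: "resc_zdt n a (T.fib v) \<in> T.fib ` S \<longleftrightarrow> op_t v \<in> S" "resc_z\<tau>d\<tau> n a (T.fib v) \<in> T.fib ` S \<longleftrightarrow> op_\<tau> v \<in> S"
    if "v \<in> S" for v
  proof -
    have v: "v \<in> Vn n" using that S by auto
    show "resc_zdt n a (T.fib v) \<in> T.fib ` S \<longleftrightarrow> op_t v \<in> S"
      unfolding resc_zdt_fib[OF v] by (rule fib_image_iff[OF op_Vn(1)[OF v] S])
    show "resc_z\<tau>d\<tau> n a (T.fib v) \<in> T.fib ` S \<longleftrightarrow> op_\<tau> v \<in> S"
      unfolding resc_z\<tau>d\<tau>_fib[OF v] by (rule fib_image_iff[OF op_Vn(3)[OF v] S])
  qed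
  have 6: "(\<forall>x\<in>T.fib ` S. resc_zdt n a x \<in> T.fib ` S) \<longleftrightarrow> (\<forall>v\<in>S. op_t v \<in> S)"
    "(\<forall>x\<in>T.fib ` S. resc_z\<tau>d\<tau> n a x \<in> T.fib ` S) \<longleftrightarrow> (\<forall>v\<in>S. op_\<tau> v \<in> S)"
    using 5 by simp_all
  show ?thesis unfolding V0_submodule_def V0mod_def 2 3 4 6 using 1 S by simp
qed

lemma V0mod_Vn: "V0mod (Vn n)"
  using op_Vn by (simp add: V0mod_def Vn_closed Vn_scale)

lemma V0mod_hull_Vn: "S \<subseteq> Vn n \<Longrightarrow> V0mod hull S \<subseteq> Vn n"
  by (rule hull_minimal[where S = V0mod, OF _ V0mod_Vn])

lemma hull_fib:
  assumes S: "S \<subseteq> Vn n"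
  shows "V0_submodule n a hull (T.fib ` S) = T.fib ` (V0mod hull S)"
proof -
  have c: "V0_submodule n a (T.fib ` Vn n)" by (simp add: V0_submodule_fib V0mod_Vn)
  have rep: "\<exists>t\<subseteq>Vn n. x = T.fib ` t" if "V0_submodule n a x" for x
  proof -
    have "x \<subseteq> T.fib ` Vn n" using that by (simp add: V0_submodule_def rescaled_model)
    then show ?thesis by (metis subset_imageE)
  qed
  show ?thesis
  proof (rule Set.set_eqI)
    fix x
    show "x \<in> V0_submodule n a hull (T.fib ` S) \<longleftrightarrow> x \<in> T.fib ` (V0mod hull S)"
    proof (cases "x \<in> T.fib ` Vn n")
      case True
      then obtain v where v: "v \<in> Vn n" "x = T.fib v" by blast
      have "x \<in> V0_submodule n a hull (T.fib ` S) \<longleftrightarrow> (\<forall>y. V0_submodule n a y \<and> T.fib ` S \<subseteq> y \<longrightarrow> x \<in> y)"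
        unfolding hull_def by simp
      also have "\<dots> \<longleftrightarrow> (\<forall>t\<subseteq>Vn n. V0_submodule n a (T.fib ` t) \<and> T.fib ` S \<subseteq> T.fib ` t \<longrightarrow> x \<in> T.fib ` t)"
      proof (intro iffI allI impI)
        fix y assume *: "\<forall>t\<subseteq>Vn n. V0_submodule n a (T.fib ` t) \<and> T.fib ` S \<subseteq> T.fib ` t \<longrightarrow> x \<in> T.fib ` t"
          and y: "V0_submodule n a y \<and> T.fib ` S \<subseteq> y"
        then obtain t where "t \<subseteq> Vn n" "y = T.fib ` t" using rep by meson
        then show "x \<in> y" using * y by simp
      qed simp
      also have "\<dots> \<longleftrightarrow> (\<forall>t\<subseteq>Vn n. V0mod t \<and> S \<subseteq> t \<longrightarrow> v \<in> t)"
        using v by (simp add: V0_submodule_fib fib_image_subset[OF S] fib_image_iff)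
      also have "\<dots> \<longleftrightarrow> v \<in> V0mod hull S" unfolding hull_def by (auto simp: V0mod_def)
      also have "\<dots> \<longleftrightarrow> x \<in> T.fib ` (V0mod hull S)" using fib_image_iff[OF v(1) V0mod_hull_Vn[OF S]] v(2) by simp
      finally show ?thesis .
    next
      case False
      have "V0_submodule n a hull (T.fib ` S) \<subseteq> T.fib ` Vn n"
        by (rule hull_minimal[where S = "V0_submodule n a", OF image_mono[OF S] c])
      then show ?thesis using False V0mod_hull_Vn[OF S] by blast
    qed
  qed
qed

lemma opN_Vn: "v \<in> Vn n \<Longrightarrow> opN \<alpha> v \<in> Vn n"
  unfolding opN_def by (intro Vn_closed op_Vn Vn_scale)

lemma opN_pow_Vn: "v \<in> Vn n \<Longrightarrow> (opN \<alpha> ^^ N) v \<in> Vn n"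
  by (induction N) (simp_all add: opN_Vn)

lemma opN_fib:
  assumes v: "v \<in> Vn n"
  shows "((\<lambda>y. resc_z\<tau>d\<tau> n a y \<oplus>\<^bsub>rescaled n a\<^esub> (cst (of_real \<alpha>) * mon (1, 0, 0)) \<odot>\<^bsub>rescaled n a\<^esub> y) ^^ N) (T.fib v)
    = T.fib ((opN \<alpha> ^^ N) v)"
proof (induction N)
  case (Suc N)
  let ?w = "(opN \<alpha> ^^ N) v"
  have w: "?w \<in> Vn n" by (rule opN_pow_Vn[OF v])
  have "resc_z\<tau>d\<tau> n a (T.fib ?w) \<oplus>\<^bsub>rescaled n a\<^esub> (cst (of_real \<alpha>) * mon (1, 0, 0)) \<odot>\<^bsub>rescaled n a\<^esub> T.fib ?w
      = T.fib (opN \<alpha> ?w)"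
    unfolding resc_z\<tau>d\<tau>_fib[OF w] rescaled_smult[OF w] rescaled_model(2)[OF op_Vn(3)[OF w] Vn_scale[OF w]] opN_def ..
  then show ?case using Suc by simp
qed simp

lemma belowI: "y < x \<Longrightarrow> v \<in> F y \<Longrightarrow> v \<in> below F x"
  by (auto simp: below_def)

lemma below_fib: "below (\<lambda>\<alpha>. T.fib ` W \<alpha>) x = T.fib ` below W x"
  by (auto simp: below_def)

lemma below_Vn: "(\<And>\<alpha>. W \<alpha> \<subseteq> Vn n) \<Longrightarrow> below W x \<subseteq> Vn n"
  by (auto simp: below_def)

lemma is_V_filtration_fib:
  assumes W: "\<And>\<alpha>. W \<alpha> \<subseteq> Vn n"
  shows "is_V_filtration n a (\<lambda>\<alpha>. T.fib ` W \<alpha>) \<longleftrightarrow> is_Vmod W"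
proof -
  have 1: "V0_submodule n a (T.fib ` W \<alpha>) \<longleftrightarrow> V0mod (W \<alpha>)" for \<alpha>
    by (rule V0_submodule_fib[OF W])
  have 2: "(\<exists>S. finite S \<and> S \<subseteq> carrier (rescaled n a) \<and> T.fib ` W \<alpha> = V0_submodule n a hull S)
      \<longleftrightarrow> (\<exists>S. finite S \<and> S \<subseteq> Vn n \<and> W \<alpha> = V0mod hull S)" (is "?l \<longleftrightarrow> ?r") for \<alpha>
  proof
    assume ?l
    then obtain S where S: "finite S" "S \<subseteq> T.fib ` Vn n" "T.fib ` W \<alpha> = V0_submodule n a hull S"
      by (auto simp: rescaled_model)
    obtain S' where S': "S' \<subseteq> Vn n" "finite S'" "S = T.fib ` S'"
      using finite_subset_image[OF S(1,2)] by blast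
    have "T.fib ` W \<alpha> = T.fib ` (V0mod hull S')" using S(3) S' hull_fib[OF S'(1)] by simp
    then have "W \<alpha> = V0mod hull S'" using fib_image_eq[OF W V0mod_hull_Vn[OF S'(1)]] by simp
    then show ?r using S' by blast
  next
    assume ?r
    then obtain S where "finite S" "S \<subseteq> Vn n" "W \<alpha> = V0mod hull S" by blast
    then show ?l using hull_fib[of S] by (intro exI[of _ "T.fib ` S"]) (auto simp: rescaled_model)
  qed
  have 3: "T.fib ` W \<alpha> \<subseteq> T.fib ` W \<beta> \<longleftrightarrow> W \<alpha> \<subseteq> W \<beta>" "T.fib ` W \<alpha> = T.fib ` W \<beta> \<longleftrightarrow> W \<alpha> = W \<beta>" for \<alpha> \<beta>
    using fib_image_subset[OF W W] fib_image_eq[OF W W] by auto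
  have 4: "(\<Union>\<alpha>. T.fib ` W \<alpha>) = carrier (rescaled n a) \<longleftrightarrow> (\<Union>\<alpha>. W \<alpha>) = Vn n"
  proof -
    have "(\<Union>\<alpha>. T.fib ` W \<alpha>) = T.fib ` (\<Union>\<alpha>. W \<alpha>)" by blast
    then show ?thesis using fib_image_eq[of "\<Union>\<alpha>. W \<alpha>" "Vn n"] W by (simp add: rescaled_model UN_subset_iff)
  qed
  have 5: "module.smult (rescaled n a) tau ` T.fib ` W \<alpha> = T.fib ` W \<beta> \<longleftrightarrow> (\<lambda>v r. tau * v r) ` W \<alpha> = W \<beta>" for \<alpha> \<beta>
  proof -
    have "module.smult (rescaled n a) tau ` T.fib ` W \<alpha> = T.fib ` (\<lambda>v r. tau * v r) ` W \<alpha>"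
      using W rescaled_smult by (force simp: image_image intro!: image_cong)
    moreover have "(\<lambda>v r. tau * v r) ` W \<alpha> \<subseteq> Vn n" using W Vn_scale by blast
    ultimately show ?thesis using fib_image_eq[OF _ W] by simp
  qed
  have bV: "below W \<alpha> \<subseteq> Vn n" for \<alpha> by (rule below_Vn[OF W])
  have 6: "(\<forall>x\<in>T.fib ` W \<alpha>. p \<noteq> 0 \<and> p \<odot>\<^bsub>rescaled n a\<^esub> x \<in> T.fib ` below W \<alpha> \<longrightarrow> x \<in> T.fib ` below W \<alpha>)
    \<longleftrightarrow> (\<forall>v\<in>W \<alpha>. p \<noteq> 0 \<and> (\<lambda>r. p * v r) \<in> below W \<alpha> \<longrightarrow> v \<in> below W \<alpha>)" for p \<alpha>
  proof -
    have "p \<odot>\<^bsub>rescaled n a\<^esub> T.fib v \<in> T.fib ` below W \<alpha> \<longleftrightarrow> (\<lambda>r. p * v r) \<in> below W \<alpha>"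
      "T.fib v \<in> T.fib ` below W \<alpha> \<longleftrightarrow> v \<in> below W \<alpha>" if "v \<in> W \<alpha>" for v
    proof -
      have v: "v \<in> Vn n" using that W by blast
      show "p \<odot>\<^bsub>rescaled n a\<^esub> T.fib v \<in> T.fib ` below W \<alpha> \<longleftrightarrow> (\<lambda>r. p * v r) \<in> below W \<alpha>"
        unfolding rescaled_smult[OF v] by (rule fib_image_iff[OF Vn_scale[OF v] bV])
      show "T.fib v \<in> T.fib ` below W \<alpha> \<longleftrightarrow> v \<in> below W \<alpha>" by (rule fib_image_iff[OF v bV])
    qed
    then show ?thesis by simp
  qed
  have 7: "(\<forall>x\<in>T.fib ` W \<alpha>. ((\<lambda>y. resc_z\<tau>d\<tau> n a y
              \<oplus>\<^bsub>rescaled n a\<^esub> (cst (of_real \<alpha>) * mon (1, 0, 0)) \<odot>\<^bsub>rescaled n a\<^esub> y) ^^ N) x \<in> T.fib ` below W \<alpha>)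
    \<longleftrightarrow> (\<forall>v\<in>W \<alpha>. (opN \<alpha> ^^ N) v \<in> below W \<alpha>)" for N \<alpha>
  proof -
    have "((\<lambda>y. resc_z\<tau>d\<tau> n a y \<oplus>\<^bsub>rescaled n a\<^esub> (cst (of_real \<alpha>) * mon (1, 0, 0)) \<odot>\<^bsub>rescaled n a\<^esub> y) ^^ N) (T.fib v)
        \<in> T.fib ` below W \<alpha> \<longleftrightarrow> (opN \<alpha> ^^ N) v \<in> below W \<alpha>" if "v \<in> W \<alpha>" for v
    proof -
      have v: "v \<in> Vn n" using that W by blast
      show ?thesis unfolding opN_fib[OF v] by (rule fib_image_iff[OF opN_pow_Vn[OF v] bV])
    qed
    then show ?thesis by simp
  qed
  show ?thesis
    unfolding is_V_filtration_def is_Vmod_def 1 2 3 4 5 below_fib 6 7 ..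
qed

lemma opN_add: "opN \<alpha> (v + w) = opN \<alpha> v + opN \<alpha> w"
  by (simp add: opN_def op_\<tau>_def fun_eq_iff deriv_add cyc_add distrib_left algebra_simps)

lemma opN_scale:
  "opN \<alpha> (\<lambda>r. (cst c * mon (1, 0, 0)) * v r) = (\<lambda>r. (cst c * mon (1, 0, 0)) * opN \<alpha> v r)"
proof -
  have d: "d_\<theta> (cst c * mon (1, 0, 0) * f) = cst c * mon (1, 0, 0) * d_\<theta> f" for f
    by (simp add: deriv_mult deriv_cst deriv_single)
  show ?thesis
    unfolding opN_def op_\<tau>_def plus_fun_def d cyc_scale by (rule ext) (simp add: algebra_simps)
qed

lemma opN_change:
  "opN \<alpha> v = opN \<beta> v + (\<lambda>r. (cst (of_real (\<alpha> - \<beta>)) * mon (1, 0, 0)) * v r)"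
proof -
  have e: "cst (of_real \<alpha>) = (cst (of_real \<beta>) + cst (of_real (\<alpha> - \<beta>)) :: O_zt\<theta>)"
    by (simp flip: single_add)
  show ?thesis unfolding opN_def e by (simp add: fun_eq_iff distrib_left distrib_right add.assoc del: of_real_diff)
qed

context
  fixes W assumes W: "is_Vmod W"
begin

lemma W_V0: "V0mod (W \<alpha>)" using W by (simp add: is_Vmod_def)
lemma W_mono: "\<alpha> \<le> \<beta> \<Longrightarrow> W \<alpha> \<subseteq> W \<beta>" using W by (simp add: is_Vmod_def)
lemma W_hull: "\<exists>S. finite S \<and> S \<subseteq> Vn n \<and> W \<alpha> = V0mod hull S" using W by (simp add: is_Vmod_def)
lemma W_exhaust: "(\<Union>\<alpha>. W \<alpha>) = Vn n" using W by (simp add: is_Vmod_def)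
lemma W_nilp: "\<exists>N. \<forall>v\<in>W \<alpha>. (opN \<alpha> ^^ N) v \<in> below W \<alpha>" using W by (simp add: is_Vmod_def)
lemma W_discrete: "\<exists>A. finite A \<and> (\<forall>\<alpha> \<beta>. \<alpha> \<le> \<beta> \<and> (\<forall>c\<in>A. \<forall>k::int. c + of_int k \<notin> {\<alpha><..\<beta>}) \<longrightarrow> W \<alpha> = W \<beta>)"
  using W unfolding is_Vmod_def by (elim conjE)
lemma W_closed:
  "0 \<in> W \<alpha>" "v \<in> W \<alpha> \<Longrightarrow> w \<in> W \<alpha> \<Longrightarrow> v + w \<in> W \<alpha>" "f \<in> Fil 0 \<Longrightarrow> v \<in> W \<alpha> \<Longrightarrow> (\<lambda>r. f * v r) \<in> W \<alpha>"
  "v \<in> W \<alpha> \<Longrightarrow> op_\<tau> v \<in> W \<alpha>"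
  using W_V0[of \<alpha>] by (simp_all add: V0mod_def O_zt\<tau>_Fil)

lemma W_opN: "v \<in> W \<alpha> \<Longrightarrow> opN \<beta> v \<in> W \<alpha>"
  unfolding opN_def
  by (intro W_closed Fil_mult0 Fil_cst Fil_single) simp_all

lemma W_opN_pow: "v \<in> W \<alpha> \<Longrightarrow> (opN \<beta> ^^ N) v \<in> W \<alpha>"
  by (induction N) (simp_all add: W_opN)

lemma below_closed:
  "v \<in> below W \<beta> \<Longrightarrow> w \<in> below W \<beta> \<Longrightarrow> v + w \<in> below W \<beta>"
  "f \<in> Fil 0 \<Longrightarrow> v \<in> below W \<beta> \<Longrightarrow> (\<lambda>r. f * v r) \<in> below W \<beta>"
  "v \<in> below W \<beta> \<Longrightarrow> opN \<delta> v \<in> below W \<beta>"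
proof -
  assume v: "v \<in> below W \<beta>"
  then obtain x where x: "x < \<beta>" "v \<in> W x" by (auto simp: below_def)
  show "f \<in> Fil 0 \<Longrightarrow> (\<lambda>r. f * v r) \<in> below W \<beta>" "opN \<delta> v \<in> below W \<beta>"
    using belowI[OF x(1), of _ W] W_closed(3)[OF _ x(2)] W_opN[OF x(2)] by simp_all
  assume "w \<in> below W \<beta>"
  then obtain y where y: "y < \<beta>" "w \<in> W y" by (auto simp: below_def)
  have "v \<in> W (max x y)" "w \<in> W (max x y)" using x y W_mono[of x "max x y"] W_mono[of y "max x y"] by auto
  then show "v + w \<in> below W \<beta>" using x y W_closed(2)[of v "max x y" w] by (auto simp: below_def)
qed

lemma W_strict: "p \<in> C_z \<Longrightarrow> p \<noteq> 0 \<Longrightarrow> v \<in> W \<alpha> \<Longrightarrow> (\<lambda>r. p * v r) \<in> below W \<alpha> \<Longrightarrow> v \<in> below W \<alpha>"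
  using W by (simp add: is_Vmod_def)

lemma W_right:
  obtains \<epsilon> where "\<epsilon> > 0" "\<And>s. \<mu> \<le> s \<Longrightarrow> s < \<mu> + \<epsilon> \<Longrightarrow> W \<mu> = W s"
proof -
  obtain A where A: "finite A"
    "\<And>\<alpha> \<beta>. \<alpha> \<le> \<beta> \<and> (\<forall>c\<in>A. \<forall>k::int. c + of_int k \<notin> {\<alpha><..\<beta>}) \<Longrightarrow> W \<alpha> = W \<beta>"
    using W_discrete by metis
  obtain \<epsilon> where "\<epsilon> > 0" "\<And>s. s < \<mu> + \<epsilon> \<Longrightarrow> \<forall>c\<in>A. \<forall>k::int. c + of_int k \<notin> {\<mu><..s}"
    using no_jumps_right[OF A(1)] by blast
  then show ?thesis using that A(2) by blast
qed

text \<open>On the \<open>\<beta>\<close>-graded piece \<open>opN \<beta>\<close> is nilpotent and commutes with \<open>cz\<close>, and \<open>cz\<close> is injective by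
  strictness. A vector killed by \<open>opN \<beta> + cz\<close> satisfies \<open>cz y = - opN \<beta> y\<close>, so the vanishing of a power
  of \<open>opN \<beta>\<close> on it can be lowered to the exponent zero.\<close>

lemma W_nilpotent_shift_injective:
  assumes c: "c \<noteq> 0"
  shows "y \<in> W \<beta> \<Longrightarrow> opN \<beta> y + (\<lambda>r. (cst c * mon (1, 0, 0)) * y r) \<in> below W \<beta> \<Longrightarrow> y \<in> below W \<beta>"
proof -
  let ?sc = "\<lambda>y r. (cst c * mon (1, 0, 0)) * y r"
  obtain K where K: "\<And>v. v \<in> W \<beta> \<Longrightarrow> (opN \<beta> ^^ K) v \<in> below W \<beta>"
    using W_nilp by blast
  have e: "cst c * mon (1, 0, 0) = (sg (1, 0, 0) c :: O_zt\<theta>)" by (simp add: mult_single)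
  have p: "cst c * mon (1, 0, 0) \<in> C_z" "cst c * mon (1, 0, 0) \<noteq> (0 :: O_zt\<theta>)"
    unfolding e using c lookup_single_eq[of "(1, 0, 0) :: nat \<times> int \<times> int" c]
    by (simp add: C_z_def, metis lookup_zero)
  have "y \<in> W \<beta> \<Longrightarrow> opN \<beta> y + ?sc y \<in> below W \<beta> \<Longrightarrow> (opN \<beta> ^^ k) y \<in> below W \<beta> \<Longrightarrow> y \<in> below W \<beta>" for k y
  proof (induction k arbitrary: y)
    case (Suc k)
    have "opN \<beta> (opN \<beta> y) + ?sc (opN \<beta> y) = opN \<beta> (opN \<beta> y + ?sc y)"
      by (simp only: opN_add opN_scale)
    also have "\<dots> \<in> below W \<beta>" by (rule below_closed(3)[OF Suc.prems(2)])
    finally have e: "opN \<beta> (opN \<beta> y) + ?sc (opN \<beta> y) \<in> below W \<beta>" .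
    have "(opN \<beta> ^^ k) (opN \<beta> y) \<in> below W \<beta>"
      using Suc.prems(3) by (simp add: funpow_swap1)
    then have 1: "opN \<beta> y \<in> below W \<beta>"
      by (rule Suc.IH[OF W_opN[OF Suc.prems(1)] e])
    have "(\<lambda>r. -1 * opN \<beta> y r) \<in> below W \<beta>"
      using below_closed(2)[OF Fil_uminus 1, of 1] Fil_cst(2)[of 1] by simp
    from below_closed(1)[OF Suc.prems(2) this] have "?sc y \<in> below W \<beta>" by (simp add: plus_fun_def)
    then show ?case by (rule W_strict[OF p Suc.prems(1)])
  qed simp
  then show "y \<in> W \<beta> \<Longrightarrow> opN \<beta> y + ?sc y \<in> below W \<beta> \<Longrightarrow> y \<in> below W \<beta>" using K by blast
qed

lemma W_pow_injective:
  assumes "\<alpha> < \<beta>"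
  shows "y \<in> W \<beta> \<Longrightarrow> (opN \<alpha> ^^ k) y \<in> below W \<beta> \<Longrightarrow> y \<in> below W \<beta>"
proof (induction k arbitrary: y)
  case (Suc k)
  have "opN \<alpha> y \<in> below W \<beta>"
    using Suc.IH[OF W_opN[OF Suc.prems(1)]] Suc.prems(2) by (simp add: funpow_swap1)
  then have "opN \<beta> y + (\<lambda>r. (cst (of_real (\<alpha> - \<beta>)) * mon (1, 0, 0)) * y r) \<in> below W \<beta>"
    by (simp only: opN_change[of \<alpha> y \<beta>])
  then show ?case using assms
    by (intro W_nilpotent_shift_injective[OF _ Suc.prems(1)]) (simp_all del: of_real_diff)
qed simp

end

text \<open>Finite generation puts one step of \<open>W\<close> into some step of \<open>W'\<close>; multiplication by powers of \<open>\<tau>\<close>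
  transports this inclusion to all smaller indices.\<close>

lemma Vmod_bounded:
  assumes W: "is_Vmod W" and W': "is_Vmod W'"
  shows "\<exists>\<gamma>. \<forall>m::nat. W (\<alpha> - real m) \<subseteq> W' (\<gamma> - real m)"
proof -
  obtain S where S: "finite S" "S \<subseteq> Vn n" "W \<alpha> = V0mod hull S"
    using W_hull[OF W] by blast
  have "\<exists>\<gamma>. S \<subseteq> W' \<gamma>" using S(1,2)
  proof (induction S rule: finite_induct)
    case (insert v S)
    then obtain \<gamma> where \<gamma>: "S \<subseteq> W' \<gamma>" by auto
    obtain \<delta> where "v \<in> W' \<delta>" using insert.prems W_exhaust[OF W'] by blast
    then have "insert v S \<subseteq> W' (max \<gamma> \<delta>)"
      using \<gamma> W_mono[OF W', of \<gamma> "max \<gamma> \<delta>"] W_mono[OF W', of \<delta> "max \<gamma> \<delta>"] by auto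
    then show ?case by blast
  qed simp
  then obtain \<gamma> where "S \<subseteq> W' \<gamma>" by blast
  then have 0: "W \<alpha> \<subseteq> W' \<gamma>" unfolding S(3) by (rule hull_minimal) (rule W_V0[OF W'])
  have t: "(\<lambda>v r. tau * v r) ` U \<delta> = U (\<delta> - 1)" if "is_Vmod U" for U \<delta>
    using that by (simp add: is_Vmod_def)
  have "W (\<alpha> - real m) \<subseteq> W' (\<gamma> - real m)" for m
  proof (induction m)
    case (Suc m)
    have "W (\<alpha> - real m - 1) \<subseteq> W' (\<gamma> - real m - 1)"
      unfolding t[OF W, symmetric] t[OF W', symmetric] by (rule image_mono[OF Suc])
    then show ?case by (simp add: algebra_simps)
  qed (use 0 in simp)
  then show ?thesis by blast
qed

text \<open>Consider the infimum \<open>\<mu>\<close> of the indices where the claim fails; it is finite by \<open>Vmod_bounded\<close>, and the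
  claim fails at \<open>\<mu>\<close> itself since \<open>W\<close> is constant to the right of \<open>\<mu>\<close>. A power of \<open>opN \<mu>\<close> moves an
  element of \<open>W \<mu>\<close> into a smaller step, where the claim holds, and on the \<open>\<beta>\<close>-graded piece of \<open>W'\<close> that
  power is injective because \<open>\<mu> < \<beta>\<close>.\<close>

lemma Vmod_drop:
  assumes W: "is_Vmod W" and W': "is_Vmod W'" and ab: "\<alpha> < \<beta>"
    and x: "x \<in> W \<alpha>" "x \<in> W' \<beta>"
  shows "x \<in> below W' \<beta>"
proof (rule ccontr)
  define B where "B = {s. s < \<beta> \<and> (\<exists>x\<in>W s \<inter> W' \<beta>. x \<notin> below W' \<beta>)}"
  assume "x \<notin> below W' \<beta>"
  then have ne: "B \<noteq> {}" using ab x by (auto simp: B_def)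
  obtain \<gamma> where \<gamma>: "\<And>m::nat. W (\<alpha> - real m) \<subseteq> W' (\<gamma> - real m)"
    using Vmod_bounded[OF W W', of \<alpha>] by blast
  obtain m :: nat where m: "\<gamma> - \<beta> < real m" using reals_Archimedean2 by blast
  have lb: "\<alpha> - real m \<le> s" if "s \<in> B" for s
  proof (rule ccontr)
    assume "\<not> \<alpha> - real m \<le> s"
    then have "W s \<subseteq> W' (\<gamma> - real m)" using W_mono[OF W, of s "\<alpha> - real m"] \<gamma>[of m] by simp
    then have "W s \<subseteq> below W' \<beta>" using m belowI[of "\<gamma> - real m" \<beta> _ W'] by auto
    then show False using that by (auto simp: B_def)
  qed
  then have bdd: "bdd_below B" by (auto simp: bdd_below_def)
  define \<mu> where "\<mu> = Inf B"
  obtain \<epsilon> where \<epsilon>: "\<epsilon> > 0" "\<And>s. \<mu> \<le> s \<Longrightarrow> s < \<mu> + \<epsilon> \<Longrightarrow> W \<mu> = W s" using W_right[OF W] by blast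
  obtain s where s: "s \<in> B" "s < \<mu> + \<epsilon>" using cInf_lessD[OF ne, of "\<mu> + \<epsilon>"] \<epsilon>(1) by (auto simp: \<mu>_def)
  have "\<mu> \<le> s" unfolding \<mu>_def by (rule cInf_lower[OF s(1) bdd])
  then have "W \<mu> = W s" "\<mu> < \<beta>" using \<epsilon>(2) s by (auto simp: B_def)
  then obtain y where y: "y \<in> W \<mu>" "y \<in> W' \<beta>" "y \<notin> below W' \<beta>" using s(1) by (auto simp: B_def)
  obtain K where "(opN \<mu> ^^ K) y \<in> below W \<mu>" using W_nilp[OF W] y(1) by blast
  then obtain s' where s': "s' < \<mu>" "(opN \<mu> ^^ K) y \<in> W s'" by (auto simp: below_def)
  have "s' \<notin> B" using cInf_lower[OF _ bdd, of s'] s'(1) by (auto simp: \<mu>_def)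
  then have "(opN \<mu> ^^ K) y \<in> below W' \<beta>"
    using s' \<open>\<mu> < \<beta>\<close> W_opN_pow[OF W' y(2)] by (auto simp: B_def)
  then show False using W_pow_injective[OF W' \<open>\<mu> < \<beta>\<close> y(2)] y(3) by blast
qed

text \<open>By \<open>Vmod_drop\<close> the smallest index \<open>\<ge> \<alpha>\<close> of a step of \<open>W'\<close> that contains a given \<open>x \<in> W \<alpha>\<close> cannot exceed
  \<open>\<alpha>\<close>.\<close>

lemma Vmod_subset:
  assumes W: "is_Vmod W" and W': "is_Vmod W'"
  shows "W \<alpha> \<subseteq> W' \<alpha>"
proof
  fix x assume x: "x \<in> W \<alpha>"
  obtain \<gamma> where \<gamma>: "\<And>m::nat. W (\<alpha> - real m) \<subseteq> W' (\<gamma> - real m)"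
    using Vmod_bounded[OF W W', of \<alpha>] by blast
  define B where "B = {\<beta>. \<alpha> \<le> \<beta> \<and> x \<in> W' \<beta>}"
  have "x \<in> W' (max \<alpha> \<gamma>)" using \<gamma>[of 0] x W_mono[OF W', of \<gamma> "max \<alpha> \<gamma>"] by auto
  then have "max \<alpha> \<gamma> \<in> B" by (simp add: B_def)
  then have ne: "B \<noteq> {}" by blast
  have bdd: "bdd_below B" by (auto simp: bdd_below_def B_def)
  define \<mu> where "\<mu> = Inf B"
  have \<mu>: "\<alpha> \<le> \<mu>" unfolding \<mu>_def by (rule cInf_greatest[OF ne]) (simp add: B_def)
  obtain \<epsilon> where \<epsilon>: "\<epsilon> > 0" "\<And>s. \<mu> \<le> s \<Longrightarrow> s < \<mu> + \<epsilon> \<Longrightarrow> W' \<mu> = W' s" using W_right[OF W'] by blast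
  obtain s where s: "s \<in> B" "s < \<mu> + \<epsilon>" using cInf_lessD[OF ne, of "\<mu> + \<epsilon>"] \<epsilon>(1) by (auto simp: \<mu>_def)
  have "\<mu> \<le> s" unfolding \<mu>_def by (rule cInf_lower[OF s(1) bdd])
  then have x\<mu>: "x \<in> W' \<mu>" using \<epsilon>(2) s by (auto simp: B_def)
  show "x \<in> W' \<alpha>"
  proof (cases "\<alpha> = \<mu>")
    case False
    then have "x \<in> below W' \<mu>" using Vmod_drop[OF W W' _ x x\<mu>] \<mu> by simp
    then obtain y where y: "y < \<mu>" "x \<in> W' y" by (auto simp: below_def)
    then have "max y \<alpha> \<in> B" using W_mono[OF W', of y "max y \<alpha>"] by (auto simp: B_def)
    then have "\<mu> \<le> max y \<alpha>" unfolding \<mu>_def by (rule cInf_lower[OF _ bdd])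
    then show ?thesis using y \<mu> False by simp
  qed (use x\<mu> in simp)
qed

lemma Vmod_unique: "is_Vmod W \<Longrightarrow> is_Vmod W' \<Longrightarrow> W = W'"
  using Vmod_subset by (metis ext subset_antisym)

end

section \<open>Existence of the V-filtration\<close>

lemma Fil_sum: "(\<And>i. i \<in> I \<Longrightarrow> f i \<in> Fil m) \<Longrightarrow> (\<Sum>i\<in>I. f i) \<in> Fil m"
  by (induction I rule: infinite_finite_induct) (simp_all add: Fil_zero Fil_add)

lemma tau_Fil: "f \<in> Fil m \<Longrightarrow> tau * f \<in> Fil (m - 1)"
  using Fil_mult[of tau "-1" f m] Fil_single[of "-1" "-1" 0 0 1] by simp

lemma mon_inverse: "mon (0, 0, m) * mon (0, 0, - m) = (1 :: O_zt\<theta>)"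
proof -
  have "mon (0, 0, 0) = (1 :: O_zt\<theta>)" by (metis single_one zero_prod_def)
  then show ?thesis by (simp add: mult_single)
qed

lemma of_int_mult_single:
  "of_int n * sg (k :: 'k::comm_monoid_add) c = (sg k (of_int n * c) :: 'k \<Rightarrow>\<^sub>0 complex)"
proof -
  have "sg 0 (of_int n) * sg k c = (sg k (of_int n * c) :: 'k \<Rightarrow>\<^sub>0 complex)"
    by (simp only: mult_single add_0_left)
  then show ?thesis by (simp only: single_of_int)
qed

text \<open>On the part of exact degree \<open>m\<close> in \<open>\<theta>\<close> the operator \<open>\<theta>\<partial>\<^sub>\<theta>\<close> is multiplication by \<open>m\<close>.\<close>

lemma Fil_leading:
  assumes f: "f \<in> Fil m"
  shows "mon (1, 0, 1) * d_\<theta> f - cst (of_int m) * mon (1, 0, 0) * f \<in> Fil (m - 1)"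
proof -
  let ?D = "\<lambda>f. mon (1, 0, 1) * d_\<theta> f - cst (of_int m) * mon (1, 0, 0) * f"
  have add: "?D (f + g) = ?D f + ?D g" for f g
    by (simp add: deriv_add algebra_simps)
  have e: "f = (\<Sum>k\<in>kys f. sg k (lk f k))"
    by (intro poly_mapping_eqI) (simp add: lookup_sum lookup_single when_def in_keys_iff)
  have "?D (sg k (lk f k)) \<in> Fil (m - 1)" if "k \<in> kys f" for k
  proof -
    obtain x b d where k: "k = (x, b, d)" by (cases k)
    have "?D (sg k (lk f k)) = sg (Suc x, b, d) ((of_int d - of_int m) * lk f k)"
      by (simp add: k deriv_single mult_single mult.assoc of_int_mult_single left_diff_distrib single_diff)
    moreover have "d \<le> m" using f that by (auto simp: Fil_def k)
    ultimately show ?thesis by (cases "d = m") (simp_all add: Fil_zero Fil_single)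
  qed
  then have "(\<Sum>k\<in>kys f. ?D (sg k (lk f k))) \<in> Fil (m - 1)" by (rule Fil_sum)
  then show ?thesis using additive_sum[of ?D, OF add] e by metis
qed

context hypergeometric
begin

lemma nu_jump: "nu n a \<alpha> r = \<lceil>jump r - \<alpha>\<rceil>"
  by (simp add: nu_def jump_def algebra_simps)

text \<open>The exponent that replaces \<open>\<nu>\<^sub>\<alpha>(r)\<close> for the union of the steps with index smaller than \<open>\<alpha>\<close>.\<close>

definition nu_below :: "real \<Rightarrow> nat \<Rightarrow> int"
  where "nu_below \<alpha> r = \<lfloor>jump r - \<alpha>\<rfloor> + 1"

text \<open>The monotonicity of the \<open>a\<^sub>i\<close> ensures that \<open>\<tau>Q\<^sub>r\<close> has at most the order of \<open>Q\<^sub>r\<^sub>-\<^sub>1\<close>.\<close>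

lemma jump_step: "0 < r \<Longrightarrow> r < n \<Longrightarrow> jump r \<le> jump (r - 1) + 1"
proof -
  assume r: "0 < r" "r < n"
  then have "a r \<le> a (Suc r)" by (intro a_mono) auto
  then have "real n * a r \<le> real n * a (Suc r)" by (rule mult_left_mono) simp
  then show ?thesis using r by (simp add: jump_def of_nat_diff)
qed

text \<open>The exponents lie in an interval of length less than 1, so \<open>\<tau>tQ\<^sub>0\<close>, to which \<open>Q\<^sub>n\<^sub>-\<^sub>1\<close> is mapped, has
  strictly smaller order than \<open>Q\<^sub>n\<^sub>-\<^sub>1\<close>. This strict inequality breaks the cycle and makes \<open>opN\<close>
  nilpotent on graded pieces.\<close>

lemma jump_wrap: "jump 0 < jump (n - 1) + 1"
proof -
  have "a n < 1" "0 \<le> a 1" using a_range[of n] a_range[of 1] n by auto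
  then have "real n * (a n - a 1) < real n * 1" using n by (intro mult_strict_left_mono) auto
  then show ?thesis using n by (simp add: jump_def of_nat_diff algebra_simps)
qed

definition bounded_by :: "(nat \<Rightarrow> int) \<Rightarrow> (nat \<Rightarrow> O_zt\<theta>) set"
  where "bounded_by b = {v \<in> Vn n. \<forall>r<n. v r \<in> Fil (- b r)}"

abbreviation Vmod :: "real \<Rightarrow> (nat \<Rightarrow> O_zt\<theta>) set"
  where "Vmod \<alpha> \<equiv> bounded_by (nu n a \<alpha>)"

lemma bounded_by_mono: "(\<And>r. r < n \<Longrightarrow> b r \<le> c r) \<Longrightarrow> bounded_by c \<subseteq> bounded_by b"
  using Fil_mono[of _ "- c _" "- b _"] by (fastforce simp: bounded_by_def)

lemma cyc_Fil:
  assumes "\<And>r. r < n \<Longrightarrow> v r \<in> Fil (- b r)" "r < n"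
  shows "tau * cyc n (mon (0, 1, 0)) v r \<in> Fil (- (if r = 0 then b (n - 1) else b (r - 1)) - 1)"
proof -
  have c: "cyc n (mon (0, 1, 0)) v r \<in> Fil (- (if r = 0 then b (n - 1) else b (r - 1)))"
    using assms n by (auto simp: cyc_def intro!: Fil_mult0 Fil_single)
  then show ?thesis by (rule tau_Fil)
qed

lemma V0mod_bounded_by:
  assumes step: "\<And>r. 0 < r \<Longrightarrow> r < n \<Longrightarrow> b r \<le> b (r - 1) + 1" and wrap: "b 0 \<le> b (n - 1) + 1"
  shows "V0mod (bounded_by b)"
proof -
  have cyc: "tau * cyc n (mon (0, 1, 0)) v r \<in> Fil (- b r)" if "v \<in> bounded_by b" "r < n" for v r
  proof -
    have "tau * cyc n (mon (0, 1, 0)) v r \<in> Fil (- (if r = 0 then b (n - 1) else b (r - 1)) - 1)"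
      using that by (intro cyc_Fil) (simp_all add: bounded_by_def)
    moreover have "- (if r = 0 then b (n - 1) else b (r - 1)) - 1 \<le> - b r"
      using step[of r] wrap that(2) by (cases "r = 0") simp_all
    ultimately show ?thesis by (rule Fil_mono)
  qed
  have t: "op_t v \<in> bounded_by b" if v: "v \<in> bounded_by b" for v
  proof -
    have "op_t v r \<in> Fil (- b r)" if r: "r < n" for r
    proof -
      have f: "v r \<in> Fil (- b r)" using v r by (simp add: bounded_by_def)
      show ?thesis unfolding op_t_def
        by (intro Fil_add Fil_mult0[of "mon (1, 0, 0)"] Fil_mult0[of "mon (0, -1, 0)"] Fil_mult0[of "cst _ * mon _"]
            Fil_mult0[of "cst _" "mon _" 0] Fil_single Fil_cst Fil_deriv f cyc[OF v r]) simp_all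
    qed
    then show ?thesis using v op_Vn(1) by (simp add: bounded_by_def)
  qed
  have \<tau>: "op_\<tau> v \<in> bounded_by b" if v: "v \<in> bounded_by b" for v
  proof -
    have "op_\<tau> v r \<in> Fil (- b r)" if r: "r < n" for r
    proof -
      have f: "v r \<in> Fil (- b r)" using v r by (simp add: bounded_by_def)
      show ?thesis unfolding op_\<tau>_def mult.assoc[of "of_nat n"]
        by (intro Fil_add Fil_diff Fil_mult0[of "of_nat n"] Fil_mult0[of "cst _ * mon _"]
            Fil_mult0[of "cst _" "mon _" 0] Fil_single Fil_cst Fil_deriv f cyc[OF v r]) simp_all
    qed
    then show ?thesis using v op_Vn(3) by (simp add: bounded_by_def)
  qed
  show ?thesis unfolding V0mod_def
    using t \<tau> by (auto simp: bounded_by_def Vn_closed Vn_scale Fil_zero Fil_add O_zt\<tau>_Fil Fil_mult0)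
qed

lemma V0mod_Vmod: "V0mod (Vmod \<alpha>)"
proof (rule V0mod_bounded_by)
  fix r assume "0 < r" "r < n"
  then have "jump r - \<alpha> \<le> jump (r - 1) - \<alpha> + 1" using jump_step[of r] by simp
  then have "\<lceil>jump r - \<alpha>\<rceil> \<le> \<lceil>jump (r - 1) - \<alpha> + 1\<rceil>" by (rule ceiling_mono)
  then show "nu n a \<alpha> r \<le> nu n a \<alpha> (r - 1) + 1" by (simp add: nu_jump)
next
  have "\<lceil>jump 0 - \<alpha>\<rceil> \<le> \<lceil>jump (n - 1) - \<alpha> + 1\<rceil>" using jump_wrap by (intro ceiling_mono) simp
  then show "nu n a \<alpha> 0 \<le> nu n a \<alpha> (n - 1) + 1" by (simp add: nu_jump)
qed

lemma Vmod_mono: "\<alpha> \<le> \<beta> \<Longrightarrow> Vmod \<alpha> \<subseteq> Vmod \<beta>"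
  by (intro bounded_by_mono) (simp add: nu_jump ceiling_mono)

lemma below_Vmod: "below Vmod \<alpha> = bounded_by (nu_below \<alpha>)"
proof
  have "Vmod \<beta> \<subseteq> bounded_by (nu_below \<alpha>)" if "\<beta> < \<alpha>" for \<beta>
  proof (rule bounded_by_mono)
    fix r
    have "real_of_int \<lfloor>jump r - \<alpha>\<rfloor> < jump r - \<beta>" using that by linarith
    then show "nu_below \<alpha> r \<le> nu n a \<beta> r" by (simp add: nu_below_def nu_jump less_ceiling_iff add1_zle_eq)
  qed
  then show "below Vmod \<alpha> \<subseteq> bounded_by (nu_below \<alpha>)" by (auto simp: below_def)
  \<comment> \<open>lowering the index by this much raises no exponent beyond \<open>nu_below\<close>\<close>
  define \<delta> where "\<delta> = Min ((\<lambda>r. real_of_int \<lfloor>jump r - \<alpha>\<rfloor> + 1 - (jump r - \<alpha>)) ` {..<n})"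
  have "0 \<in> {..<n}" using n by simp
  then have ne: "{..<n} \<noteq> {}" by blast
  have "real_of_int \<lfloor>jump r - \<alpha>\<rfloor> + 1 - (jump r - \<alpha>) > 0" for r by linarith
  then have "\<delta> > 0" unfolding \<delta>_def using ne by (subst Min_gr_iff) auto
  have "bounded_by (nu_below \<alpha>) \<subseteq> Vmod (\<alpha> - \<delta>)"
  proof (rule bounded_by_mono)
    fix r assume "r < n"
    then have "\<delta> \<le> real_of_int \<lfloor>jump r - \<alpha>\<rfloor> + 1 - (jump r - \<alpha>)" unfolding \<delta>_def by (intro Min_le) auto
    then show "nu n a (\<alpha> - \<delta>) r \<le> nu_below \<alpha> r" by (simp add: nu_below_def nu_jump ceiling_le_iff)
  qed
  then show "bounded_by (nu_below \<alpha>) \<subseteq> below Vmod \<alpha>"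
    using belowI[of "\<alpha> - \<delta>" \<alpha> _ Vmod] \<open>\<delta> > 0\<close> by auto
qed

lemma Vmod_exhaustive: "(\<Union>\<alpha>. Vmod \<alpha>) = Vn n"
proof
  show "(\<Union>\<alpha>. Vmod \<alpha>) \<subseteq> Vn n" by (auto simp: bounded_by_def)
  show "Vn n \<subseteq> (\<Union>\<alpha>. Vmod \<alpha>)"
  proof
    fix v :: "nat \<Rightarrow> O_zt\<theta>" assume v: "v \<in> Vn n"
    define T where "T = (SIGMA r:{..<n}. kys (v r))"
    have "finite T" by (simp add: T_def)
    then obtain M where M: "M \<ge> 0" "\<And>k. k \<in> T \<Longrightarrow> \<bar>snd (snd (snd k))\<bar> \<le> M"
      using finite_bound_abs[of T "\<lambda>k. snd (snd (snd k))"] by metis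
    \<comment> \<open>large enough for \<open>\<nu>\<^sub>\<alpha>(r) \<le> -M\<close>, where \<open>M\<close> bounds the order of the pole of \<open>v\<close>\<close>
    define \<alpha> where "\<alpha> = (\<Sum>r<n. \<bar>jump r\<bar>) + of_int M"
    have "v r \<in> Fil (- nu n a \<alpha> r)" if r: "r < n" for r
    proof -
      have "\<bar>jump r\<bar> \<le> (\<Sum>r<n. \<bar>jump r\<bar>)" using r by (intro member_le_sum) auto
      then have "nu n a \<alpha> r \<le> - M" by (simp add: nu_jump ceiling_le_iff \<alpha>_def)
      moreover have "d \<le> M" if "(x, b, d) \<in> kys (v r)" for x b d
        using M(2)[of "(r, x, b, d)"] that r by (auto simp: T_def)
      ultimately show ?thesis by (force simp: Fil_def)
    qed
    then show "v \<in> (\<Union>\<alpha>. Vmod \<alpha>)" using v by (auto simp: bounded_by_def)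
  qed
qed

lemma Vmod_tau: "(\<lambda>v r. tau * v r) ` Vmod \<alpha> = Vmod (\<alpha> - 1)"
proof -
  have nu: "nu n a (\<alpha> - 1) r = nu n a \<alpha> r + 1" for r
  proof -
    have "jump r - (\<alpha> - 1) = jump r - \<alpha> + 1" by simp
    then show ?thesis by (simp only: nu_jump ceiling_add_one)
  qed
  have t: "tau \<in> Fil (-1)" "mon (0, 0, 1) \<in> Fil 1" by (rule Fil_single, simp)+
  have inv: "tau * (mon (0, 0, 1) * f) = f" for f :: O_zt\<theta>
    using mon_inverse[of "-1"] by (simp flip: mult.assoc)
  show ?thesis
  proof
    show "(\<lambda>v r. tau * v r) ` Vmod \<alpha> \<subseteq> Vmod (\<alpha> - 1)"
    proof clarify
      fix v assume v: "v \<in> Vmod \<alpha>"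
      have "tau * v r \<in> Fil (- nu n a (\<alpha> - 1) r)" if "r < n" for r
        using tau_Fil[of "v r" "- nu n a \<alpha> r"] v that by (simp add: bounded_by_def nu)
      then show "(\<lambda>r. tau * v r) \<in> Vmod (\<alpha> - 1)" using v by (simp add: bounded_by_def Vn_scale)
    qed
    show "Vmod (\<alpha> - 1) \<subseteq> (\<lambda>v r. tau * v r) ` Vmod \<alpha>"
    proof
      fix v assume v: "v \<in> Vmod (\<alpha> - 1)"
      have "mon (0, 0, 1) * v r \<in> Fil (- nu n a \<alpha> r)" if "r < n" for r
        using Fil_mult[OF t(2), of "v r" "- nu n a (\<alpha> - 1) r"] v that by (simp add: bounded_by_def nu)
      then have "(\<lambda>r. mon (0, 0, 1) * v r) \<in> Vmod \<alpha>" using v by (simp add: bounded_by_def Vn_scale)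
      then show "v \<in> (\<lambda>v r. tau * v r) ` Vmod \<alpha>" by (rule rev_image_eqI) (simp add: inv)
    qed
  qed
qed

lemma Vmod_hull: "\<exists>S. finite S \<and> S \<subseteq> Vn n \<and> Vmod \<alpha> = V0mod hull S"
proof -
  define e where "e = (\<lambda>r s. if s = r then mon (0, 0, - nu n a \<alpha> r) else (0 :: O_zt\<theta>))"
  have eV: "e r \<in> Vmod \<alpha>" if "r < n" for r
    using that by (auto simp: e_def bounded_by_def Vn_def Fil_zero Fil_single)
  have "Vmod \<alpha> \<subseteq> V0mod hull (e ` {..<n})"
  proof
    fix v assume v: "v \<in> Vmod \<alpha>"
    have "v \<in> t" if t: "V0mod t" "e ` {..<n} \<subseteq> t" for t
    proof -
      define w where "w = (\<lambda>r s. (mon (0, 0, nu n a \<alpha> r) * v r) * e r s)"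
      have w: "w r \<in> t" if r: "r < n" for r
      proof -
        have "mon (0, 0, nu n a \<alpha> r) * v r \<in> Fil (nu n a \<alpha> r + - nu n a \<alpha> r)"
          using v r by (intro Fil_mult Fil_single) (auto simp: bounded_by_def)
        then have "mon (0, 0, nu n a \<alpha> r) * v r \<in> O_zt\<tau>" by (simp add: O_zt\<tau>_Fil)
        moreover have "e r \<in> t" using t(2) r by auto
        ultimately show ?thesis unfolding w_def using t(1) by (simp add: V0mod_def)
      qed
      have "(\<Sum>r<k. w r) \<in> t" if "k \<le> n" for k
        using that
      proof (induction k)
        case 0
        show ?case using t(1) unfolding V0mod_def lessThan_0 sum.empty by blast
      next
        case (Suc k)
        then have "sum w {..<k} \<in> t" "w k \<in> t" using w[of k] by simp_all
        then show ?case using t(1) unfolding V0mod_def sum.lessThan_Suc by blast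
      qed
      moreover have "(\<Sum>r<n. w r) = v"
      proof
        fix s
        have one: "mon (0, 0, m) * f * mon (0, 0, - m) = f" for m and f :: O_zt\<theta>
          using mon_inverse[of m] by (metis mult.commute mult.left_commute mult_1_right)
        have "(\<Sum>r<k. w r) s = (\<Sum>r<k. w r s)" for k by (induction k) simp_all
        then have "(\<Sum>r<n. w r) s = (\<Sum>r<n. w r s)" .
        also have "\<dots> = (\<Sum>r<n. if r = s then v s else 0)"
          by (intro sum.cong refl) (simp add: w_def e_def one)
        also have "\<dots> = v s" using v by (simp add: bounded_by_def Vn_def)
        finally show "(\<Sum>r<n. w r) s = v s" .
      qed
      ultimately show ?thesis by fastforce
    qed
    then show "v \<in> V0mod hull (e ` {..<n})" by (simp add: hull_def)
  qed
  moreover have "V0mod hull (e ` {..<n}) \<subseteq> Vmod \<alpha>"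
    using eV by (intro hull_minimal[where S = V0mod] V0mod_Vmod) auto
  moreover have "e ` {..<n} \<subseteq> Vn n" using eV by (auto simp: bounded_by_def)
  ultimately show ?thesis by (intro exI[of _ "e ` {..<n}"]) auto
qed

text \<open>If \<open>jump r - \<alpha>\<close> is an integer, the leading term of the coordinate is cancelled by the eigenvalue; otherwise
  the two exponents coincide. Only the contribution of the preceding coordinate can prevent the drop.\<close>

lemma opN_Fil:
  assumes f: "v r \<in> Fil (- nu n a \<alpha> r)" and c: "tau * cyc n (mon (0, 1, 0)) v r \<in> Fil (- nu_below \<alpha> r)"
  shows "opN \<alpha> v r \<in> Fil (- nu_below \<alpha> r)"
proof -
  define y where "y = jump r - \<alpha>"
  have e: "opN \<alpha> v r = of_nat n * (tau * cyc n (mon (0, 1, 0)) v r)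
      - (mon (1, 0, 1) * d_\<theta> (v r) + cst (of_real y) * mon (1, 0, 0) * v r)"
    by (simp add: opN_def op_\<tau>_def y_def single_diff algebra_simps)
  have "mon (1, 0, 1) * d_\<theta> (v r) + cst (of_real y) * mon (1, 0, 0) * v r \<in> Fil (- nu_below \<alpha> r)"
  proof (cases "y \<in> \<int>")
    case True
    then obtain m where m: "y = of_int m" by (auto elim: Ints_cases)
    have 1: "nu n a \<alpha> r = m" "- nu_below \<alpha> r = - m - 1" using m by (simp_all add: nu_jump nu_below_def y_def)
    have "cst (of_real y) = - (cst (of_int (- m)) :: O_zt\<theta>)" by (simp add: m flip: single_uminus)
    then show ?thesis using Fil_leading[OF f[unfolded 1]] by (simp add: 1 algebra_simps)
  next
    case False
    then have "nu_below \<alpha> r = nu n a \<alpha> r" by (simp add: nu_jump nu_below_def y_def ceiling_altdef Ints_def) (metis Ints_of_int Ints_def)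
    moreover have "mon (1, 0, 1) * d_\<theta> (v r) \<in> Fil (- nu n a \<alpha> r)" by (rule Fil_deriv(2)[OF f])
    ultimately show ?thesis using f
      by (auto simp del: One_nat_def intro!: Fil_add Fil_mult0[of "cst _ * mon _"] Fil_mult0[of "cst _" "mon _" 0] Fil_cst Fil_single)
  qed
  then show ?thesis unfolding e using c by (intro Fil_diff Fil_mult0[of "of_nat n"] Fil_cst)
qed

text \<open>The coordinate 0 drops at the first application, by \<open>jump_wrap\<close>, and the coordinate \<open>r\<close> drops as soon
  as the coordinate \<open>r - 1\<close> has done so; after \<open>n\<close> applications all of them have.\<close>

lemma opN_pow_Fil:
  assumes v: "v \<in> Vmod \<alpha>"
  shows "(opN \<alpha> ^^ k) v \<in> Vmod \<alpha> \<and> (\<forall>r<n. r < k \<longrightarrow> (opN \<alpha> ^^ k) v r \<in> Fil (- nu_below \<alpha> r))"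
proof (induction k)
  case 0
  then show ?case using v by simp
next
  case (Suc k)
  let ?w = "(opN \<alpha> ^^ k) v"
  have w: "?w \<in> Vmod \<alpha>" "\<And>r. r < n \<Longrightarrow> r < k \<Longrightarrow> ?w r \<in> Fil (- nu_below \<alpha> r)" using Suc by auto
  have wr: "?w r \<in> Fil (- nu n a \<alpha> r)" if "r < n" for r using w(1) that by (simp add: bounded_by_def)
  have 1: "opN \<alpha> ?w \<in> Vmod \<alpha>"
  proof -
    have "(\<lambda>r. cst (of_real \<alpha>) * mon (1, 0, 0) * ?w r) \<in> Vmod \<alpha>"
      using w(1) by (auto simp: bounded_by_def Vn_scale
        intro!: Fil_mult0[of "cst _ * mon _"] Fil_mult0[of "cst _" "mon _" 0] Fil_cst Fil_single)
    then show ?thesis using V0mod_Vmod[of \<alpha>] w(1) by (simp add: opN_def V0mod_def)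
  qed
  have "opN \<alpha> ?w r \<in> Fil (- nu_below \<alpha> r)" if r: "r < n" "r < Suc k" for r
  proof (rule opN_Fil[where v = ?w, OF wr[OF r(1)]])
    show "tau * cyc n (mon (0, 1, 0)) ?w r \<in> Fil (- nu_below \<alpha> r)"
    proof (cases "r = 0")
      case True
      have "real_of_int \<lfloor>jump 0 - \<alpha>\<rfloor> < jump (n - 1) - \<alpha> + 1" using jump_wrap by linarith
      then have "\<lfloor>jump 0 - \<alpha>\<rfloor> < \<lceil>jump (n - 1) - \<alpha> + 1\<rceil>" by (simp only: less_ceiling_iff)
      then have "nu_below \<alpha> 0 \<le> nu n a \<alpha> (n - 1) + 1" by (simp add: nu_below_def nu_jump)
      then show ?thesis
        using cyc_Fil[of ?w "nu n a \<alpha>" r, OF wr r(1)] True Fil_mono by fastforce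
    next
      case False
      have "nu_below \<alpha> r \<le> nu_below \<alpha> (r - 1) + 1"
      proof -
        have "\<lfloor>jump r - \<alpha>\<rfloor> \<le> \<lfloor>jump (r - 1) - \<alpha> + 1\<rfloor>" using jump_step[of r] False r by (intro floor_mono) simp
        then show ?thesis by (simp add: nu_below_def)
      qed
      moreover have "tau * cyc n (mon (0, 1, 0)) ?w r \<in> Fil (- nu_below \<alpha> (r - 1) - 1)"
      proof -
        have "?w (r - 1) \<in> Fil (- nu_below \<alpha> (r - 1))" using w(2)[of "r - 1"] r False by simp
        then show ?thesis using False r tau_Fil by (simp add: cyc_def)
      qed
      ultimately show ?thesis using Fil_mono by fastforce
    qed
  qed
  then show ?case using 1 by simp
qed

lemma is_Vmod_Vmod: "is_Vmod Vmod"
  unfolding is_Vmod_def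
proof (intro conjI allI impI ballI)
  show "V0mod (Vmod \<alpha>)" for \<alpha> by (rule V0mod_Vmod)
  show "\<exists>S. finite S \<and> S \<subseteq> Vn n \<and> Vmod \<alpha> = V0mod hull S" for \<alpha> by (rule Vmod_hull)
  show "Vmod \<alpha> \<subseteq> Vmod \<beta>" if "\<alpha> \<le> \<beta>" for \<alpha> \<beta> by (rule Vmod_mono[OF that])
  show "(\<Union>\<alpha>. Vmod \<alpha>) = Vn n" by (rule Vmod_exhaustive)
  show "(\<lambda>v r. tau * v r) ` Vmod \<alpha> = Vmod (\<alpha> - 1)" for \<alpha> by (rule Vmod_tau)
  show "\<exists>A. finite A \<and> (\<forall>\<alpha> \<beta>. \<alpha> \<le> \<beta> \<and> (\<forall>c\<in>A. \<forall>k::int. c + of_int k \<notin> {\<alpha><..\<beta>}) \<longrightarrow> Vmod \<alpha> = Vmod \<beta>)"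
  proof (intro exI[of _ "jump ` {..<n}"] conjI allI impI)
    fix \<alpha> \<beta> assume *: "\<alpha> \<le> \<beta> \<and> (\<forall>c\<in>jump ` {..<n}. \<forall>k::int. c + of_int k \<notin> {\<alpha><..\<beta>})"
    have "nu n a \<alpha> r = nu n a \<beta> r" if r: "r < n" for r
    proof (rule ccontr)
      assume "nu n a \<alpha> r \<noteq> nu n a \<beta> r"
      moreover have "nu n a \<beta> r \<le> nu n a \<alpha> r" using * by (simp add: nu_jump ceiling_mono)
      ultimately have "\<lceil>jump r - \<beta>\<rceil> < \<lceil>jump r - \<alpha>\<rceil>" by (simp add: nu_jump)
      then have "real_of_int \<lceil>jump r - \<beta>\<rceil> < jump r - \<alpha>" by (simp only: less_ceiling_iff)
      moreover have "jump r - \<beta> \<le> real_of_int \<lceil>jump r - \<beta>\<rceil>" by (rule le_of_int_ceiling)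
      ultimately have "jump r + of_int (- \<lceil>jump r - \<beta>\<rceil>) \<in> {\<alpha><..\<beta>}"
        by (simp only: greaterThanAtMost_iff of_int_minus) linarith
      then show False using * r by blast
    qed
    then show "Vmod \<alpha> = Vmod \<beta>" by (simp add: bounded_by_def)
  qed simp
  show "v \<in> below Vmod \<alpha>" if "p \<in> C_z" "v \<in> Vmod \<alpha>" "p \<noteq> 0 \<and> (\<lambda>r. p * v r) \<in> below Vmod \<alpha>" for \<alpha> p v
    using that Fil_strict[of p] unfolding below_Vmod by (auto simp: bounded_by_def)
  show "\<exists>N. \<forall>v\<in>Vmod \<alpha>. (opN \<alpha> ^^ N) v \<in> below Vmod \<alpha>" for \<alpha>
    using opN_pow_Fil[of _ \<alpha> n] unfolding below_Vmod by (intro exI[of _ n]) (auto simp: bounded_by_def)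
qed

lemma V_filtration_eq: "V_filtration n a = (\<lambda>\<alpha>. T.fib ` Vmod \<alpha>)"
  unfolding V_filtration_def
proof (rule the_equality)
  have "Vmod \<alpha> \<subseteq> Vn n" for \<alpha> by (auto simp: bounded_by_def)
  then show "is_V_filtration n a (\<lambda>\<alpha>. T.fib ` Vmod \<alpha>)"
    using is_V_filtration_fib[of Vmod] is_Vmod_Vmod by blast
  fix V assume V: "is_V_filtration n a V"
  define W where "W = (\<lambda>\<alpha>. {v \<in> Vn n. T.fib v \<in> V \<alpha>})"
  have "V \<alpha> \<subseteq> T.fib ` Vn n" for \<alpha>
    using V by (simp add: is_V_filtration_def V0_submodule_def rescaled_model)
  then have VW: "V = (\<lambda>\<alpha>. T.fib ` W \<alpha>)" by (auto simp: W_def fun_eq_iff)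
  have "is_Vmod W"
    using V is_V_filtration_fib[of W] unfolding VW by (simp add: W_def)
  then have "W = Vmod" using Vmod_unique is_Vmod_Vmod by blast
  then show "V = (\<lambda>\<alpha>. T.fib ` Vmod \<alpha>)" using VW by simp
qed

end

section \<open>Specialization and restriction\<close>

lemma (in additive_fibres) finsum_quot_cong:
  assumes "finite I" and v: "\<And>i. i \<in> I \<Longrightarrow> v i \<in> Im" and f: "\<And>i. i \<in> I \<Longrightarrow> f i = fib (v i)"
  shows "finsum (quot_module M (fib 0)) f I = fib (\<Sum>i\<in>I. v i)"
proof -
  interpret Q: comm_monoid "add_monoid (quot_module M (fib 0))" by (rule comm_monoid_quot)
  have "finsum (quot_module M (fib 0)) f I = finsum (quot_module M (fib 0)) (\<lambda>i. fib (v i)) I"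
    unfolding finsum_def by (rule Q.finprod_cong') (auto simp: carrier_quot v f)
  then show ?thesis using finsum_quot[of I v, OF assms(1) v] by simp
qed

lemmas (in free_quotient) M_finsum_cong = finsum_quot_cong[unfolded fib_zero Im_eq]

lemma ev_z1_zdt: "ev_z1 (zdt h) = d_t (ev_z1 h)"
proof (induction h rule: poly_mapping_add_induct)
  case (single k c)
  then show ?case by (cases k) (simp add: zdt_single subst_single deriv_single)
qed (simp add: z_ops_add subst_add deriv_add)

lemma deriv_unit_vec: "zdt (unit_vec k s) = 0" "d_t (unit_vec k s) = 0"
proof -
  have "d_t (1 :: O_t) = 0" "d_t' (1 :: O_zt) = 0" by (metis cst_one deriv_cst)+
  then show "zdt (unit_vec k s) = 0" "d_t (unit_vec k s) = 0"
    by (simp_all add: unit_vec_def zdt_def deriv_diff)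
qed

lemma ev_z1_surj: "\<exists>h. ev_z1 h = f"
proof (induction f rule: poly_mapping_add_induct)
  case (single b c)
  then show ?case by (intro exI[of _ "sg (0, b) c"]) (simp add: subst_single)
next
  case (add f g)
  then show ?case by (metis subst_add(2))
qed

lemma division_z1:
  fixes f :: O_zt
  shows "\<exists>h g. f = (mon (1, 0) - 1) * h + g \<and> (\<forall>(x, b)\<in>kys g. x = 0)"
proof (induction f rule: poly_mapping_add_induct)
  case (single k c)
  obtain x b where k: "k = (x, b)" by (cases k)
  show ?case unfolding k
  proof (induction x)
    case 0
    show ?case by (intro exI[of _ 0] exI[of _ "sg (0, b) c"]) simp
  next
    case (Suc x)
    then obtain h g where hg: "sg (x, b) c = (mon (1, 0) - 1) * h + g" "\<forall>(x, b)\<in>kys g. x = 0" by blast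
    have "sg (Suc x, b) c = mon (1, 0) * sg (x, b) c" by (simp add: mult_single)
    then have "sg (Suc x, b) c = (mon (1, 0) - 1) * sg (x, b) c + sg (x, b) c" by (simp add: left_diff_distrib)
    also have "\<dots> = (mon (1, 0) - 1) * (sg (x, b) c + h) + g" using hg(1) by (simp add: distrib_left)
    finally show ?case using hg(2) by blast
  qed
next
  case (add f f')
  then obtain h g h' g' where *: "f = (mon (1, 0) - 1) * h + g" "\<forall>(x, b)\<in>kys g. x = 0"
    "f' = (mon (1, 0) - 1) * h' + g'" "\<forall>(x, b)\<in>kys g'. x = 0" by blast
  then have "f + f' = (mon (1, 0) - 1) * (h + h') + (g + g')" by (simp add: distrib_left)
  moreover have "\<forall>(x, b)\<in>kys (g + g'). x = 0" using *(2,4) Poly_Mapping.keys_add[of g g'] by blast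
  ultimately show ?case by blast
qed

lemma ev_z1_kernel: "ev_z1 f = 0 \<longleftrightarrow> (\<exists>h. f = (mon (1, 0) - 1) * h)"
proof
  assume f: "ev_z1 f = 0"
  obtain h g where hg: "f = (mon (1, 0) - 1) * h + g" "\<forall>(x, b)\<in>kys g. x = 0" using division_z1 by blast
  have "ev_z1 g = 0" using f by (simp add: hg(1) subst_add subst_mult subst_diff subst_single subst_one single_one)
  have "g = 0"
  proof (rule poly_mapping_eqI)
    fix k :: "nat \<times> int"
    obtain x b where k: "k = (x, b)" by (cases k)
    have "0 = lk (ev_z1 g) b" by (simp add: \<open>ev_z1 g = 0\<close>)
    also have "\<dots> = (\<Sum>k\<in>kys g. lk (sg (snd k) (lk g k)) b)"
      by (simp add: ev_z1_def lookup_sum case_prod_beta)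
    also have "\<dots> = (\<Sum>k\<in>kys g. if k = (0, b) then lk g (0, b) else 0)"
      using hg(2) by (intro sum.cong refl) (auto simp: lookup_single when_def)
    also have "\<dots> = lk g (0, b)" by (simp add: in_keys_iff)
    finally have 0: "lk g (0, b) = 0" by simp
    have "k \<in> kys g \<Longrightarrow> x = 0" using hg(2) by (auto simp: k dest!: bspec)
    then show "lk g k = lk 0 k" using 0 by (cases "x = 0") (auto simp: k in_keys_iff)
  qed
  then show "\<exists>h. f = (mon (1, 0) - 1) * h" using hg(1) by auto
next
  assume "\<exists>h. f = (mon (1, 0) - 1) * h"
  then show "ev_z1 f = 0" by (auto simp: subst_mult subst_diff subst_single subst_one single_one)
qed

lemma lookup_ev_\<tau>z:
  "lk (lk (ev_\<tau>z f) q) b = (\<Sum>(x, b', d)\<in>kys f. if int x - d = q \<and> b' = b then lk f (x, b', d) else 0)"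
proof -
  have "lk (lk (ev_\<tau>z f) q) b = (\<Sum>k\<in>kys f. lk (lk (case k of (x, b', d) \<Rightarrow> sg (int x - d) (sg b' (lk f k))) q) b)"
    unfolding ev_\<tau>z_def by (simp add: lookup_sum case_prod_beta)
  also have "\<dots> = (\<Sum>(x, b', d)\<in>kys f. if int x - d = q \<and> b' = b then lk f (x, b', d) else 0)"
    by (intro sum.cong refl) (auto simp: lookup_single when_def split: prod.split)
  finally show ?thesis .
qed

lemma ev_\<tau>z_bound:
  assumes "f \<in> Fil m" "q < - m"
  shows "lk (ev_\<tau>z f) q = 0"
proof (rule poly_mapping_eqI)
  fix b
  have "lk (lk (ev_\<tau>z f) q) b = 0"
    unfolding lookup_ev_\<tau>z using assms by (intro sum.neutral) (auto simp: Fil_def)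
  then show "lk (lk (ev_\<tau>z f) q) b = lk 0 b" by simp
qed

lemma ev_\<tau>z_lift:
  assumes "q \<ge> - m"
  shows "\<exists>f\<in>Fil m. ev_\<tau>z f = sg q g"
proof (induction g rule: poly_mapping_add_induct)
  case (single b c)
  have "ev_\<tau>z (sg (nat (q + m), b, m) c) = sg q (sg b c)" using assms by (simp add: subst_single)
  then show ?case by (intro bexI[of _ "sg (nat (q + m), b, m) c"] Fil_single) simp_all
next
  case (add g g')
  then obtain f f' where "f \<in> Fil m" "ev_\<tau>z f = sg q g" "f' \<in> Fil m" "ev_\<tau>z f' = sg q g'" by blast
  then show ?case by (intro bexI[of _ "f + f'"] Fil_add) (simp_all add: subst_add single_add)
qed

text \<open>Every factor \<open>\<tau>\<close> can be traded for a factor \<open>z\<close> modulo \<open>\<tau> - z\<close>, until the degree in \<open>\<theta>\<close> is exactly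
  \<open>m\<close>; on such functions the restriction to \<open>\<tau> = z\<close> is injective.\<close>

lemma division_\<tau>z:
  "f \<in> Fil m \<Longrightarrow> \<exists>g\<in>Fil m. \<exists>h. f = (tau - mon (1, 0, 0)) * g + h \<and> (\<forall>(x, b, d)\<in>kys h. d = m)"
proof -
  let ?P = "\<lambda>f. \<exists>g\<in>Fil m. \<exists>h. f = (tau - mon (1, 0, 0)) * g + h \<and> (\<forall>(x, b, d)\<in>kys h. d = m)"
  have add: "?P (f + f')" if "?P f" "?P f'" for f f'
  proof -
    from that obtain g h g' h' where *: "g \<in> Fil m" "f = (tau - mon (1, 0, 0)) * g + h" "\<forall>(x, b, d)\<in>kys h. d = m"
      "g' \<in> Fil m" "f' = (tau - mon (1, 0, 0)) * g' + h'" "\<forall>(x, b, d)\<in>kys h'. d = m" by blast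
    have "f + f' = (tau - mon (1, 0, 0)) * (g + g') + (h + h')" using *(2,5) by (simp add: distrib_left)
    moreover have "\<forall>(x, b, d)\<in>kys (h + h'). d = m" using *(3,6) Poly_Mapping.keys_add[of h h'] by blast
    ultimately show ?thesis using Fil_add[OF *(1,4)] by blast
  qed
  have sgl: "?P (sg (x, b, m - int k) c)" for x b k c
  proof (induction k arbitrary: x)
    case 0
    show ?case by (intro bexI[of _ 0] exI[of _ "sg (x, b, m) c"]) (auto simp: Fil_zero)
  next
    case (Suc k)
    have e: "(tau - mon (1, 0, 0)) * sg (x, b, m - int k) c + sg (Suc x, b, m - int k) c = sg (x, b, m - int (Suc k)) c"
    proof -
      have "m - int (Suc k) = - 1 + (m - int k)" by simp
      then show ?thesis by (simp only: left_diff_distrib mult_single) simp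
    qed
    have "?P ((tau - mon (1, 0, 0)) * sg (x, b, m - int k) c)"
      by (intro bexI[of _ "sg (x, b, m - int k) c"] exI[of _ 0]) (auto simp: Fil_single)
    from add[OF this Suc.IH[of "Suc x"]] show ?case unfolding e .
  qed
  assume f: "f \<in> Fil m"
  have e: "f = (\<Sum>k\<in>kys f. sg k (lk f k))"
    by (intro poly_mapping_eqI) (simp add: lookup_sum lookup_single when_def in_keys_iff)
  have "?P (\<Sum>k\<in>K. sg k (lk f k))" if "K \<subseteq> kys f" for K
    using finite_subset[OF that finite_keys] that
  proof (induction K rule: finite_induct)
    case empty
    show ?case by (intro bexI[of _ 0] exI[of _ 0]) (auto simp: Fil_zero)
  next
    case (insert k K)
    obtain x b d where k: "k = (x, b, d)" by (cases k)
    have "d \<le> m" using f insert.prems by (auto simp: Fil_def k)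
    then have "m - int (nat (m - d)) = d" by simp
    then have p1: "?P (sg k (lk f k))" using sgl[of x b "nat (m - d)" "lk f k"] by (simp only: k)
    have p2: "?P (\<Sum>k\<in>K. sg k (lk f k))" using insert by simp
    have s: "(\<Sum>k\<in>insert k K. sg k (lk f k)) = sg k (lk f k) + (\<Sum>k\<in>K. sg k (lk f k))"
      using insert.hyps by simp
    show ?case unfolding s by (rule add[OF p1 p2])
  qed
  from this[OF order_refl] show "?P f" unfolding e[symmetric] .
qed

lemma ev_\<tau>z_kernel:
  assumes f: "f \<in> Fil m"
  shows "ev_\<tau>z f = 0 \<longleftrightarrow> (\<exists>g\<in>Fil m. f = (tau - mon (1, 0, 0)) * g)"
proof
  have ev0: "ev_\<tau>z (tau - mon (1, 0, 0)) = 0" by (simp add: subst_diff subst_single)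
  assume ev: "ev_\<tau>z f = 0"
  obtain g h where gh: "g \<in> Fil m" "f = (tau - mon (1, 0, 0)) * g + h" "\<forall>(x, b, d)\<in>kys h. d = m"
    using division_\<tau>z[OF f] by blast
  have h0: "ev_\<tau>z h = 0" using ev unfolding gh(2) subst_add subst_mult ev0 by simp
  have "h = 0"
  proof (rule poly_mapping_eqI)
    fix k :: "nat \<times> int \<times> int"
    obtain x b d where k: "k = (x, b, d)" by (cases k)
    have "0 = lk (lk (ev_\<tau>z h) (int x - m)) b" by (simp add: h0)
    also have "\<dots> = (\<Sum>k\<in>kys h. if k = (x, b, m) then lk h (x, b, m) else 0)"
      unfolding lookup_ev_\<tau>z
    proof (intro sum.cong refl)
      fix l assume l: "l \<in> kys h"
      obtain x' b' d' where l': "l = (x', b', d')" by (cases l)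
      have "d' = m" using gh(3) l by (auto simp: l' dest!: bspec)
      then show "(case l of (x', b', d) \<Rightarrow> if int x' - d = int x - m \<and> b' = b then lk h (x', b', d) else 0)
          = (if l = (x, b, m) then lk h (x, b, m) else 0)" by (simp add: l')
    qed
    also have "\<dots> = lk h (x, b, m)" by (simp add: in_keys_iff)
    finally have 0: "lk h (x, b, m) = 0" by simp
    have "k \<in> kys h \<Longrightarrow> d = m" using gh(3) by (auto simp: k dest!: bspec)
    then show "lk h k = lk 0 k" using 0 by (cases "d = m") (auto simp: k in_keys_iff)
  qed
  then show "\<exists>g\<in>Fil m. f = (tau - mon (1, 0, 0)) * g" using gh by auto
next
  assume "\<exists>g\<in>Fil m. f = (tau - mon (1, 0, 0)) * g"
  then show "ev_\<tau>z f = 0" by (auto simp: subst_mult subst_diff subst_single)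
qed

lemma lookup_mult_constant: "lk (F * sg 0 g) p = lk F p * g" for F :: "int \<Rightarrow>\<^sub>0 O_t"
  by (induction F rule: poly_mapping_add_induct)
     (simp_all add: mult_single lookup_single when_def distrib_right lookup_add)

lemma lookup_of_int_mult: "lk (of_int c * F) p = of_int c * lk F p" for F :: "int \<Rightarrow>\<^sub>0 O_t"
proof -
  have "lk (F * sg 0 (of_int c)) p = lk F p * of_int c" by (rule lookup_mult_constant)
  then show ?thesis by (simp add: mult.commute)
qed

context hypergeometric
begin

definition spec :: "(O_zt \<Rightarrow> O_zt) set \<Rightarrow> (O_t \<Rightarrow> O_t) set"
  where "spec = restrict (\<lambda>C. H.fib (\<lambda>r. ev_z1 (hat_coord C r))) (carrier (Hhat n a))"

lemma ev_Vn: "v \<in> Vn n \<Longrightarrow> (\<lambda>r. ev_z1 (v r)) \<in> Vn n"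
  by (simp add: Vn_def subst_diff)

lemma spec_fib: "v \<in> Vn n \<Longrightarrow> spec (Hh.fib v) = H.fib (\<lambda>r. ev_z1 (v r))"
  by (simp add: spec_def Hhat_model hat_coord)

lemma ev_conn: "ev_z1 (conn_t v r) = conn (\<lambda>r. ev_z1 (v r)) r"
proof -
  have "ev_z1 (cyc n (mon (0, 1)) v r) = cyc n (mon 1) (\<lambda>r. ev_z1 (v r)) r"
    by (simp add: cyc_def subst_mult subst_single subst_diff)
  then show ?thesis
    by (simp add: conn_t_def conn_def subst_add subst_mult subst_single ev_z1_zdt subst_cst single_one)
qed

lemma fib_eq_zero: "v \<in> Vn n \<Longrightarrow> H.fib v = H.fib 0 \<longleftrightarrow> (\<forall>r. v r = 0)"
  using H.M_inj[of v 0] by (auto simp: fun_eq_iff)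

lemma class_id:
  "Hhat_ideal n a +>\<^bsub>R_int\<^esub> id = Hh.fib (unit_vec 0)" "hypH_class n a id = H.fib (unit_vec 0)"
  using class_Hhat[of 0] class_H[of 0] n by (simp_all add: Qh_def Q_def)

lemma ev_unit_vec: "(\<lambda>r. ev_z1 (unit_vec k r)) = unit_vec k"
  by (auto simp: unit_vec_def subst_one subst_diff fun_eq_iff)

lemma is_specialization_spec: "is_specialization n a spec"
  unfolding is_specialization_def
proof (intro conjI ballI allI)
  show "spec \<in> carrier (Hhat n a) \<rightarrow>\<^sub>E carrier (hypH n a)"
    by (auto simp: spec_def Hhat_model hypH_model hat_coord ev_Vn)
  show "spec (Hhat_ideal n a +>\<^bsub>R_int\<^esub> id) = hypH_class n a id"
    using n by (simp add: class_id spec_fib unit_vec_Vn ev_unit_vec)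
  fix m assume "m \<in> carrier (Hhat n a)"
  then obtain v where v: "v \<in> Vn n" "m = Hh.fib v" by (auto simp: Hhat_model)
  show "spec (f \<odot>\<^bsub>Hhat_O n a\<^esub> m) = ev_z1 f \<odot>\<^bsub>hypH_O n a\<^esub> spec m" for f
    by (simp add: v Hhat_smult spec_fib Vn_scale hypH_smult ev_Vn subst_mult)
  show "spec (zdt \<odot>\<^bsub>Hhat n a\<^esub> m) = d_t \<odot>\<^bsub>hypH n a\<^esub> spec m"
    by (simp add: v Hhat_smult spec_fib conn_Vn hypH_smult ev_Vn ev_conn)
  fix m' assume "m' \<in> carrier (Hhat n a)"
  then obtain w where w: "w \<in> Vn n" "m' = Hh.fib w" by (auto simp: Hhat_model)
  have "(\<lambda>r. ev_z1 (v r)) + (\<lambda>r. ev_z1 (w r)) = (\<lambda>r. ev_z1 ((v + w) r))"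
    by (simp add: fun_eq_iff subst_add)
  then show "spec (m \<oplus>\<^bsub>Hhat n a\<^esub> m') = spec m \<oplus>\<^bsub>hypH n a\<^esub> spec m'"
    by (simp only: v w Hhat_model(2) spec_fib Vn_closed hypH_model(2) ev_Vn)
next
  have "H.fib w \<in> spec ` carrier (Hhat n a)" if w: "w \<in> Vn n" for w
  proof -
    have "\<forall>r. \<exists>h. ev_z1 h = w r" using ev_z1_surj by blast
    from choice[OF this] obtain h where h: "\<And>r. ev_z1 (h r) = w r" by blast
    define v where "v = (\<lambda>r. if r < n then h r else 0)"
    have "v \<in> Vn n" "(\<lambda>r. ev_z1 (v r)) = w" using w h by (auto simp: v_def Vn_def subst_diff fun_eq_iff)
    then show ?thesis using spec_fib[of v] by (auto simp: Hhat_model)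
  qed
  then show "spec ` carrier (Hhat n a) = carrier (hypH n a)"
    by (auto simp: Hhat_model hypH_model spec_fib ev_Vn)
  show "{m \<in> carrier (Hhat n a). spec m = \<zero>\<^bsub>hypH n a\<^esub>}
      = module.smult (Hhat_O n a) (mon (1, 0) - 1) ` carrier (Hhat n a)" (is "?l = ?r")
  proof
    show "?l \<subseteq> ?r"
    proof
      fix m assume "m \<in> ?l"
      then obtain v where v: "v \<in> Vn n" "m = Hh.fib v" "H.fib (\<lambda>r. ev_z1 (v r)) = H.fib 0"
        by (auto simp: Hhat_model hypH_model spec_fib)
      then have "\<exists>h. v r = (mon (1, 0) - 1) * h" for r
        using fib_eq_zero[OF ev_Vn] ev_z1_kernel by blast
      then obtain h where h: "\<And>r. v r = (mon (1, 0) - 1) * h r" by metis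
      define w where "w = (\<lambda>r. if r < n then h r else 0)"
      have "w \<in> Vn n" "(\<lambda>r. (mon (1, 0) - 1) * w r) = v" using v(1) h by (auto simp: w_def Vn_def fun_eq_iff)
      then show "m \<in> ?r" using Hhat_smult(1)[of w "mon (1, 0) - 1"] by (auto simp: v(2) Hhat_model)
    qed
    show "?r \<subseteq> ?l"
    proof
      fix m assume "m \<in> ?r"
      then obtain v where v: "v \<in> Vn n" "m = Hh.fib (\<lambda>r. (mon (1, 0) - 1) * v r)"
        by (auto simp: Hhat_model Hhat_smult)
      have "(\<lambda>r. ev_z1 ((mon (1, 0) - 1) * v r)) = 0" using ev_z1_kernel by (simp only: fun_eq_iff) auto
      then have "spec m = H.fib 0" unfolding v(2) spec_fib[OF Vn_scale[OF v(1)]] by (rule arg_cong)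
      then show "m \<in> ?l" using Vn_scale[OF v(1)] by (simp only: v(2) Hhat_model hypH_model mem_Collect_eq) blast
    qed
  qed
qed

text \<open>\<open>Q\<^sub>k\<^sub>+\<^sub>1\<close> is obtained from \<open>Q\<^sub>k\<close> by \<open>zt\<partial>\<^sub>t\<close> and multiplication by functions, so the compatibilities determine
  \<open>\<sigma>\<close> on the basis, starting from the class of 1.\<close>

lemma specialization_unique:
  assumes \<sigma>: "is_specialization n a \<sigma>" and v: "v \<in> Vn n"
  shows "\<sigma> (Hh.fib v) = H.fib (\<lambda>r. ev_z1 (v r))"
proof -
  note S = \<sigma>[unfolded is_specialization_def]
  note S_add = S[THEN conjunct2, THEN conjunct2, THEN conjunct1, rule_format]
  note S_smult = S[THEN conjunct2, THEN conjunct2, THEN conjunct2, THEN conjunct1, rule_format]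
  note S_zdt = S[THEN conjunct2, THEN conjunct2, THEN conjunct2, THEN conjunct2, THEN conjunct1, rule_format]
  have mem: "Hh.fib v \<in> carrier (Hhat n a)" if "v \<in> Vn n" for v
    using that by (simp add: Hhat_model)
  have add: "\<sigma> (Hh.fib (v + w)) = \<sigma> (Hh.fib v) \<oplus>\<^bsub>hypH n a\<^esub> \<sigma> (Hh.fib w)" if "v \<in> Vn n" "w \<in> Vn n" for v w
    using S_add[OF mem[OF that(1)] mem[OF that(2)]] unfolding Hhat_model(2)[OF that] .
  have smult: "\<sigma> (Hh.fib (\<lambda>r. f * v r)) = ev_z1 f \<odot>\<^bsub>hypH_O n a\<^esub> \<sigma> (Hh.fib v)" if "v \<in> Vn n" for f v
    using S_smult[OF mem[OF that], of f] unfolding Hhat_smult(1)[OF that] .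
  have zdt: "\<sigma> (Hh.fib (conn_t v)) = d_t \<odot>\<^bsub>hypH n a\<^esub> \<sigma> (Hh.fib v)" if "v \<in> Vn n" for v
    using S_zdt[OF mem[OF that]] unfolding Hhat_smult(2)[OF that] .
  have unit: "\<sigma> (Hh.fib (unit_vec k)) = H.fib (unit_vec k)" if "k < n" for k
    using that
  proof (induction k)
    case 0
    then show ?case using \<sigma> by (simp add: is_specialization_def class_id)
  next
    case (Suc k)
    define c :: complex where "c = of_real (a (Suc k))"
    have k: "unit_vec k \<in> Vn n" "unit_vec k \<in> Vn n" using Suc.prems by (simp_all add: unit_vec_Vn)
    have cyc: "cyc n T (unit_vec k) s = unit_vec (Suc k) s" for T :: "'b::comm_ring_1" and s
      using Suc.prems by (auto simp: cyc_def unit_vec_def)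
    have 1: "conn_t (unit_vec k) = (\<lambda>s. mon (0, -1) * (cst c * mon (1, 0) * unit_vec k s + unit_vec (Suc k) s))"
      unfolding conn_t_def cyc c_def
      by (rule ext) (simp only: deriv_unit_vec, simp add: unit_vec_def)
    have 2: "conn (unit_vec k) = (\<lambda>s. mon (-1) * (cst c * unit_vec k s + unit_vec (Suc k) s))"
      unfolding conn_def cyc c_def
      by (rule ext) (simp only: deriv_unit_vec, simp add: unit_vec_def)
    have t: "mon (0, 1) * (mon (0, -1) * f) = f" "mon 1 * (mon (-1) * g) = g" for f :: O_zt and g :: O_t
      using tinv(1)[of g] tinv(2)[of f] by (simp_all add: mult.left_commute)
    have e: "unit_vec (Suc k) = (\<lambda>s. mon (0, 1) * conn_t (unit_vec k) s) + (\<lambda>s. - (cst c * mon (1, 0)) * unit_vec k s)"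
      unfolding 1 t by (simp add: fun_eq_iff)
    have e': "unit_vec (Suc k) = (\<lambda>s. mon 1 * conn (unit_vec k) s) + (\<lambda>s. - cst c * unit_vec k s)"
      unfolding 2 t by (simp add: fun_eq_iff)
    have IH: "\<sigma> (Hh.fib (unit_vec k)) = H.fib (unit_vec k)" using Suc by simp
    have ev: "ev_z1 (- (cst c * mon (1, 0))) = - cst c" "ev_z1 (mon (0, 1)) = mon 1"
      by (simp_all add: subst_diff subst_mult subst_cst subst_single single_one)
    show ?case
      unfolding e add[OF Vn_scale[OF conn_Vn(2)[OF k(1)]] Vn_scale[OF k(1)]]
        smult[OF k(1)] smult[OF conn_Vn(2)[OF k(1)]] zdt[OF k(1)] IH
        hypH_smult(2)[OF k(2)] hypH_smult(1)[OF k(2)] hypH_smult(1)[OF conn_Vn(1)[OF k(2)]]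
        hypH_model(2)[OF Vn_scale[OF conn_Vn(1)[OF k(2)]] Vn_scale[OF k(2)]] ev
      unfolding e' ..
  qed
  have "\<sigma> (Hh.fib (\<lambda>r. if r < k then v r else 0)) = H.fib (\<lambda>r. ev_z1 (if r < k then v r else 0))" if "k \<le> n" for k
    using that
  proof (induction k)
    case 0
    have z: "(\<lambda>r. 0 * v r) = (\<lambda>r. 0)" "(\<lambda>r. 0 * unit_vec 0 r) = (\<lambda>r. 0 :: O_t)" by simp_all
    have "\<sigma> (Hh.fib (\<lambda>r. 0 * unit_vec 0 r)) = H.fib (\<lambda>r. 0 * unit_vec 0 r)"
      using n by (subst smult) (simp_all add: unit_vec_Vn unit subst_diff hypH_smult)
    then show ?case by (simp add: subst_diff)
  next
    case (Suc k)
    let ?t = "\<lambda>k r. if r < k then v r else 0"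
    have k: "k < n" using Suc.prems by simp
    have t: "?t k \<in> Vn n" using v by (simp add: Vn_def)
    have e: "?t (Suc k) = ?t k + (\<lambda>r. v k * unit_vec k r)"
      by (auto simp: fun_eq_iff unit_vec_def less_Suc_eq)
    have e': "(\<lambda>r. ev_z1 (?t (Suc k) r)) = (\<lambda>r. ev_z1 (?t k r)) + (\<lambda>r. ev_z1 (v k) * unit_vec k r)"
      by (auto simp: fun_eq_iff unit_vec_def less_Suc_eq subst_diff)
    have IH: "\<sigma> (Hh.fib (?t k)) = H.fib (\<lambda>r. ev_z1 (?t k r))" using Suc by simp
    show ?case
      unfolding e' unfolding e add[OF t Vn_scale[OF unit_vec_Vn[OF k]]] smult[OF unit_vec_Vn[OF k]] unit[OF k] IH
        hypH_smult(1)[OF unit_vec_Vn[OF k]] hypH_model(2)[OF ev_Vn[OF t] Vn_scale[OF unit_vec_Vn[OF k]]] ..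
  qed
  from this[of n] have "\<sigma> (Hh.fib (\<lambda>r. if r < n then v r else 0)) = H.fib (\<lambda>r. ev_z1 (if r < n then v r else 0))" by simp
  moreover have "(\<lambda>r. if r < n then v r else 0) = v" using v by (auto simp: Vn_def)
  ultimately show ?thesis by metis
qed

lemma specialization_eq: "specialization n a = spec"
  unfolding specialization_def
proof (rule the_equality)
  show "is_specialization n a spec" by (rule is_specialization_spec)
  fix \<sigma> assume \<sigma>: "is_specialization n a \<sigma>"
  have ext: "\<sigma> \<in> carrier (Hhat n a) \<rightarrow>\<^sub>E carrier (hypH n a)" "spec \<in> carrier (Hhat n a) \<rightarrow>\<^sub>E carrier (hypH n a)"
    using \<sigma> is_specialization_spec by (simp_all add: is_specialization_def)
  show "\<sigma> = spec"
  proof (rule PiE_ext[OF ext])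
    fix m assume "m \<in> carrier (Hhat n a)"
    then show "\<sigma> m = spec m" using specialization_unique[OF \<sigma>] by (auto simp: Hhat_model spec_fib)
  qed
qed

lemma restrict_fib:
  assumes x: "x \<in> carrier TF"
  shows "restrict_\<tau>z n a x p = H.fib (\<lambda>r. lk (ev_\<tau>z (tcoord x r)) p)"
proof -
  define w where "w = (\<lambda>k r. (of_int (lk x k) * lk (ev_\<tau>z (fst k)) p) * ev_z1 (hat_coord (snd k) r))"
  have k: "w k \<in> Vn n \<and> (of_int (lk x k) * lk (ev_\<tau>z (fst k)) p) \<odot>\<^bsub>hypH_O n a\<^esub> specialization n a (snd k) = H.fib (w k)"
    if "k \<in> kys x" for k
  proof -
    from x that obtain v where v: "v \<in> Vn n" "snd k = Hh.fib v" by (force simp: TF_simps)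
    have "(\<lambda>r. ev_z1 (hat_coord (snd k) r)) \<in> Vn n" using v by (simp add: hat_coord ev_Vn)
    from Vn_scale[OF this] have 1: "w k \<in> Vn n" by (simp add: w_def)
    show ?thesis using 1 v by (simp add: specialization_eq spec_fib hypH_smult ev_Vn w_def hat_coord)
  qed
  have "restrict_\<tau>z n a x p = finsum H.M (\<lambda>k. (of_int (lk x k) * lk (ev_\<tau>z (fst k)) p) \<odot>\<^bsub>hypH_O n a\<^esub> specialization n a (snd k)) (kys x)"
    unfolding restrict_\<tau>z_def by (simp add: hypH_O_def finsum_restrict_scalars hypH_eq)
  also have "\<dots> = H.fib (\<Sum>k\<in>kys x. w k)"
    by (rule H.M_finsum_cong) (simp_all add: k)
  also have "(\<Sum>k\<in>kys x. w k) = (\<lambda>r. lk (ev_\<tau>z (tcoord x r)) p)"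
  proof
    fix r
    have app: "(\<Sum>k\<in>K. F k) r = (\<Sum>k\<in>K. F k r)" for K and F :: "_ \<Rightarrow> nat \<Rightarrow> 'z::comm_monoid_add"
      by (induction K rule: infinite_finite_induct) simp_all
    have o: "ev_\<tau>z (of_int c * h) = of_int c * ev_\<tau>z h" for c h
    proof -
      have "ev_\<tau>z (of_int c) = sg 0 (sg 0 (of_int c))" using subst_cst(3)[of "of_int c"] by (simp only: single_of_int)
      then show ?thesis by (simp add: subst_mult)
    qed
    have "lk (ev_\<tau>z (tcoord x r)) p = (\<Sum>k\<in>kys x. lk (ev_\<tau>z (of_int (lk x k) * (fst k * mu_pull (hat_coord (snd k) r)))) p)"
      unfolding tcoord_def frag_sum_def app additive_sum[of ev_\<tau>z, OF subst_add(3)] lookup_sum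
      by (simp add: case_prod_beta)
    also have "\<dots> = (\<Sum>k\<in>kys x. w k r)"
      by (intro sum.cong refl) (simp only: o, simp add: subst_mult ev_mu lookup_of_int_mult lookup_mult_constant w_def mult.assoc)
    finally show "(\<Sum>k\<in>kys x. w k) r = lk (ev_\<tau>z (tcoord x r)) p" by (simp only: app)
  qed
  finally show ?thesis .
qed

end

section \<open>The irregular Hodge filtration\<close>

text \<open>Elimination without division: a vector with nonzero entry at \<open>r0\<close> serves to clear that entry in the
  other vectors, after cross-multiplication.\<close>

lemma linear_dependence:
  fixes w :: "'s \<Rightarrow> 'j \<Rightarrow> 'b::idom"
  assumes "finite J" "finite S" "card S > card J"
  shows "\<exists>c. (\<exists>s\<in>S. c s \<noteq> 0) \<and> (\<forall>r\<in>J. (\<Sum>s\<in>S. c s * w s r) = 0)"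
  using assms
proof (induction J arbitrary: S w rule: finite_induct)
  case empty
  then have "S \<noteq> {}" by auto
  then show ?case by (intro exI[of _ "\<lambda>_. 1"]) auto
next
  case (insert r0 J)
  show ?case
  proof (cases "\<forall>s\<in>S. w s r0 = 0")
    case True
    have "card S > card J" using insert by simp
    then obtain c where "\<exists>s\<in>S. c s \<noteq> 0" "\<forall>r\<in>J. (\<Sum>s\<in>S. c s * w s r) = 0"
      using insert.IH[OF insert.prems(1)] by blast
    then show ?thesis using True by (intro exI[of _ c]) simp
  next
    case False
    then obtain s0 where s0: "s0 \<in> S" "w s0 r0 \<noteq> 0" by blast
    define S' where "S' = S - {s0}"
    have S': "finite S'" "card S' > card J" "s0 \<notin> S'" "S = insert s0 S'"
      using insert s0 by (auto simp: S'_def)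
    obtain c where c: "\<exists>s\<in>S'. c s \<noteq> 0"
      "\<forall>r\<in>J. (\<Sum>s\<in>S'. c s * (w s0 r0 * w s r - w s r0 * w s0 r)) = 0"
      using insert.IH[OF S'(1,2), of "\<lambda>s r. w s0 r0 * w s r - w s r0 * w s0 r"] by blast
    \<comment> \<open>the coefficient of \<open>s0\<close> is chosen to cancel the entry at \<open>r0\<close>\<close>
    define d where "d = (\<lambda>s. if s = s0 then - (\<Sum>s\<in>S'. c s * w s r0) else c s * w s0 r0)"
    have sum: "(\<Sum>s\<in>S. d s * w s r) = (\<Sum>s\<in>S'. c s * (w s0 r0 * w s r - w s r0 * w s0 r))" for r
    proof -
      have "(\<Sum>s\<in>S'. d s * w s r) = (\<Sum>s\<in>S'. c s * w s0 r0 * w s r)"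
        using S'(3) by (intro sum.cong) (auto simp: d_def)
      then have "(\<Sum>s\<in>S. d s * w s r) = (\<Sum>s\<in>S'. c s * w s0 r0 * w s r) - (\<Sum>s\<in>S'. c s * w s r0) * w s0 r"
        using S' by (simp add: d_def)
      then show ?thesis by (simp add: sum_distrib_right sum_subtractf right_diff_distrib mult.assoc)
    qed
    have "(\<Sum>s\<in>S. d s * w s r0) = 0" unfolding sum by (simp add: mult.commute)
    moreover have "\<exists>s\<in>S. d s \<noteq> 0" using c(1) s0 S'(3,4) by (auto simp: d_def)
    ultimately show ?thesis using c(2) by (intro exI[of _ d]) (simp add: sum)
  qed
qed

context hypergeometric
begin

text \<open>Coordinates of the step \<open>x\<close> of the irregular Hodge filtration.\<close>

definition Fv :: "real \<Rightarrow> (nat \<Rightarrow> O_t) set"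
  where "Fv x = {v \<in> Vn n. \<forall>r<n. v r \<noteq> 0 \<longrightarrow> jump r \<le> x}"

lemma Fv_Vn: "Fv x \<subseteq> Vn n"
  by (auto simp: Fv_def)

lemma restrict_Vn: "v \<in> Vn n \<Longrightarrow> (\<lambda>r. lk (ev_\<tau>z (v r)) p) \<in> Vn n"
  by (simp add: Vn_def subst_diff)

lemma restriction_kernel:
  "{C \<in> T.fib ` Vmod \<alpha>. \<forall>x\<in>C. \<forall>p. restrict_\<tau>z n a x p = \<zero>\<^bsub>hypH n a\<^esub>}
    = module.smult (rescaled n a) (tau - mon (1, 0, 0)) ` T.fib ` Vmod \<alpha>" (is "?l = ?r")
proof
  have V: "v \<in> Vn n" if "v \<in> Vmod \<alpha>" for v using that by (simp add: bounded_by_def)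
  show "?l \<subseteq> ?r"
  proof
    fix C assume C: "C \<in> ?l"
    then obtain v where v: "v \<in> Vmod \<alpha>" "C = T.fib v" by blast
    have "v \<in> T.Im" unfolding T_Im by (rule V[OF v(1)])
    then obtain x where x: "x \<in> carrier TF" "tcoord x = v" by blast
    then have "x \<in> C" by (simp add: v(2) T.fib_def)
    then have "H.fib (\<lambda>r. lk (ev_\<tau>z (v r)) p) = H.fib 0" for p
      using C restrict_fib[OF x(1), of p] x(2) by (simp add: hypH_model)
    then have "lk (ev_\<tau>z (v r)) p = 0" for r p
      using fib_eq_zero[OF restrict_Vn[OF V[OF v(1)]]] by blast
    then have ev: "ev_\<tau>z (v r) = 0" for r by (intro poly_mapping_eqI) simp
    have "\<forall>r. \<exists>g. r < n \<longrightarrow> g \<in> Fil (- nu n a \<alpha> r) \<and> v r = (tau - mon (1, 0, 0)) * g"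
      using ev_\<tau>z_kernel ev v(1) unfolding bounded_by_def by blast
    from choice[OF this] obtain g where g: "\<And>r. r < n \<Longrightarrow> g r \<in> Fil (- nu n a \<alpha> r) \<and> v r = (tau - mon (1, 0, 0)) * g r"
      by blast
    define w where "w = (\<lambda>r. if r < n then g r else 0)"
    have w: "w \<in> Vmod \<alpha>" using g by (simp add: bounded_by_def w_def Vn_def)
    have "(\<lambda>r. (tau - mon (1, 0, 0)) * w r) = v"
      using g V[OF v(1)] by (auto simp: w_def Vn_def fun_eq_iff)
    then have "C = (tau - mon (1, 0, 0)) \<odot>\<^bsub>rescaled n a\<^esub> T.fib w"
      using rescaled_smult[OF V[OF w]] v(2) by simp
    then show "C \<in> ?r" using w by blast
  qed
  show "?r \<subseteq> ?l"
  proof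
    fix C assume "C \<in> ?r"
    then obtain w where w: "w \<in> Vmod \<alpha>" "C = (tau - mon (1, 0, 0)) \<odot>\<^bsub>rescaled n a\<^esub> T.fib w" by blast
    define v where "v = (\<lambda>r. (tau - mon (1, 0, 0)) * w r)"
    have C: "C = T.fib v" using w rescaled_smult[OF V] by (simp add: v_def)
    have t: "tau - mon (1, 0, 0) \<in> Fil 0" by (intro Fil_diff Fil_single) simp_all
    have "v \<in> Vmod \<alpha>" unfolding v_def bounded_by_def
      using w(1) Vn_scale[OF V[OF w(1)]] Fil_mult0[OF t] by (simp add: bounded_by_def)
    moreover have "restrict_\<tau>z n a x p = \<zero>\<^bsub>hypH n a\<^esub>" if "x \<in> C" for x p
    proof -
      have x: "x \<in> carrier TF" "tcoord x = v" using that by (simp_all add: C T.fib_def)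
      have "ev_\<tau>z (v r) = 0" for r by (simp add: v_def subst_mult subst_diff subst_single)
      then have "(\<lambda>r. lk (ev_\<tau>z (tcoord x r)) p) = 0" by (simp add: x(2) fun_eq_iff)
      then show ?thesis unfolding restrict_fib[OF x(1)] hypH_model by (rule arg_cong)
    qed
    ultimately show "C \<in> ?l" using C by blast
  qed
qed

text \<open>The coefficient of \<open>z\<^sup>p\<close> in the restriction of an element of \<open>Vmod \<alpha>\<close> has nonzero coordinates only where
  \<open>\<nu>\<^sub>\<alpha>(r) \<le> p\<close>, which means \<open>jump r \<le> \<alpha> + p\<close>. Conversely each such coefficient is the restriction of a
  multiple of \<open>\<tau>\<close> to the power \<open>\<nu>\<^sub>\<alpha>(r)\<close> (\<open>ev_\<tau>z_lift\<close>).\<close>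

lemma restriction_image:
  "restrict_\<tau>z n a ` \<Union>(T.fib ` Vmod \<alpha>)
    = {h. (\<forall>p. h p \<in> H.fib ` Fv (\<alpha> + of_int p)) \<and> finite {p. h p \<noteq> \<zero>\<^bsub>hypH n a\<^esub>}}" (is "?l = ?r")
proof
  have V: "v \<in> Vn n" if "v \<in> Vmod \<alpha>" for v using that by (simp add: bounded_by_def)
  show "?l \<subseteq> ?r"
  proof
    fix h assume "h \<in> ?l"
    then obtain v x where v: "v \<in> Vmod \<alpha>" "x \<in> T.fib v" "h = restrict_\<tau>z n a x" by blast
    then have x: "x \<in> carrier TF" "tcoord x = v" by (simp_all add: T.fib_def)
    have h: "h p = H.fib (\<lambda>r. lk (ev_\<tau>z (v r)) p)" for p
      by (simp add: v(3) restrict_fib[OF x(1)] x(2))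
    have "(\<lambda>r. lk (ev_\<tau>z (v r)) p) \<in> Fv (\<alpha> + of_int p)" for p
    proof -
      have "jump r \<le> \<alpha> + of_int p" if r: "r < n" "lk (ev_\<tau>z (v r)) p \<noteq> 0" for r
      proof -
        have "v r \<in> Fil (- nu n a \<alpha> r)" using v(1) r by (simp add: bounded_by_def)
        then have "\<not> p < nu n a \<alpha> r" using ev_\<tau>z_bound[of "v r" "- nu n a \<alpha> r" p] r(2) by auto
        then have "\<lceil>jump r - \<alpha>\<rceil> \<le> p" by (simp add: nu_jump)
        then show ?thesis by (simp add: ceiling_le_iff)
      qed
      then show ?thesis using restrict_Vn[OF V[OF v(1)]] by (simp add: Fv_def)
    qed
    moreover have "finite {p. h p \<noteq> \<zero>\<^bsub>hypH n a\<^esub>}"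
    proof (rule finite_subset)
      show "{p. h p \<noteq> \<zero>\<^bsub>hypH n a\<^esub>} \<subseteq> (\<Union>r<n. kys (ev_\<tau>z (v r)))"
      proof
        fix p assume "p \<in> {p. h p \<noteq> \<zero>\<^bsub>hypH n a\<^esub>}"
        then obtain r where r: "lk (ev_\<tau>z (v r)) p \<noteq> 0"
          using fib_eq_zero[OF restrict_Vn[OF V[OF v(1)]], of p] by (auto simp: h hypH_model)
        then have "r < n" using V[OF v(1)] by (cases "r < n") (simp_all add: Vn_def subst_diff)
        then show "p \<in> (\<Union>r<n. kys (ev_\<tau>z (v r)))" using r by (auto simp: in_keys_iff)
      qed
    qed simp
    ultimately show "h \<in> ?r" by (auto simp: h)
  qed
  show "?r \<subseteq> ?l"
  proof
    fix h assume h: "h \<in> ?r"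
    then have "\<forall>p. \<exists>w. w \<in> Fv (\<alpha> + of_int p) \<and> h p = H.fib w" by blast
    from choice[OF this] obtain w where w: "\<And>p. w p \<in> Fv (\<alpha> + of_int p)" "\<And>p. h p = H.fib (w p)" by blast
    define P where "P = {p. h p \<noteq> \<zero>\<^bsub>hypH n a\<^esub>}"
    have P: "finite P" using h by (simp add: P_def)
    have "\<exists>f. f \<in> Fil (- nu n a \<alpha> r) \<and> ev_\<tau>z f = sg p (w p r)" if r: "r < n" for r p
    proof (cases "w p r = 0")
      case True
      then show ?thesis by (intro exI[of _ 0]) (simp add: Fil_zero subst_diff)
    next
      case False
      then have "jump r \<le> \<alpha> + of_int p" using w(1)[of p] r by (simp add: Fv_def)
      then have "nu n a \<alpha> r \<le> p" by (simp add: nu_jump ceiling_le_iff)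
      then show ?thesis using ev_\<tau>z_lift[of "- nu n a \<alpha> r" p "w p r"] by auto
    qed
    then have "\<forall>k. \<exists>f. fst k < n \<longrightarrow> f \<in> Fil (- nu n a \<alpha> (fst k)) \<and> ev_\<tau>z f = sg (snd k) (w (snd k) (fst k))"
      by blast
    from choice[OF this] obtain f where f: "\<And>r p. r < n \<Longrightarrow> f (r, p) \<in> Fil (- nu n a \<alpha> r)"
      "\<And>r p. r < n \<Longrightarrow> ev_\<tau>z (f (r, p)) = sg p (w p r)" by fastforce
    define v where "v = (\<lambda>r. if r < n then \<Sum>p\<in>P. f (r, p) else 0)"
    have v: "v \<in> Vmod \<alpha>" using f(1) by (simp add: bounded_by_def v_def Vn_def Fil_sum)
    have "v \<in> T.Im" unfolding T_Im by (rule V[OF v])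
    then obtain x where x: "x \<in> carrier TF" "tcoord x = v" by blast
    have "restrict_\<tau>z n a x p = h p" for p
    proof -
      have ev: "lk (ev_\<tau>z (v r)) p = (if p \<in> P then w p r else 0)" for r
      proof (cases "r < n")
        case True
        have "lk (ev_\<tau>z (v r)) p = (\<Sum>q\<in>P. lk (sg q (w q r)) p)"
          using True f(2) by (simp add: v_def additive_sum[of ev_\<tau>z, OF subst_add(3)] lookup_sum)
        also have "\<dots> = (\<Sum>q\<in>P. if q = p then w p r else 0)"
          by (intro sum.cong refl) (simp add: lookup_single when_def)
        finally show ?thesis using P by simp
      next
        case False
        have "w p r = 0" using w(1)[of p] False by (simp add: Fv_def Vn_def)
        then show ?thesis using False by (simp add: v_def subst_diff)
      qed
      show ?thesis
      proof (cases "p \<in> P")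
        case True
        then show ?thesis by (simp add: restrict_fib[OF x(1)] x(2) ev w(2))
      next
        case False
        then have "(\<lambda>r. lk (ev_\<tau>z (tcoord x r)) p) = 0" by (simp add: x(2) ev fun_eq_iff)
        then have "restrict_\<tau>z n a x p = H.fib 0" unfolding restrict_fib[OF x(1)] by (rule arg_cong)
        then show ?thesis using False by (simp add: P_def hypH_model)
      qed
    qed
    then have "h = restrict_\<tau>z n a x" by (simp add: fun_eq_iff)
    moreover have "x \<in> T.fib v" using x by (simp add: T.fib_def)
    ultimately show "h \<in> ?l" using v by blast
  qed
qed

text \<open>A family \<open>F\<close> with the defining property is recovered from the images of the steps of the
  V-filtration by taking coefficients of \<open>z\<^sup>0\<close>, since any element of \<open>F \<alpha>\<close> occurs as the only nonzero
  coefficient of some element of the image.\<close>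

lemma F_irr_eq: "F_irr n a = (\<lambda>x. H.fib ` Fv x)"
  unfolding F_irr_def
proof (rule the_equality)
  show "is_irr_Hodge_filtration n a (\<lambda>x. H.fib ` Fv x)"
    unfolding is_irr_Hodge_filtration_def V_filtration_eq
    by (intro allI conjI restriction_kernel restriction_image)
  fix F assume F: "is_irr_Hodge_filtration n a F"
  define im where "im F' \<alpha> = {h. (\<forall>p. h p \<in> F' (\<alpha> + of_int p)) \<and> finite {p::int. h p \<noteq> \<zero>\<^bsub>hypH n a\<^esub>}}"
    for F' :: "real \<Rightarrow> (O_t \<Rightarrow> O_t) set set" and \<alpha>
  have eq: "im F \<alpha> = im (\<lambda>x. H.fib ` Fv x) \<alpha>" for \<alpha>
    using F restriction_image[of \<alpha>] unfolding is_irr_Hodge_filtration_def V_filtration_eq im_def by simp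
  have "0 \<in> Fv x" for x by (simp add: Fv_def Vn_closed)
  then have z: "(\<lambda>p. \<zero>\<^bsub>hypH n a\<^esub>) \<in> im (\<lambda>x. H.fib ` Fv x) \<alpha>" for \<alpha> by (simp add: im_def hypH_model)
  have rec: "F' \<alpha> = (\<lambda>h. h 0) ` im F' \<alpha>" if zF: "(\<lambda>p. \<zero>\<^bsub>hypH n a\<^esub>) \<in> im F' \<alpha>" for F' \<alpha>
  proof
    show "(\<lambda>h. h 0) ` im F' \<alpha> \<subseteq> F' \<alpha>"
    proof clarify
      fix h assume "h \<in> im F' \<alpha>"
      then have "h 0 \<in> F' (\<alpha> + of_int 0)" unfolding im_def by blast
      then show "h 0 \<in> F' \<alpha>" by simp
    qed
    show "F' \<alpha> \<subseteq> (\<lambda>h. h 0) ` im F' \<alpha>"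
    proof
      fix m assume m: "m \<in> F' \<alpha>"
      define h where "h = (\<lambda>p::int. if p = 0 then m else \<zero>\<^bsub>hypH n a\<^esub>)"
      have "finite {p. h p \<noteq> \<zero>\<^bsub>hypH n a\<^esub>}" by (rule finite_subset[of _ "{0}"]) (auto simp: h_def)
      then have "h \<in> im F' \<alpha>" using m zF by (auto simp: im_def h_def)
      then show "m \<in> (\<lambda>h. h 0) ` im F' \<alpha>" by (rule rev_image_eqI) (simp add: h_def)
    qed
  qed
  show "F = (\<lambda>x. H.fib ` Fv x)"
  proof
    fix \<alpha>
    have "F \<alpha> = (\<lambda>h. h 0) ` im F \<alpha>" by (rule rec) (unfold eq, rule z)
    also have "\<dots> = H.fib ` Fv \<alpha>" unfolding eq by (rule rec[OF z, symmetric])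
    finally show "F \<alpha> = H.fib ` Fv \<alpha>" .
  qed
qed

lemma hypH_O_simps:
  "carrier (hypH_O n a) = H.fib ` Vn n" "\<zero>\<^bsub>hypH_O n a\<^esub> = H.fib 0"
  "v \<in> Vn n \<Longrightarrow> w \<in> Vn n \<Longrightarrow> H.fib v \<oplus>\<^bsub>hypH_O n a\<^esub> H.fib w = H.fib (v + w)"
  using hypH_model by (simp_all add: hypH_O_def restrict_scalars_def)

lemma finsum_hypH_O:
  "finite I \<Longrightarrow> (\<And>i. i \<in> I \<Longrightarrow> v i \<in> Vn n) \<Longrightarrow> (\<And>i. i \<in> I \<Longrightarrow> f i = H.fib (v i)) \<Longrightarrow>
    finsum (hypH_O n a) f I = H.fib (\<Sum>i\<in>I. v i)"
  unfolding hypH_O_def finsum_restrict_scalars hypH_eq by (rule H.M_finsum_cong)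

lemma sum_unit_vec:
  "finite I \<Longrightarrow> (\<Sum>k\<in>I. (\<lambda>s. g k * unit_vec k s)) = (\<lambda>s. if s \<in> I then g s else 0)"
  for g :: "nat \<Rightarrow> 'b::comm_ring_1"
proof
  fix s assume I: "finite I"
  have "(\<Sum>k\<in>I. (\<lambda>s. g k * unit_vec k s)) s = (\<Sum>k\<in>I. g k * unit_vec k s)"
    using I by (induction I rule: finite_induct) simp_all
  also have "\<dots> = (\<Sum>k\<in>I. if k = s then g s else 0)"
    by (intro sum.cong) (auto simp: unit_vec_def)
  finally show "(\<Sum>k\<in>I. (\<lambda>s. g k * unit_vec k s)) s = (if s \<in> I then g s else 0)" using I by simp
qed

lemma Qbar_fib:
  assumes r: "r < n" shows "Qbar n a r = H.fib (\<lambda>s. (- of_nat n) ^ r * unit_vec r s)"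
proof -
  have c: "H.coords (Q r) = unit_vec r"
    using H.coords_comb[OF unit_vec_Vn[OF r]] r by (simp add: comb_unit_vec)
  have "(\<lambda>f. (- of_nat n) ^ r * Q r f) \<in> carrier D_Gm"
    by (rule D_Gm_comp[OF D_Gm_closed(2) Q_D_Gm])
  from H.M_class[OF this] show ?thesis
    unfolding Qbar_def hypH_class_def using H.coords_mult[OF Q_D_Gm, of "(- of_nat n) ^ r" r] c
    by (simp add: Q_def)
qed

lemma power_n_unit: "\<exists>u :: O_t. u * (- of_nat n) ^ k = 1"
proof -
  have e: "- of_nat n = (cst (- of_nat n) :: O_t)" by (simp add: single_uminus)
  have "(cst (- 1 / of_nat n) :: O_t) * (- of_nat n) = 1"
    unfolding e mult_single using n by simp
  then have "((cst (- 1 / of_nat n) :: O_t)) ^ k * (- of_nat n) ^ k = 1"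
    by (simp flip: power_mult_distrib)
  then show ?thesis by blast
qed

lemma F_irr_direct_sum:
  "is_internal_direct_sum (hypH_O n a) {k. k \<le> n - 1 \<and> j \<ge> nu n a \<alpha> k}
     (\<lambda>k. {f \<odot>\<^bsub>hypH_O n a\<^esub> Qbar n a k | f. f \<in> UNIV}) (F_irr n a (\<alpha> + of_int j))"
proof -
  define I where "I = {k. k \<le> n - 1 \<and> j \<ge> nu n a \<alpha> k}"
  have I: "finite I" by (simp add: I_def)
  have I_iff: "k \<in> I \<longleftrightarrow> k < n \<and> jump k \<le> \<alpha> + of_int j" for k
    using n by (auto simp: I_def nu_jump ceiling_le_iff)
  define g where "g k f = f * (- of_nat n) ^ k" for k and f :: O_t
  have el: "f \<odot>\<^bsub>hypH_O n a\<^esub> Qbar n a k = H.fib (\<lambda>s. g k f * unit_vec k s)" if "k \<in> I" for f k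
    using that by (simp add: I_iff Qbar_fib hypH_smult Vn_scale unit_vec_Vn g_def mult.assoc)
  have sum: "finsum (hypH_O n a) (\<lambda>k. x k) I = H.fib (\<lambda>s. if s \<in> I then g s (f s) else 0)"
    if "\<And>k. k \<in> I \<Longrightarrow> x k = f k \<odot>\<^bsub>hypH_O n a\<^esub> Qbar n a k" for x f
  proof -
    have "finsum (hypH_O n a) x I = H.fib (\<Sum>k\<in>I. (\<lambda>s. g k (f k) * unit_vec k s))"
      by (rule finsum_hypH_O[OF I]) (simp_all add: that el Vn_scale unit_vec_Vn I_iff)
    then show ?thesis by (simp only: sum_unit_vec[OF I])
  qed
  have gV: "(\<lambda>s. if s \<in> I then g s (f s) else 0) \<in> Vn n" for f by (simp add: Vn_def I_iff)
  have pick: "\<exists>f. \<forall>k\<in>I. x k = f k \<odot>\<^bsub>hypH_O n a\<^esub> Qbar n a k"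
    if "x \<in> (\<Pi> k\<in>I. {f \<odot>\<^bsub>hypH_O n a\<^esub> Qbar n a k | f. f \<in> UNIV})" for x
  proof -
    have "\<forall>k. \<exists>f. k \<in> I \<longrightarrow> x k = f \<odot>\<^bsub>hypH_O n a\<^esub> Qbar n a k" using that by blast
    from choice[OF this] show ?thesis by blast
  qed
  show ?thesis
    unfolding is_internal_direct_sum_def F_irr_eq I_def[symmetric]
  proof (intro conjI ballI impI)
    show "H.fib ` Fv (\<alpha> + of_int j) =
      {finsum (hypH_O n a) x I | x. x \<in> (\<Pi> k\<in>I. {f \<odot>\<^bsub>hypH_O n a\<^esub> Qbar n a k | f. f \<in> UNIV})}" (is "?l = ?r")
    proof
      show "?r \<subseteq> ?l"
      proof
        fix y assume "y \<in> ?r"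
        then obtain x where x: "y = finsum (hypH_O n a) x I"
          "x \<in> (\<Pi> k\<in>I. {f \<odot>\<^bsub>hypH_O n a\<^esub> Qbar n a k | f. f \<in> UNIV})" by blast
        obtain f where "\<forall>k\<in>I. x k = f k \<odot>\<^bsub>hypH_O n a\<^esub> Qbar n a k" using pick[OF x(2)] by blast
        then have "y = H.fib (\<lambda>s. if s \<in> I then g s (f s) else 0)" using sum[of x f] x(1) by simp
        moreover have "(\<lambda>s. if s \<in> I then g s (f s) else 0) \<in> Fv (\<alpha> + of_int j)"
          using gV by (simp add: Fv_def I_iff)
        ultimately show "y \<in> ?l" by blast
      qed
      show "?l \<subseteq> ?r"
      proof
        fix y assume "y \<in> ?l"
        then obtain v where v: "v \<in> Fv (\<alpha> + of_int j)" "y = H.fib v" by blast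
        have "\<forall>k. \<exists>u :: O_t. u * (- of_nat n) ^ k = 1" using power_n_unit by blast
        from choice[OF this] obtain u :: "nat \<Rightarrow> O_t" where u: "\<And>k. u k * (- of_nat n) ^ k = 1" by blast
        define x where "x = (\<lambda>k. (v k * u k) \<odot>\<^bsub>hypH_O n a\<^esub> Qbar n a k)"
        have "v s = 0" if "s \<notin> I" for s
          using v(1) that by (cases "s < n") (auto simp: I_iff Fv_def Vn_def)
        then have "(\<lambda>s. if s \<in> I then g s (v s * u s) else 0) = v"
          by (auto simp: g_def mult.assoc u fun_eq_iff)
        then have "finsum (hypH_O n a) x I = y"
          using sum[of x "\<lambda>k. v k * u k"] by (simp add: x_def v(2))
        then show "y \<in> ?r" by (auto simp: x_def)
      qed
    qed
    fix x k assume x: "x \<in> (\<Pi> k\<in>I. {f \<odot>\<^bsub>hypH_O n a\<^esub> Qbar n a k | f. f \<in> UNIV})"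
      and z: "finsum (hypH_O n a) (\<lambda>k. x k) I = \<zero>\<^bsub>hypH_O n a\<^esub>" and k: "k \<in> I"
    obtain f where f: "\<forall>k\<in>I. x k = f k \<odot>\<^bsub>hypH_O n a\<^esub> Qbar n a k" using pick[OF x] by blast
    then have "H.fib (\<lambda>s. if s \<in> I then g s (f s) else 0) = H.fib 0"
      using sum[of x f] z by (simp add: hypH_O_simps)
    then have "\<forall>s. (if s \<in> I then g s (f s) else 0) = 0" using fib_eq_zero[OF gV] by simp
    then have "g k (f k) = 0" using k by metis
    then have "x k = H.fib (\<lambda>s. 0 * unit_vec k s)" using f el[OF k] k by simp
    moreover have "(\<lambda>s. 0 * unit_vec k s) = (0 :: nat \<Rightarrow> O_t)" by (simp add: fun_eq_iff)
    ultimately show "x k = \<zero>\<^bsub>hypH_O n a\<^esub>" unfolding hypH_O_simps by (simp only:)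
  qed
qed

section \<open>The graded pieces\<close>

definition hyp_coord :: "(O_t \<Rightarrow> O_t) set \<Rightarrow> nat \<Rightarrow> O_t"
  where "hyp_coord C = (THE v. v \<in> Vn n \<and> C = H.fib v)"

lemma hyp_coord: "v \<in> Vn n \<Longrightarrow> hyp_coord (H.fib v) = v"
  unfolding hyp_coord_def using H.M_inj by (intro the_equality) auto

definition jumps :: "real \<Rightarrow> nat set"
  where "jumps x = {r. r < n \<and> jump r = x}"

lemma finite_jumps: "finite (jumps x)"
  by (simp add: jumps_def)

text \<open>The graded piece is described by the coordinates that jump exactly at \<open>x\<close>.\<close>

definition gr_coord :: "real \<Rightarrow> (O_t \<Rightarrow> O_t) set \<Rightarrow> nat \<Rightarrow> O_t"
  where "gr_coord x C r = (if r \<in> jumps x then hyp_coord C r else 0)"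

abbreviation "FM x \<equiv> (hypH_O n a)\<lparr>carrier := H.fib ` Fv x\<rparr>"

lemma FM_simps:
  "carrier (FM x) = H.fib ` Fv x" "v \<in> Vn n \<Longrightarrow> w \<in> Vn n \<Longrightarrow> H.fib v \<oplus>\<^bsub>FM x\<^esub> H.fib w = H.fib (v + w)"
  "v \<in> Vn n \<Longrightarrow> f \<odot>\<^bsub>FM x\<^esub> H.fib v = H.fib (\<lambda>r. f * v r)"
  by (simp_all add: hypH_O_simps hypH_smult)

lemma Fv_closed:
  "v \<in> Fv x \<Longrightarrow> w \<in> Fv x \<Longrightarrow> v + w \<in> Fv x" "v \<in> Fv x \<Longrightarrow> w \<in> Fv x \<Longrightarrow> v - w \<in> Fv x"
  "v \<in> Fv x \<Longrightarrow> (\<lambda>r. f * v r) \<in> Fv x" "0 \<in> Fv x"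
  unfolding Fv_def by (auto simp: Vn_def)

lemma gr_coord_fib: "v \<in> Vn n \<Longrightarrow> gr_coord x (H.fib v) = (\<lambda>r. if r \<in> jumps x then v r else 0)"
  by (rule ext) (simp add: gr_coord_def hyp_coord)

lemma additive_fibres_gr: "additive_fibres (FM x) (gr_coord x)"
proof
  fix C D assume "C \<in> carrier (FM x)" "D \<in> carrier (FM x)"
  then obtain v w where vw: "v \<in> Fv x" "C = H.fib v" "w \<in> Fv x" "D = H.fib w" by (auto simp: FM_simps)
  then have V: "v \<in> Vn n" "w \<in> Vn n" using Fv_Vn by auto
  have s: "C \<oplus>\<^bsub>FM x\<^esub> D = H.fib (v + w)" using V by (simp only: vw FM_simps)
  show "C \<oplus>\<^bsub>FM x\<^esub> D \<in> carrier (FM x)"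
    unfolding s FM_simps(1) by (rule imageI[OF Fv_closed(1)[OF vw(1,3)]])
  show "gr_coord x (C \<oplus>\<^bsub>FM x\<^esub> D) = gr_coord x C + gr_coord x D"
    unfolding s gr_coord_fib[OF Vn_closed(2)[OF V]] unfolding vw gr_coord_fib[OF V(1)] gr_coord_fib[OF V(2)]
    by (simp add: fun_eq_iff)
  have "H.fib (w - v) \<oplus>\<^bsub>FM x\<^esub> C = D"
    using FM_simps(2)[OF Vn_closed(3)[OF V(2,1)] V(1), of x] by (simp add: vw)
  then show "\<exists>z\<in>carrier (FM x). z \<oplus>\<^bsub>FM x\<^esub> C = D"
    unfolding FM_simps(1) using Fv_closed(2)[OF vw(3,1)] by blast
next
  show "carrier (FM x) \<noteq> {}" using Fv_closed(4) by (auto simp: FM_simps)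
qed

lemma below_F:
  "below (\<lambda>x. H.fib ` Fv x) x = H.fib ` {v \<in> Fv x. \<forall>r\<in>jumps x. v r = 0}"
proof
  show "below (\<lambda>x. H.fib ` Fv x) x \<subseteq> H.fib ` {v \<in> Fv x. \<forall>r\<in>jumps x. v r = 0}"
    by (fastforce simp: below_def Fv_def jumps_def)
  define y where "y = Max (insert (x - 1) (jump ` {r. r < n \<and> jump r < x}))"
  have "y < x" unfolding y_def by (subst Max_less_iff) auto
  have le: "jump r \<le> y" if "r < n" "jump r < x" for r
    unfolding y_def using that by (intro Max_ge) auto
  have "v \<in> Fv y" if "v \<in> Fv x" "\<forall>r\<in>jumps x. v r = 0" for v
  proof -
    have "jump r \<le> y" if r: "r < n" "v r \<noteq> 0" for r
    proof (rule le[OF r(1)])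
      have "jump r \<le> x" "jump r \<noteq> x" using \<open>v \<in> Fv x\<close> \<open>\<forall>r\<in>jumps x. v r = 0\<close> r by (auto simp: Fv_def jumps_def)
      then show "jump r < x" by simp
    qed
    then show ?thesis using that by (simp add: Fv_def)
  qed
  then show "H.fib ` {v \<in> Fv x. \<forall>r\<in>jumps x. v r = 0} \<subseteq> below (\<lambda>x. H.fib ` Fv x) x"
    using belowI[OF \<open>y < x\<close>, of _ "\<lambda>x. H.fib ` Fv x"] by blast
qed

context
  fixes x :: real
begin

interpretation G: additive_fibres "FM x" "gr_coord x" by (rule additive_fibres_gr)

lemma G_fib_zero: "G.fib 0 = below (F_irr n a) x"
proof -
  have "G.fib 0 = {C \<in> H.fib ` Fv x. gr_coord x C = 0}" by (simp add: G.fib_def)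
  also have "\<dots> = H.fib ` {v \<in> Fv x. \<forall>r\<in>jumps x. v r = 0}"
  proof -
    have "gr_coord x (H.fib v) = 0 \<longleftrightarrow> (\<forall>r\<in>jumps x. v r = 0)" if "v \<in> Fv x" for v
      unfolding gr_coord_fib[OF subsetD[OF Fv_Vn that]] by (auto simp: fun_eq_iff)
    then show ?thesis by blast
  qed
  finally show ?thesis by (simp add: F_irr_eq below_F)
qed

definition "Gr = {v :: nat \<Rightarrow> O_t. \<forall>r. r \<notin> jumps x \<longrightarrow> v r = 0}"

lemma Gr_Fv: "v \<in> Gr \<Longrightarrow> v \<in> Fv x"
  by (auto simp: Gr_def Fv_def Vn_def jumps_def)

lemma G_Im: "G.Im = Gr"
proof
  show "G.Im \<subseteq> Gr" by (auto simp: Gr_def gr_coord_def)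
  show "Gr \<subseteq> G.Im"
  proof
    fix v assume v: "v \<in> Gr"
    then have "gr_coord x (H.fib v) = v"
      unfolding gr_coord_fib[OF subsetD[OF Fv_Vn Gr_Fv[OF v]]] using v by (auto simp: Gr_def fun_eq_iff)
    then show "v \<in> G.Im" using Gr_Fv[OF v] by (intro image_eqI[of _ _ "H.fib v"]) (simp_all add: FM_simps)
  qed
qed

lemma gr_eq: "gr_F_irr n a x = quot_module (FM x) (G.fib 0)"
  unfolding gr_F_irr_def G_fib_zero by (simp add: F_irr_eq)

lemma gr_carrier: "carrier (gr_F_irr n a x) = G.fib ` Gr"
  unfolding gr_eq G.carrier_quot G_Im ..

lemma gr_zero: "\<zero>\<^bsub>gr_F_irr n a x\<^esub> = G.fib 0"
  unfolding gr_eq by (rule G.zero_quot)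

lemma gr_smult:
  assumes v: "v \<in> Gr" shows "f \<odot>\<^bsub>gr_F_irr n a x\<^esub> G.fib v = G.fib (\<lambda>r. f * v r)"
  unfolding gr_eq G.smult_quot
proof (rule G.induced_fib)
  show "v \<in> G.Im" using v by (simp only: G_Im)
  fix C assume C: "C \<in> carrier (FM x)" "gr_coord x C = v"
  then obtain w where w: "w \<in> Fv x" "C = H.fib w" by (auto simp: FM_simps)
  have W: "w \<in> Vn n" using w Fv_Vn by auto
  have "f \<odot>\<^bsub>FM x\<^esub> C = H.fib (\<lambda>r. f * w r)" unfolding w(2) by (rule FM_simps(3)[OF W])
  moreover have "gr_coord x (H.fib (\<lambda>r. f * w r)) = (\<lambda>r. f * v r)"
    unfolding C(2)[symmetric] w(2) gr_coord_fib[OF W] gr_coord_fib[OF Vn_scale[OF W]] by (simp add: fun_eq_iff)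
  ultimately show "f \<odot>\<^bsub>FM x\<^esub> C \<in> carrier (FM x) \<and> gr_coord x (f \<odot>\<^bsub>FM x\<^esub> C) = (\<lambda>r. f * v r)"
    using Fv_closed(3)[OF w(1)] by (simp only: FM_simps(1)) blast
qed

lemma gr_inj: "v \<in> Gr \<Longrightarrow> G.fib v = G.fib w \<longleftrightarrow> v = w"
  using G.fib_eq_iff G_Im by simp

lemma Gr_scale: "v \<in> Gr \<Longrightarrow> (\<lambda>r. f * v r) \<in> Gr"
  by (simp add: Gr_def)

lemma gr_jump: "carrier (gr_F_irr n a x) \<noteq> {\<zero>\<^bsub>gr_F_irr n a x\<^esub>} \<longleftrightarrow> jumps x \<noteq> {}"
proof
  assume ne: "carrier (gr_F_irr n a x) \<noteq> {\<zero>\<^bsub>gr_F_irr n a x\<^esub>}"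
  show "jumps x \<noteq> {}"
  proof
    assume "jumps x = {}"
    then have "Gr = {0}" by (auto simp: Gr_def fun_eq_iff)
    then show False using ne by (simp add: gr_carrier gr_zero)
  qed
next
  assume "jumps x \<noteq> {}"
  then obtain r where r: "r \<in> jumps x" by blast
  have u: "unit_vec r \<in> Gr" using r by (auto simp: Gr_def unit_vec_def)
  have "(unit_vec r :: nat \<Rightarrow> O_t) r \<noteq> 0 r" by (simp add: unit_vec_def)
  then have "G.fib (unit_vec r) \<noteq> G.fib 0" using gr_inj[OF u, of 0] by metis
  then show "carrier (gr_F_irr n a x) \<noteq> {\<zero>\<^bsub>gr_F_irr n a x\<^esub>}"
    using u unfolding gr_carrier gr_zero by blast
qed

lemma gr_lin_indep:
  assumes S: "finite S" "S \<subseteq> carrier (gr_F_irr n a x)" and w: "\<And>s. s \<in> S \<Longrightarrow> w s \<in> Gr \<and> s = G.fib (w s)"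
  shows "lin_indep (gr_F_irr n a x) S \<longleftrightarrow>
    (\<forall>c. (\<forall>r\<in>jumps x. (\<Sum>s\<in>S. c s * w s r) = 0) \<longrightarrow> (\<forall>s\<in>S. c s = 0))"
proof -
  have "(\<Oplus>\<^bsub>gr_F_irr n a x\<^esub>s\<in>S. c s \<odot>\<^bsub>gr_F_irr n a x\<^esub> s) = \<zero>\<^bsub>gr_F_irr n a x\<^esub>
      \<longleftrightarrow> (\<forall>r\<in>jumps x. (\<Sum>s\<in>S. c s * w s r) = 0)" for c
  proof -
    let ?v = "\<Sum>s\<in>S. (\<lambda>r. c s * w s r)"
    have im: "(\<lambda>r. c s * w s r) \<in> G.Im" if "s \<in> S" for s
      unfolding G_Im using w[OF that] by (intro Gr_scale) simp
    have "c s \<odot>\<^bsub>gr_F_irr n a x\<^esub> s = G.fib (\<lambda>r. c s * w s r)" if "s \<in> S" for s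
      using gr_smult[of "w s" "c s"] w[OF that] by metis
    then have "(\<Oplus>\<^bsub>gr_F_irr n a x\<^esub>s\<in>S. c s \<odot>\<^bsub>gr_F_irr n a x\<^esub> s) = G.fib ?v"
      unfolding gr_eq by (intro G.finsum_quot_cong[OF S(1) im])
    moreover have vG: "?v \<in> Gr" using G.Im_sum[of S "\<lambda>s r. c s * w s r", OF im] unfolding G_Im .
    moreover have app: "?v r = (\<Sum>s\<in>S. c s * w s r)" for r
      using S(1) by (induction S rule: finite_induct) simp_all
    ultimately have "(\<Oplus>\<^bsub>gr_F_irr n a x\<^esub>s\<in>S. c s \<odot>\<^bsub>gr_F_irr n a x\<^esub> s) = \<zero>\<^bsub>gr_F_irr n a x\<^esub> \<longleftrightarrow> ?v = 0"
      using gr_inj[OF vG, of 0] by (simp only: gr_zero)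
    also have "\<dots> \<longleftrightarrow> (\<forall>r\<in>jumps x. ?v r = 0)" using vG by (auto simp: Gr_def fun_eq_iff)
    finally show ?thesis by (simp only: app)
  qed
  then show ?thesis by (simp add: lin_indep_def)
qed

text \<open>The basis vectors that jump at \<open>x\<close> are independent, and \<open>linear_dependence\<close> bounds the size of any
  independent set.\<close>

lemma gr_rank: "rank (gr_F_irr n a x) = enat (card (jumps x))"
  unfolding rank_def
proof (rule antisym)
  show "(SUP S\<in>{S. finite S \<and> S \<subseteq> carrier (gr_F_irr n a x) \<and> lin_indep (gr_F_irr n a x) S}. enat (card S))
      \<le> enat (card (jumps x))"
  proof (rule SUP_least)
    fix S assume "S \<in> {S. finite S \<and> S \<subseteq> carrier (gr_F_irr n a x) \<and> lin_indep (gr_F_irr n a x) S}"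
    then have S: "finite S" "S \<subseteq> carrier (gr_F_irr n a x)" "lin_indep (gr_F_irr n a x) S" by auto
    have "\<forall>s. \<exists>v. s \<in> S \<longrightarrow> v \<in> Gr \<and> s = G.fib v" using S(2) unfolding gr_carrier by blast
    from choice[OF this] obtain w where w: "\<And>s. s \<in> S \<Longrightarrow> w s \<in> Gr \<and> s = G.fib (w s)" by blast
    have "\<not> card S > card (jumps x)"
    proof
      assume "card S > card (jumps x)"
      from linear_dependence[OF finite_jumps S(1) this, of w]
      obtain c where c: "\<exists>s\<in>S. c s \<noteq> 0" "\<forall>r\<in>jumps x. (\<Sum>s\<in>S. c s * w s r) = 0" by blast
      have "\<forall>c. (\<forall>r\<in>jumps x. (\<Sum>s\<in>S. c s * w s r) = 0) \<longrightarrow> (\<forall>s\<in>S. c s = 0)"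
        using gr_lin_indep[OF S(1,2), of w] w S(3) by simp
      then show False using c by blast
    qed
    then show "enat (card S) \<le> enat (card (jumps x))" by simp
  qed
  define S where "S = (\<lambda>r. G.fib (unit_vec r)) ` jumps x"
  have u: "unit_vec r \<in> Gr" if "r \<in> jumps x" for r using that by (auto simp: Gr_def unit_vec_def)
  have inj: "inj_on (\<lambda>r. G.fib (unit_vec r)) (jumps x)"
  proof (rule inj_onI)
    fix r s assume *: "r \<in> jumps x" "G.fib (unit_vec r) = G.fib (unit_vec s)"
    then have "(unit_vec r :: nat \<Rightarrow> O_t) = unit_vec s" using gr_inj[OF u[OF *(1)]] by simp
    then have "(unit_vec r :: nat \<Rightarrow> O_t) r = unit_vec s r" by simp
    then show "r = s" by (simp add: unit_vec_def split: if_splits)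
  qed
  have S: "finite S" "S \<subseteq> carrier (gr_F_irr n a x)"
    using finite_jumps u unfolding gr_carrier by (auto simp: S_def)
  define idx where "idx = the_inv_into (jumps x) (\<lambda>r. G.fib (unit_vec r))"
  have idx: "idx (G.fib (unit_vec r)) = r" if "r \<in> jumps x" for r
    unfolding idx_def using the_inv_into_f_f[OF inj that] by simp
  have w: "unit_vec (idx s) \<in> Gr \<and> s = G.fib (unit_vec (idx s))" if "s \<in> S" for s
    using that u idx by (auto simp: S_def)
  have "\<forall>c :: _ \<Rightarrow> O_t. (\<forall>r\<in>jumps x. (\<Sum>s\<in>S. c s * unit_vec (idx s) r) = 0) \<longrightarrow> (\<forall>s\<in>S. c s = 0)"
  proof (intro allI impI ballI)
    fix c :: "_ \<Rightarrow> O_t" and s assume c: "\<forall>r\<in>jumps x. (\<Sum>s\<in>S. c s * unit_vec (idx s) r) = 0" and s: "s \<in> S"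
    from s obtain r where r: "r \<in> jumps x" "s = G.fib (unit_vec r)" by (auto simp: S_def)
    have "0 = (\<Sum>s\<in>S. c s * unit_vec (idx s) r)" using c r by simp
    also have "\<dots> = (\<Sum>q\<in>jumps x. c (G.fib (unit_vec q)) * unit_vec q r)"
      unfolding S_def by (subst sum.reindex[OF inj]) (simp add: idx)
    also have "\<dots> = (\<Sum>q\<in>jumps x. if q = r then c s else 0)"
      by (intro sum.cong refl) (auto simp: unit_vec_def r(2))
    also have "\<dots> = c s" using r finite_jumps by simp
    finally show "c s = 0" by simp
  qed
  then have "lin_indep (gr_F_irr n a x) S"
    using gr_lin_indep[OF S, of "\<lambda>s. unit_vec (idx s)"] w by simp
  then have mem: "S \<in> {S. finite S \<and> S \<subseteq> carrier (gr_F_irr n a x) \<and> lin_indep (gr_F_irr n a x) S}" using S by simp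
  have "card S = card (jumps x)" unfolding S_def by (rule card_image[OF inj])
  then show "enat (card (jumps x))
      \<le> (SUP S\<in>{S. finite S \<and> S \<subseteq> carrier (gr_F_irr n a x) \<and> lin_indep (gr_F_irr n a x) S}. enat (card S))"
    using SUP_upper[OF mem, of "\<lambda>S. enat (card S)"] by simp
qed

end

lemma rho_jump: "rho n a (Suc r) + (- 1 - \<gamma>) = jump r"
  by (simp add: rho_def jump_def)

lemma jumps_image: "{k \<in> {1..n}. rho n a k + (- 1 - \<gamma>) = x} = Suc ` jumps x"
proof (intro equalityI subsetI)
  fix k assume "k \<in> {k \<in> {1..n}. rho n a k + (- 1 - \<gamma>) = x}"
  then have k: "1 \<le> k" "k \<le> n" "rho n a k + (- 1 - \<gamma>) = x" by auto
  then obtain r where "k = Suc r" by (cases k) auto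
  then show "k \<in> Suc ` jumps x" using k by (simp add: rho_jump jumps_def)
next
  fix k assume "k \<in> Suc ` jumps x"
  then show "k \<in> {k \<in> {1..n}. rho n a k + (- 1 - \<gamma>) = x}"
    by (auto simp: jumps_def rho_jump simp del: of_nat_Suc)
qed

lemma jumping_numbers_eq:
  "jumping_numbers n a = {rho n a k + (- 1 - \<gamma>) | k. k \<in> {1..n}}"
proof -
  have "x \<in> jumping_numbers n a \<longleftrightarrow> {k \<in> {1..n}. rho n a k + (- 1 - \<gamma>) = x} \<noteq> {}" for x
    unfolding jumping_numbers_def mem_Collect_eq gr_jump jumps_image by simp
  then show ?thesis by (intro Set.set_eqI) auto
qed

lemma irr_Hodge_number_eq:
  "irr_Hodge_number n a x = enat (card {k \<in> {1..n}. rho n a k + (- 1 - \<gamma>) = x})"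
  unfolding irr_Hodge_number_def gr_rank jumps_image by (simp add: card_image)

end

theorem theorem4p7:
  fixes n :: nat and a :: "nat \<Rightarrow> real"
  assumes "n \<ge> 1"
    and "\<forall>i\<in>{1..n}. 0 \<le> a i \<and> a i < 1"
    and "\<forall>i\<in>{1..n}. \<forall>j\<in>{1..n}. i \<le> j \<longrightarrow> a i \<le> a j"
  shows "(\<exists>c::real.
            jumping_numbers n a = {rho n a k + c | k. k \<in> {1..n}} \<and>
            (\<forall>x\<in>jumping_numbers n a.
               irr_Hodge_number n a x = enat (card {k\<in>{1..n}. rho n a k + c = x})))
       \<and> (\<forall>(\<alpha>::real) (j::int).
            is_internal_direct_sum (hypH_O n a)
              {k. k \<le> n - 1 \<and> j \<ge> nu n a \<alpha> k}
              (\<lambda>k. {f \<odot>\<^bsub>hypH_O n a\<^esub> Qbar n a k | f. f \<in> UNIV})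
              (F_irr n a (\<alpha> + of_int j)))"
proof -
  interpret hypergeometric n a
    using assms by unfold_locales auto
  show ?thesis
    using jumping_numbers_eq irr_Hodge_number_eq F_irr_direct_sum by blast
qed

end
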